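(* Let $h^*$ be an additive multiplicative generalized cohomology theory. Let $M$ be a smooth $h^*$-oriented manifold of dimension $m$ and let $e_{TM}\in h^m(M)$ be the Euler class of the tangent bundle of $M$. For $n\geq0$, let $\vee_nS^1$ be the wedge of $n$ circles, let $ev_n:\mathrm{map}(\vee_nS^1,M)\to M$ be the evaluation map at the base point, and let $\sigma_n:M\hookrightarrow\mathrm{map}(\vee_nS^1,M)$ be its section sending a point $x$ to the constant map with value $x$. Then for any $b\in h^*(\mathrm{map}(\vee_nS^1,M))$, $$b\cup ev_n^*(e_{TM})=ev_n^*\circ\sigma_n^*(b)\cup ev_n^*(e_{TM}).$$
   Context: Manifolds are without boundary. The Euler class of an $h^*$-oriented vector bundle is the restriction of its Thom class to the zero section. $\mathrm{map}(X,M)$ is the space of continuous maps. For $n=0$ the wedge is a point. *)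

theory Defs
  imports "HOL-Analysis.Analysis" "HOL-Homology.Homology" "HOL-Library.Equipollence"
begin

section \<open>Generalized cohomology theories\<close>

text \<open>
  A cohomology theory on pairs \<open>(X, A)\<close> of spaces whose points lie in a universe \<open>'u\<close>.
  As in the library's homology groups, the abelian groups are written multiplicatively.
  For \<open>f : (X, A) \<rightarrow> (Y, B)\<close> the map \<open>Ind h k X A Y B f\<close> is
  \<open>f\<^sup>* : h\<^sup>k(Y, B) \<rightarrow> h\<^sup>k(X, A)\<close>; \<open>Bdy h k X A\<close> is the connecting map
  \<open>h\<^sup>k(A) \<rightarrow> h\<^sup>k\<^sup>+\<^sup>1(X, A)\<close>; and \<open>Cup h X A B p q\<close> is the cup product
  \<open>h\<^sup>p(X, A) \<times> h\<^sup>q(X, B) \<rightarrow> h\<^sup>p\<^sup>+\<^sup>q(X, A \<union> B)\<close>.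
\<close>

record ('u, 'c) cohomology =
  Grp :: "int \<Rightarrow> 'u topology \<Rightarrow> 'u set \<Rightarrow> 'c monoid"
  Ind :: "int \<Rightarrow> 'u topology \<Rightarrow> 'u set \<Rightarrow> 'u topology \<Rightarrow> 'u set \<Rightarrow> ('u \<Rightarrow> 'u) \<Rightarrow> 'c \<Rightarrow> 'c"
  Bdy :: "int \<Rightarrow> 'u topology \<Rightarrow> 'u set \<Rightarrow> 'c \<Rightarrow> 'c"
  Cup :: "'u topology \<Rightarrow> 'u set \<Rightarrow> 'u set \<Rightarrow> int \<Rightarrow> int \<Rightarrow> 'c \<Rightarrow> 'c \<Rightarrow> 'c"
  One :: "'u topology \<Rightarrow> 'c"

definition pair_map ::
  "'a topology \<Rightarrow> 'a set \<Rightarrow> 'b topology \<Rightarrow> 'b set \<Rightarrow> ('a \<Rightarrow> 'b) \<Rightarrow> bool" where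
  "pair_map X A Y B f \<longleftrightarrow>
     A \<subseteq> topspace X \<and> B \<subseteq> topspace Y \<and> continuous_map X Y f \<and> f ` A \<subseteq> B"

locale cohomology_theory =
  fixes h :: "('u, 'c) cohomology"
  assumes group:
    "\<And>k X A. A \<subseteq> topspace X \<Longrightarrow> comm_group (Grp h k X A)"
  and ind_hom:
    "\<And>k X A Y B f. pair_map X A Y B f \<Longrightarrow> Ind h k X A Y B f \<in> hom (Grp h k Y B) (Grp h k X A)"
  and ind_id:
    "\<And>k X A x. \<lbrakk>A \<subseteq> topspace X; x \<in> carrier (Grp h k X A)\<rbrakk> \<Longrightarrow> Ind h k X A X A id x = x"
  and ind_comp:
    "\<And>k X A Y B Z C f g z.
       \<lbrakk>pair_map X A Y B f; pair_map Y B Z C g; z \<in> carrier (Grp h k Z C)\<rbrakk>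
       \<Longrightarrow> Ind h k X A Z C (g \<circ> f) z = Ind h k X A Y B f (Ind h k Y B Z C g z)"
  and homotopy:
    "\<And>k X A Y B f g y.
       \<lbrakk>pair_map X A Y B f; pair_map X A Y B g; homotopic_with (\<lambda>u. u ` A \<subseteq> B) X Y f g;
        y \<in> carrier (Grp h k Y B)\<rbrakk>
       \<Longrightarrow> Ind h k X A Y B f y = Ind h k X A Y B g y"
  and bdy_hom:
    "\<And>k X A. A \<subseteq> topspace X
       \<Longrightarrow> Bdy h k X A \<in> hom (Grp h k (subtopology X A) {}) (Grp h (k + 1) X A)"
  and bdy_natural:
    "\<And>k X A Y B f y.
       \<lbrakk>pair_map X A Y B f; y \<in> carrier (Grp h k (subtopology Y B) {})\<rbrakk>
       \<Longrightarrow> Bdy h k X A (Ind h k (subtopology X A) {} (subtopology Y B) {} f y)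
         = Ind h (k + 1) X A Y B f (Bdy h k Y B y)"
  and exact_space:
    "\<And>k X A. A \<subseteq> topspace X
       \<Longrightarrow> Ind h k X {} X A id ` carrier (Grp h k X A)
         = kernel (Grp h k X {}) (Grp h k (subtopology X A) {}) (Ind h k (subtopology X A) {} X {} id)"
  and exact_subspace:
    "\<And>k X A. A \<subseteq> topspace X
       \<Longrightarrow> Ind h k (subtopology X A) {} X {} id ` carrier (Grp h k X {})
         = kernel (Grp h k (subtopology X A) {}) (Grp h (k + 1) X A) (Bdy h k X A)"
  and exact_pair:
    "\<And>k X A. A \<subseteq> topspace X
       \<Longrightarrow> Bdy h k X A ` carrier (Grp h k (subtopology X A) {})
         = kernel (Grp h (k + 1) X A) (Grp h (k + 1) X {}) (Ind h (k + 1) X {} X A id)"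
  and excision:
    "\<And>k X A U. \<lbrakk>A \<subseteq> topspace X; U \<subseteq> A; X closure_of U \<subseteq> X interior_of A\<rbrakk>
       \<Longrightarrow> Ind h k (subtopology X (topspace X - U)) (A - U) X A id
         \<in> iso (Grp h k X A) (Grp h k (subtopology X (topspace X - U)) (A - U))"

text \<open>
  Additivity: if \<open>X\<close> is the disjoint union of the open subspaces in \<open>\<U>\<close>, then
  \<open>h\<^sup>k(X, A)\<close> is the product of the groups \<open>h\<^sup>k(U, A \<inter> U)\<close> via the restrictions.
\<close>

locale additive_cohomology_theory = cohomology_theory +
  assumes additive:
    "\<And>k X A \<U> y.
       \<lbrakk>A \<subseteq> topspace X; \<And>U. U \<in> \<U> \<Longrightarrow> openin X U; pairwise disjnt \<U>; \<Union>\<U> = topspace X;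
        \<And>U. U \<in> \<U> \<Longrightarrow> y U \<in> carrier (Grp h k (subtopology X U) (A \<inter> U))\<rbrakk>
       \<Longrightarrow> \<exists>!x. x \<in> carrier (Grp h k X A)
             \<and> (\<forall>U\<in>\<U>. Ind h k (subtopology X U) (A \<inter> U) X A id x = y U)"

definition excisive :: "('u, 'c) cohomology \<Rightarrow> 'u topology \<Rightarrow> 'u set \<Rightarrow> 'u set \<Rightarrow> bool" where
  "excisive h X A B \<longleftrightarrow> A \<subseteq> topspace X \<and> B \<subseteq> topspace X \<and>
     (\<forall>k. Ind h k (subtopology X A) (A \<inter> B) (subtopology X (A \<union> B)) B id
        \<in> iso (Grp h k (subtopology X (A \<union> B)) B) (Grp h k (subtopology X A) (A \<inter> B)))"

text \<open>
  Compatibility with the connecting maps: the class \<open>z\<close> below is the one that corresponds to a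
  product on \<open>(A, A \<inter> B)\<close> (respectively \<open>(B, A \<inter> B)\<close>) under the excision isomorphism, and the
  connecting map of the triple \<open>B \<subseteq> A \<union> B \<subseteq> X\<close> is restriction to \<open>A \<union> B\<close> followed by \<open>Bdy\<close>.
  Graded commutativity is not imposed, which is why both one-sided laws are listed.
\<close>

locale multiplicative_cohomology_theory = cohomology_theory +
  assumes cup_closed:
    "\<And>X A B p q x y.
       \<lbrakk>excisive h X A B; x \<in> carrier (Grp h p X A); y \<in> carrier (Grp h q X B)\<rbrakk>
       \<Longrightarrow> Cup h X A B p q x y \<in> carrier (Grp h (p + q) X (A \<union> B))"
  and cup_add_left:
    "\<And>X A B p q x x' y.
       \<lbrakk>excisive h X A B; x \<in> carrier (Grp h p X A); x' \<in> carrier (Grp h p X A);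
        y \<in> carrier (Grp h q X B)\<rbrakk>
       \<Longrightarrow> Cup h X A B p q (x \<otimes>\<^bsub>Grp h p X A\<^esub> x') y
         = Cup h X A B p q x y \<otimes>\<^bsub>Grp h (p + q) X (A \<union> B)\<^esub> Cup h X A B p q x' y"
  and cup_add_right:
    "\<And>X A B p q x y y'.
       \<lbrakk>excisive h X A B; x \<in> carrier (Grp h p X A); y \<in> carrier (Grp h q X B);
        y' \<in> carrier (Grp h q X B)\<rbrakk>
       \<Longrightarrow> Cup h X A B p q x (y \<otimes>\<^bsub>Grp h q X B\<^esub> y')
         = Cup h X A B p q x y \<otimes>\<^bsub>Grp h (p + q) X (A \<union> B)\<^esub> Cup h X A B p q x y'"
  and cup_natural:
    "\<And>X A B X' A' B' f p q x y.
       \<lbrakk>excisive h X A B; excisive h X' A' B'; pair_map X A X' A' f; pair_map X B X' B' f;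
        x \<in> carrier (Grp h p X' A'); y \<in> carrier (Grp h q X' B')\<rbrakk>
       \<Longrightarrow> Ind h (p + q) X (A \<union> B) X' (A' \<union> B') f (Cup h X' A' B' p q x y)
         = Cup h X A B p q (Ind h p X A X' A' f x) (Ind h q X B X' B' f y)"
  and one_closed:
    "\<And>X. One h X \<in> carrier (Grp h 0 X {})"
  and one_natural:
    "\<And>X Y f. continuous_map X Y f \<Longrightarrow> Ind h 0 X {} Y {} f (One h Y) = One h X"
  and cup_one_left:
    "\<And>X A q x. \<lbrakk>A \<subseteq> topspace X; x \<in> carrier (Grp h q X A)\<rbrakk>
       \<Longrightarrow> Cup h X {} A 0 q (One h X) x = x"
  and cup_one_right:
    "\<And>X A p x. \<lbrakk>A \<subseteq> topspace X; x \<in> carrier (Grp h p X A)\<rbrakk>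
       \<Longrightarrow> Cup h X A {} p 0 x (One h X) = x"
  and cup_assoc:
    "\<And>X A B C p q r x y z.
       \<lbrakk>excisive h X A B; excisive h X (A \<union> B) C; excisive h X B C; excisive h X A (B \<union> C);
        x \<in> carrier (Grp h p X A); y \<in> carrier (Grp h q X B); z \<in> carrier (Grp h r X C)\<rbrakk>
       \<Longrightarrow> Cup h X (A \<union> B) C (p + q) r (Cup h X A B p q x y) z
         = Cup h X A (B \<union> C) p (q + r) x (Cup h X B C q r y z)"
  and cup_bdy_left:
    "\<And>X A B p q a y z.
       \<lbrakk>excisive h X A B; a \<in> carrier (Grp h p (subtopology X A) {});
        y \<in> carrier (Grp h q X B); z \<in> carrier (Grp h (p + q) (subtopology X (A \<union> B)) B);
        Ind h (p + q) (subtopology X A) (A \<inter> B) (subtopology X (A \<union> B)) B id z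
          = Cup h (subtopology X A) {} (A \<inter> B) p q a
              (Ind h q (subtopology X A) (A \<inter> B) X B id y)\<rbrakk>
       \<Longrightarrow> Cup h X A B (p + 1) q (Bdy h p X A a) y
         = Bdy h (p + q) X (A \<union> B)
             (Ind h (p + q) (subtopology X (A \<union> B)) {} (subtopology X (A \<union> B)) B id z)"
  and cup_bdy_right:
    "\<And>X A B p q x b z.
       \<lbrakk>excisive h X A B; x \<in> carrier (Grp h p X A);
        b \<in> carrier (Grp h q (subtopology X B) {});
        z \<in> carrier (Grp h (p + q) (subtopology X (A \<union> B)) A);
        Ind h (p + q) (subtopology X B) (A \<inter> B) (subtopology X (A \<union> B)) A id z
          = Cup h (subtopology X B) (A \<inter> B) {} p q
              (Ind h p (subtopology X B) (A \<inter> B) X A id x) b\<rbrakk>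
       \<Longrightarrow> Cup h X A B p (q + 1) x (Bdy h q X B b)
         = (let w = Bdy h (p + q) X (A \<union> B)
                      (Ind h (p + q) (subtopology X (A \<union> B)) {} (subtopology X (A \<union> B)) A id z)
            in if even p then w else inv\<^bsub>Grp h (p + q + 1) X (A \<union> B)\<^esub> w)"


section \<open>Evaluating a theory on spaces of other types\<close>

text \<open>
  A space \<open>X\<close> of any type with at most as many points as \<open>'u\<close> has a homeomorphic copy in the
  universe. The cohomology of \<open>X\<close> is that of a chosen copy; another choice gives canonically
  isomorphic groups. When \<open>X\<close> has more points than \<open>'u\<close>, these definitions mean nothing.
\<close>

definition encode :: "'a topology \<Rightarrow> 'a \<Rightarrow> 'u" where
  "encode X = (SOME i. inj_on i (topspace X))"

definition copy :: "'a topology \<Rightarrow> 'u topology" where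
  "copy X = pullback_topology (encode X ` topspace X) (inv_into (topspace X) (encode X)) X"

definition coh :: "('u, 'c) cohomology \<Rightarrow> int \<Rightarrow> 'a topology \<Rightarrow> 'a set \<Rightarrow> 'c monoid" where
  "coh h k X A = Grp h k (copy X) (encode X ` A)"

definition coh_ind ::
  "('u, 'c) cohomology \<Rightarrow> int \<Rightarrow> 'a topology \<Rightarrow> 'a set \<Rightarrow> 'b topology \<Rightarrow> 'b set
     \<Rightarrow> ('a \<Rightarrow> 'b) \<Rightarrow> 'c \<Rightarrow> 'c" where
  "coh_ind h k X A Y B f =
     Ind h k (copy X) (encode X ` A) (copy Y) (encode Y ` B)
       (encode Y \<circ> f \<circ> inv_into (topspace X) (encode X))"

definition coh_cup ::
  "('u, 'c) cohomology \<Rightarrow> 'a topology \<Rightarrow> 'a set \<Rightarrow> 'a set \<Rightarrow> int \<Rightarrow> int \<Rightarrow> 'c \<Rightarrow> 'c \<Rightarrow> 'c" where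
  "coh_cup h X A B p q = Cup h (copy X) (encode X ` A) (encode X ` B) p q"

lemma inj_on_encode:
  assumes "topspace X \<lesssim> (UNIV :: 'u set)"
  shows "inj_on (encode X :: 'a \<Rightarrow> 'u) (topspace X)"
  using assms unfolding lepoll_def encode_def by (metis (no_types, lifting) someI_ex)

lemma homeomorphic_map_encode:
  assumes "topspace X \<lesssim> (UNIV :: 'u set)"
  shows "homeomorphic_map X (copy X :: 'u topology) (encode X)"
proof -
  let ?i = "encode X :: 'a \<Rightarrow> 'u" and ?j = "inv_into (topspace X) (encode X :: 'a \<Rightarrow> 'u)"
  note inj = inj_on_encode[OF assms]
  have ji: "?j (?i x) = x" if "x \<in> topspace X" for x
    using inj that by simp
  have top: "topspace (copy X :: 'u topology) = ?i ` topspace X"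
    unfolding copy_def topspace_pullback_topology using ji by auto
  have "continuous_map X (copy X) ?i"
    unfolding copy_def
  proof (rule continuous_map_pullback')
    show "continuous_map X X (?j \<circ> ?i)"
      by (rule continuous_map_eq[OF continuous_map_id]) (simp add: ji)
  qed auto
  moreover have "continuous_map (copy X) X (id \<circ> ?j)"
    unfolding copy_def by (rule continuous_map_pullback) simp
  ultimately have "homeomorphic_maps X (copy X) ?i ?j"
    unfolding homeomorphic_maps_def top by (auto simp: ji)
  then show ?thesis
    using homeomorphic_map_maps by blast
qed


section \<open>Thom classes and Euler classes\<close>

text \<open>
  For a rank \<open>r\<close> vector bundle with total space \<open>E\<close>, base \<open>B\<close>, projection \<open>p\<close> and zero section
  \<open>z\<close>, a Thom class is a \<open>t \<in> h\<^sup>r(E, E - z(B))\<close> whose restriction to the fibre over each point \<open>x\<close>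
  freely generates the \<open>h\<^sup>*({x})\<close>-module \<open>h\<^sup>*(E\<^sub>x, E\<^sub>x - 0)\<close>.
\<close>

definition thom_class ::
  "('u, 'c) cohomology \<Rightarrow> int \<Rightarrow> 'e topology \<Rightarrow> 'b topology \<Rightarrow> ('e \<Rightarrow> 'b) \<Rightarrow> ('b \<Rightarrow> 'e) \<Rightarrow> 'c \<Rightarrow> bool"
  where
  "thom_class h r E B p z t \<longleftrightarrow>
     t \<in> carrier (coh h r E (topspace E - z ` topspace B)) \<and>
     (\<forall>x\<in>topspace B.
        let F = subtopology E {\<xi> \<in> topspace E. p \<xi> = x};
            F0 = topspace F - {z x};
            P = subtopology B {x};
            tx = coh_ind h r F F0 E (topspace E - z ` topspace B) id t
        in \<forall>k. bij_betw (\<lambda>a. coh_cup h F {} F0 k r (coh_ind h k F {} P {} p a) tx)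
                 (carrier (coh h k P {})) (carrier (coh h (k + r) F F0)))"

definition euler_class ::
  "('u, 'c) cohomology \<Rightarrow> int \<Rightarrow> 'e topology \<Rightarrow> 'b topology \<Rightarrow> ('b \<Rightarrow> 'e) \<Rightarrow> 'c \<Rightarrow> 'c" where
  "euler_class h r E B z t = coh_ind h r B {} E (topspace E - z ` topspace B) z t"


section \<open>Quotient spaces, wedges of circles, mapping spaces\<close>

definition quotient_topology :: "'a topology \<Rightarrow> ('a \<Rightarrow> 'b) \<Rightarrow> 'b topology" where
  "quotient_topology X f =
     topology (\<lambda>U. U \<subseteq> f ` topspace X \<and> openin X {x \<in> topspace X. f x \<in> U})"

lemma openin_quotient_topology:
  "openin (quotient_topology X f) U \<longleftrightarrow>
     U \<subseteq> f ` topspace X \<and> openin X {x \<in> topspace X. f x \<in> U}"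
proof -
  have "{x \<in> topspace X. f x \<in> S \<inter> T} =
      {x \<in> topspace X. f x \<in> S} \<inter> {x \<in> topspace X. f x \<in> T}" for S T
    by auto
  moreover have "{x \<in> topspace X. f x \<in> \<Union>\<K>} = (\<Union>S\<in>\<K>. {x \<in> topspace X. f x \<in> S})" for \<K>
    by auto
  ultimately have "istopology (\<lambda>U. U \<subseteq> f ` topspace X \<and> openin X {x \<in> topspace X. f x \<in> U})"
    unfolding istopology_def by (auto intro!: openin_Int openin_Union)
  then show ?thesis
    by (simp add: quotient_topology_def)
qed

lemma quotient_map_quotient_topology: "quotient_map X (quotient_topology X f) f"
proof -
  have "topspace (quotient_topology X f) = f ` topspace X"
  proof
    show "topspace (quotient_topology X f) \<subseteq> f ` topspace X"
      by (metis openin_quotient_topology openin_topspace)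
    have "{x \<in> topspace X. f x \<in> f ` topspace X} = topspace X"
      by auto
    then show "f ` topspace X \<subseteq> topspace (quotient_topology X f)"
      by (metis openin_quotient_topology openin_subset openin_topspace order_refl)
  qed
  then show ?thesis
    by (auto simp: quotient_map_def openin_quotient_topology)
qed

abbreviation circle :: "complex topology" where
  "circle \<equiv> top_of_set (sphere 0 1)"

text \<open>
  \<open>n\<close> circles, numbered \<open>0, \<dots>, n - 1\<close>, and one extra point with index \<open>n\<close>, all base points being
  identified. The extra point only matters for \<open>n = 0\<close>, where it makes the wedge a point.
\<close>

definition wedge_base :: "nat \<Rightarrow> nat \<times> complex" where
  "wedge_base n = (n, 1)"

definition wedge_circles :: "nat \<Rightarrow> (nat \<times> complex) topology" where
  "wedge_circles n =
     quotient_topology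
       (sum_topology (\<lambda>i. if i < n then circle else subtopology circle {1}) {..n})
       (\<lambda>(i, z). if z = 1 then wedge_base n else (i, z))"

text \<open>
  The compact-open topology. Continuous maps are made extensional so that equality of points of
  the mapping space is equality of maps on \<open>X\<close>.
\<close>

definition mapping_space :: "'a topology \<Rightarrow> 'b topology \<Rightarrow> ('a \<Rightarrow> 'b) topology" where
  "mapping_space X Y =
     (let C = {f \<in> extensional (topspace X). continuous_map X Y f}
      in topology_generated_by {{f \<in> C. f ` K \<subseteq> U} | K U. compactin X K \<and> openin Y U})"

definition const_map :: "'a topology \<Rightarrow> 'b \<Rightarrow> 'a \<Rightarrow> 'b" where
  "const_map X y = (\<lambda>w\<in>topspace X. y)"


section \<open>Smooth manifolds and their tangent bundles\<close>

definition partial_deriv :: "nat \<Rightarrow> ((nat \<Rightarrow> real) \<Rightarrow> real) \<Rightarrow> (nat \<Rightarrow> real) \<Rightarrow> real" where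
  "partial_deriv j f x = deriv (\<lambda>s. f (x(j := s))) (x j)"

text \<open>\<open>C\<^sup>k\<close> functions on an open subset \<open>S\<close> of \<open>Euclidean_space m\<close>.\<close>

primrec ck_on :: "nat \<Rightarrow> nat \<Rightarrow> (nat \<Rightarrow> real) set \<Rightarrow> ((nat \<Rightarrow> real) \<Rightarrow> real) \<Rightarrow> bool" where
  "ck_on m 0 S f \<longleftrightarrow> continuous_map (subtopology (Euclidean_space m) S) euclideanreal f"
| "ck_on m (Suc k) S f \<longleftrightarrow>
     continuous_map (subtopology (Euclidean_space m) S) euclideanreal f \<and>
     (\<forall>j<m. (\<forall>x\<in>S. (\<lambda>s. f (x(j := s))) differentiable (at (x j))) \<and>
            ck_on m k S (partial_deriv j f))"

definition smooth_on :: "nat \<Rightarrow> (nat \<Rightarrow> real) set \<Rightarrow> ((nat \<Rightarrow> real) \<Rightarrow> real) \<Rightarrow> bool" where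
  "smooth_on m S f \<longleftrightarrow> (\<forall>k. ck_on m k S f)"

text \<open>A chart consists of its domain and its coordinate map.\<close>

type_synonym 'p chart = "'p set \<times> ('p \<Rightarrow> nat \<Rightarrow> real)"

definition is_chart :: "nat \<Rightarrow> 'p topology \<Rightarrow> 'p chart \<Rightarrow> bool" where
  "is_chart m M c \<longleftrightarrow> openin M (fst c) \<and>
     (\<exists>V. openin (Euclidean_space m) V \<and>
          homeomorphic_map (subtopology M (fst c)) (subtopology (Euclidean_space m) V) (snd c))"

definition transition :: "'p chart \<Rightarrow> 'p chart \<Rightarrow> (nat \<Rightarrow> real) \<Rightarrow> nat \<Rightarrow> real" where
  "transition c d = snd d \<circ> inv_into (fst c) (snd c)"

definition smooth_manifold :: "nat \<Rightarrow> 'p topology \<Rightarrow> 'p chart set \<Rightarrow> bool" where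
  "smooth_manifold m M \<A> \<longleftrightarrow>
     Hausdorff_space M \<and> second_countable M \<and>
     (\<forall>c\<in>\<A>. is_chart m M c) \<and> (\<Union>c\<in>\<A>. fst c) = topspace M \<and>
     (\<forall>c\<in>\<A>. \<forall>d\<in>\<A>. \<forall>i<m.
        smooth_on m (snd c ` (fst c \<inter> fst d)) (\<lambda>y. transition c d y i))"

text \<open>
  A tangent vector at \<open>x\<close> is represented by \<open>x\<close> together with the family of its coordinate vectors
  in all charts around \<open>x\<close>; \<open>tangent_vector m \<A> c x v\<close> is the one with coordinates \<open>v\<close> in the chart
  \<open>c\<close>. The tangent bundle is glued from the products \<open>U \<times> \<real>\<^sup>m\<close> over the chart domains \<open>U\<close>.
\<close>

definition transition_deriv ::
  "nat \<Rightarrow> 'p chart \<Rightarrow> 'p chart \<Rightarrow> 'p \<Rightarrow> (nat \<Rightarrow> real) \<Rightarrow> nat \<Rightarrow> real" where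
  "transition_deriv m c d x v =
     (\<lambda>i. if i < m then \<Sum>j<m. partial_deriv j (\<lambda>y. transition c d y i) (snd c x) * v j else 0)"

definition tangent_vector ::
  "nat \<Rightarrow> 'p chart set \<Rightarrow> 'p chart \<Rightarrow> 'p \<Rightarrow> (nat \<Rightarrow> real) \<Rightarrow> 'p \<times> ('p chart \<Rightarrow> nat \<Rightarrow> real)" where
  "tangent_vector m \<A> c x v = (x, \<lambda>d\<in>{d \<in> \<A>. x \<in> fst d}. transition_deriv m c d x v)"

definition tangent_bundle ::
  "nat \<Rightarrow> 'p topology \<Rightarrow> 'p chart set \<Rightarrow> ('p \<times> ('p chart \<Rightarrow> nat \<Rightarrow> real)) topology" where
  "tangent_bundle m M \<A> =
     quotient_topology
       (sum_topology (\<lambda>c. prod_topology (subtopology M (fst c)) (Euclidean_space m)) \<A>)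
       (\<lambda>(c, x, v). tangent_vector m \<A> c x v)"

definition zero_vector :: "'p chart set \<Rightarrow> 'p \<Rightarrow> 'p \<times> ('p chart \<Rightarrow> nat \<Rightarrow> real)" where
  "zero_vector \<A> x = (x, \<lambda>d\<in>{d \<in> \<A>. x \<in> fst d}. (\<lambda>i. 0))"

definition manifold_orientation ::
  "('u, 'c) cohomology \<Rightarrow> nat \<Rightarrow> 'p topology \<Rightarrow> 'p chart set \<Rightarrow> 'c \<Rightarrow> bool" where
  "manifold_orientation h m M \<A> t \<longleftrightarrow>
     thom_class h (int m) (tangent_bundle m M \<A>) M fst (zero_vector \<A>) t"

definition manifold_euler_class ::
  "('u, 'c) cohomology \<Rightarrow> nat \<Rightarrow> 'p topology \<Rightarrow> 'p chart set \<Rightarrow> 'c \<Rightarrow> 'c" where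
  "manifold_euler_class h m M \<A> t =
     euler_class h (int m) (tangent_bundle m M \<A>) M (zero_vector \<A>) t"

end

theory Submission
  imports Defs
begin

text \<open>
  Let \<open>r\<^sub>i\<close> make the \<open>i\<close>-th loop of a point of \<open>E = map(\<or>\<^sub>n S\<^sup>1, M)\<close> constant. It suffices that
  \<open>b \<union> ev\<^sup>*(e) = r\<^sub>i\<^sup>*(b) \<union> ev\<^sup>*(e)\<close> for each \<open>i\<close>, because the composite of all \<open>r\<^sub>i\<close> is \<open>\<sigma> \<circ> ev\<close>.

  In \<open>E \<times> [0, 1]\<close> let \<open>G\<close> consist of the \<open>(\<gamma>, s)\<close> with \<open>\<gamma>\<^sub>i(0) = \<gamma>\<^sub>i(s)\<close>. Near the diagonal of \<open>M \<times> M\<close>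
  there is a continuous \<open>\<phi>(x, y) \<in> T\<^sub>xM\<close> that vanishes only for \<open>x = y\<close>, and a continuous choice of
  paths from \<open>y\<close> to \<open>x\<close>. Hence, near \<open>G\<close>, the Thom class \<open>t\<close> pulls back along
  \<open>\<phi>(\<gamma>\<^sub>i(0), \<gamma>\<^sub>i(s))\<close> to a class supported on \<open>G\<close>, and \<open>\<gamma>\<^sub>i\<close> restricted to \<open>[0, s]\<close> closes up to a loop,
  which defines a map \<open>c\<close> to \<open>E\<close>. By excision \<open>c\<^sup>*(b) \<union> \<phi>\<^sup>*(t)\<close> extends to all of \<open>E \<times> [0, 1]\<close>, so
  its restrictions to \<open>s = 0\<close> and \<open>s = 1\<close> agree. They are \<open>r\<^sub>i\<^sup>*(b) \<union> ev\<^sup>*(e)\<close> and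
  \<open>b \<union> ev\<^sup>*(e)\<close>.
\<close>

section \<open>Cohomology classes supported on a closed set\<close>

text \<open>The closed-up loop exists only where the two points are close, so neither factor of the
  product is defined on all of the cylinder. What makes the product extend is that away from
  \<open>G\<close> the vector \<phi> is nonzero, so the pulled back Thom class is a class relative
  to the complement of \<open>G\<close>, and excision may discard everything outside a neighbourhood
  of \<open>G\<close>. At both ends of the cylinder the two points coincide, hence \<phi> is there
  the zero section and the Thom class becomes the Euler class. The loops are shrunk one at a time:
  cutting all of them at a common time would impose n coincidences and produce n Euler factors. A
  single factor can be used again and again because shrinking a loop does not move the base point.
  In place of a Riemannian metric and geodesics, both \<phi> and the paths are glued from straight
  segments in charts, weighted by bump functions. The theory \<open>h\<close> lives on one universe
  of points, so every space involved must be shown to have at most as many points as the real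
  line.\<close>

context cohomology_theory begin

lemma ind_closed:
  assumes "pair_map X A Y B f" and "y \<in> carrier (Grp h k Y B)"
  shows "Ind h k X A Y B f y \<in> carrier (Grp h k X A)"
  using ind_hom[OF assms(1)] assms(2) by (auto simp: hom_def)

text \<open>Functions are unconstrained off \<open>topspace X\<close>. Maps that agree on the space
  are homotopic by the constant homotopy, so the homotopy axiom absorbs the difference.\<close>

lemma ind_cong:
  assumes f: "pair_map X A Y B f" and eq: "\<And>x. x \<in> topspace X \<Longrightarrow> f x = g x"
    and y: "y \<in> carrier (Grp h k Y B)"
  shows "Ind h k X A Y B f y = Ind h k X A Y B g y"
proof (rule homotopy[OF f _ _ y])
  show g: "pair_map X A Y B g"
    using f eq unfolding pair_map_def
    by (metis continuous_map_eq image_cong subsetD)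
  show "homotopic_with (\<lambda>u. u ` A \<subseteq> B) X Y f g"
    using f g eq by (intro homotopic_with_equal) (auto simp: pair_map_def)
qed

text \<open>In the exact sequence of the pair (X, X) the restriction from X to X is the identity.
  Both adjacent maps therefore vanish, and the relative group between them is trivial.\<close>

lemma carrier_Grp_self: "carrier (Grp h k X (topspace X)) = {\<one>\<^bsub>Grp h k X (topspace X)\<^esub>}"
proof -
  let ?T = "topspace X"
  have sub: "subtopology X ?T = X"
    by simp
  have ii: "Ind h j X {} X {} id x = x" if "x \<in> carrier (Grp h j X {})" for j x
    using ind_id that by simp
  have grp: "group (Grp h j X A)" if "A \<subseteq> ?T" for j A
    using group[OF that] by (simp add: comm_group_def)
  have triv: "Ind h j X {} X ?T id x = \<one>\<^bsub>Grp h j X {}\<^esub>" if "x \<in> carrier (Grp h j X ?T)" for j x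
  proof -
    have "Ind h j X {} X ?T id x \<in> kernel (Grp h j X {}) (Grp h j X {}) (Ind h j X {} X {} id)"
      using exact_space[of ?T X j] that by auto
    then show ?thesis
      using ii by (auto simp: kernel_def)
  qed
  \<comment> \<open>The exactness axioms index the connecting map by its source degree, so its
    target is in degree k when it starts in degree k - 1.\<close>
  define j where "j = k - 1"
  have "Bdy h j X ?T y = \<one>\<^bsub>Grp h k X ?T\<^esub>" if "y \<in> carrier (Grp h j X {})" for y
  proof -
    have "y \<in> Ind h j X {} X {} id ` carrier (Grp h j X {})"
      using ii that by force
    then show ?thesis
      using exact_subspace[of ?T X j] by (auto simp: kernel_def j_def)
  qed
  moreover have "x \<in> Bdy h j X ?T ` carrier (Grp h j X {})" if "x \<in> carrier (Grp h k X ?T)" for x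
    using exact_pair[of ?T X j] triv that by (auto simp: kernel_def j_def)
  ultimately have "x = \<one>\<^bsub>Grp h k X ?T\<^esub>" if "x \<in> carrier (Grp h k X ?T)" for x
    using that by blast
  moreover have "\<one>\<^bsub>Grp h k X ?T\<^esub> \<in> carrier (Grp h k X ?T)"
    using grp[of ?T k] by (simp add: group.is_monoid monoid.one_closed)
  ultimately show ?thesis
    by blast
qed

text \<open>Both groups to be compared belong to a space relative to itself, namely (B, B) and the
  empty pair, and are trivial. This makes the product of an absolute class with a class relative to
  \<open>B\<close> available for every \<open>B\<close>.\<close>

lemma excisive_empty_left:
  assumes "B \<subseteq> topspace X"
  shows "excisive h X {} B"
proof -
  have B: "topspace (subtopology X B) = B"
    using assms by auto
  have "Ind h k (subtopology X {}) {} (subtopology X B) B id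
      \<in> iso (Grp h k (subtopology X B) B) (Grp h k (subtopology X {}) {})" for k
  proof (rule isoI)
    have "pair_map (subtopology X {}) {} (subtopology X B) B id"
      by (auto simp: pair_map_def B continuous_map_on_empty assms)
    from ind_hom[OF this]
    show hom: "Ind h k (subtopology X {}) {} (subtopology X B) B id
      \<in> hom (Grp h k (subtopology X B) B) (Grp h k (subtopology X {}) {})" .
    have "carrier (Grp h k (subtopology X B) B) = {\<one>\<^bsub>Grp h k (subtopology X B) B\<^esub>}"
      using carrier_Grp_self[of k "subtopology X B"] B by simp
    moreover have "carrier (Grp h k (subtopology X {}) {}) = {\<one>\<^bsub>Grp h k (subtopology X {}) {}\<^esub>}"
      using carrier_Grp_self[of k "subtopology X {}"] by simp
    ultimately show "bij_betw (Ind h k (subtopology X {}) {} (subtopology X B) B id)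
      (carrier (Grp h k (subtopology X B) B)) (carrier (Grp h k (subtopology X {}) {}))"
      using hom by (auto simp: hom_def bij_betw_def)
  qed
  then show ?thesis
    using assms by (simp add: excisive_def)
qed

end

text \<open>
  \<open>c\<^sup>* b \<union> \<phi>\<^sup>* t\<close> lives on \<open>(F, F - G)\<close>; by excision it is the restriction of a class on
  \<open>(X, X - G)\<close>, and a class that exists on all of \<open>X\<close> has the same pullback along homotopic maps.
\<close>

lemma cup_homotopic_supported:
  fixes h :: "('u, 'c) cohomology" and X :: "'u topology"
  assumes "multiplicative_cohomology_theory h"
    and F: "openin X F" and G: "closedin X G" and GF: "G \<subseteq> F"
    and \<phi>: "continuous_map (subtopology X F) T \<phi>" and \<phi>T0: "\<phi> ` (F - G) \<subseteq> T0"
    and T0: "T0 \<subseteq> topspace T"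
    and c: "continuous_map (subtopology X F) E' c"
    and hom: "homotopic_with (\<lambda>_. True) E X i j"
    and iF: "i ` topspace E \<subseteq> F" and jF: "j ` topspace E \<subseteq> F"
    and b: "b \<in> carrier (Grp h p E' {})" and t: "t \<in> carrier (Grp h q T T0)"
  shows "Cup h E {} {} p q (Ind h p E {} E' {} (c \<circ> i) b) (Ind h q E {} T T0 (\<phi> \<circ> i) t)
       = Cup h E {} {} p q (Ind h p E {} E' {} (c \<circ> j) b) (Ind h q E {} T T0 (\<phi> \<circ> j) t)"
proof -
  interpret multiplicative_cohomology_theory h by fact
  let ?S = "subtopology X F"
  have FX: "F \<subseteq> topspace X" and GX: "G \<subseteq> topspace X"
    using F G by (auto simp: openin_subset closedin_subset)
  have topS: "topspace ?S = F"
    using FX by auto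
  have c': "pair_map ?S {} E' {} c"
    using c by (simp add: pair_map_def)
  have \<phi>': "pair_map ?S (F - G) T T0 \<phi>"
    using \<phi> \<phi>T0 T0 FX by (auto simp: pair_map_def)
  define v where "v = Cup h ?S {} (F - G) p q (Ind h p ?S {} E' {} c b)
                        (Ind h q ?S (F - G) T T0 \<phi> t)"
  have exS: "excisive h ?S {} (F - G)"
    using FX by (intro excisive_empty_left) auto
  have exE: "excisive h E {} {}"
    by (rule excisive_empty_left) auto
  have cb: "Ind h p ?S {} E' {} c b \<in> carrier (Grp h p ?S {})"
    using c' b by (rule ind_closed)
  have \<phi>t: "Ind h q ?S (F - G) T T0 \<phi> t \<in> carrier (Grp h q ?S (F - G))"
    using \<phi>' t by (rule ind_closed)
  have v: "v \<in> carrier (Grp h (p + q) ?S (F - G))"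
    using cup_closed[OF exS cb \<phi>t] by (simp add: v_def)
  \<comment> \<open>The excised set is the complement of \<open>F\<close>, which is closed; it lies
    in the open complement of \<open>G\<close> because \<open>G\<close> is contained in
    \<open>F\<close>.\<close>
  have "Ind h (p + q) (subtopology X (topspace X - (topspace X - F)))
          ((topspace X - G) - (topspace X - F)) X (topspace X - G) id
       \<in> iso (Grp h (p + q) X (topspace X - G))
           (Grp h (p + q) (subtopology X (topspace X - (topspace X - F)))
              ((topspace X - G) - (topspace X - F)))"
  proof (rule excision)
    have "X closure_of (topspace X - F) = topspace X - F"
      using F by (intro closure_of_closedin) (simp add: closedin_diff)
    moreover have "X interior_of (topspace X - G) = topspace X - G"
      using G by (intro interior_of_openin) (simp add: closedin_def)
    ultimately show "X closure_of (topspace X - F) \<subseteq> X interior_of (topspace X - G)"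
      using GF by auto
  qed (use GF in auto)
  moreover have "topspace X - (topspace X - F) = F" "(topspace X - G) - (topspace X - F) = F - G"
    using FX by auto
  ultimately have exc: "Ind h (p + q) ?S (F - G) X (topspace X - G) id
       \<in> iso (Grp h (p + q) X (topspace X - G)) (Grp h (p + q) ?S (F - G))"
    by (simp only:)
  then have "bij_betw (Ind h (p + q) ?S (F - G) X (topspace X - G) id)
      (carrier (Grp h (p + q) X (topspace X - G))) (carrier (Grp h (p + q) ?S (F - G)))"
    by (simp add: iso_def)
  then obtain u where u: "u \<in> carrier (Grp h (p + q) X (topspace X - G))"
    and uv: "Ind h (p + q) ?S (F - G) X (topspace X - G) id u = v"
    using v by (metis bij_betw_imp_surj_on imageE)
  \<comment> \<open>A map into \<open>F\<close> factors through \<open>?S\<close>, where the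
    extended class \<open>u\<close> is the product \<open>v\<close>, so naturality splits its
    pullback into two factors. The source pair is absolute, so \<open>f\<close> may meet
    \<open>G\<close> freely.\<close>
  have pull: "Ind h (p + q) E {} X (topspace X - G) f u
      = Cup h E {} {} p q (Ind h p E {} E' {} (c \<circ> f) b) (Ind h q E {} T T0 (\<phi> \<circ> f) t)"
    if f: "continuous_map E X f" and fF: "f ` topspace E \<subseteq> F" for f
  proof -
    have fS: "continuous_map E ?S f"
      using f fF by (simp add: continuous_map_in_subtopology image_subset_iff_funcset)
    have 1: "pair_map E {} ?S {} f" "pair_map E {} ?S (F - G) f"
      using fS FX by (auto simp: pair_map_def)
    have 2: "pair_map ?S (F - G) X (topspace X - G) id"
      using FX GX GF continuous_map_id_subt[of X F] by (auto simp: pair_map_def)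
    have "Ind h (p + q) E {} X (topspace X - G) (id \<circ> f) u = Ind h (p + q) E {} ?S (F - G) f v"
      using ind_comp[OF 1(2) 2 u] uv by simp
    also have "\<dots> = Cup h E {} {} p q (Ind h p E {} ?S {} f (Ind h p ?S {} E' {} c b))
        (Ind h q E {} ?S (F - G) f (Ind h q ?S (F - G) T T0 \<phi> t))"
      using cup_natural[OF exE exS 1 cb \<phi>t] by (simp add: v_def)
    also have "Ind h p E {} ?S {} f (Ind h p ?S {} E' {} c b) = Ind h p E {} E' {} (c \<circ> f) b"
      using ind_comp[OF 1(1) c' b] by simp
    also have "Ind h q E {} ?S (F - G) f (Ind h q ?S (F - G) T T0 \<phi> t) = Ind h q E {} T T0 (\<phi> \<circ> f) t"
      using ind_comp[OF 1(2) \<phi>' t] by simp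
    finally show ?thesis
      by (simp only: id_comp)
  qed
  have ij: "continuous_map E X i" "continuous_map E X j"
    using homotopic_with_imp_continuous_maps[OF hom] by auto
  have "Ind h (p + q) E {} X (topspace X - G) i u = Ind h (p + q) E {} X (topspace X - G) j u"
    by (rule homotopy[OF _ _ _ u]) (use ij hom in \<open>simp_all add: pair_map_def\<close>)
  then show ?thesis
    using pull ij iF jF by simp
qed


section \<open>Transport between spaces of arbitrary types and their copies in the universe\<close>

abbreviation decode :: "'a topology \<Rightarrow> 'u \<Rightarrow> 'a" where
  "decode X \<equiv> inv_into (topspace X) (encode X)"

lemma
  fixes X :: "'a topology"
  assumes le: "topspace X \<lesssim> (UNIV :: 'u set)"
  shows decode_encode: "x \<in> topspace X \<Longrightarrow> decode X (encode X x :: 'u) = x"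
    and topspace_copy: "topspace (copy X :: 'u topology) = encode X ` topspace X"
    and continuous_map_encode: "continuous_map X (copy X :: 'u topology) (encode X)"
    and continuous_map_decode: "continuous_map (copy X :: 'u topology) X (decode X)"
proof -
  show dec: "decode X (encode X x :: 'u) = x" if "x \<in> topspace X" for x
    using inj_on_encode[OF le] that by simp
  have hom: "homeomorphic_map X (copy X :: 'u topology) (encode X)"
    by (rule homeomorphic_map_encode[OF le])
  show top: "topspace (copy X :: 'u topology) = encode X ` topspace X"
    using homeomorphic_imp_surjective_map[OF hom] by simp
  show "continuous_map X (copy X :: 'u topology) (encode X)"
    by (rule homeomorphic_imp_continuous_map[OF hom])
  obtain g where g: "homeomorphic_maps X (copy X :: 'u topology) (encode X) g"
    using hom homeomorphic_map_maps by blast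
  then have "continuous_map (copy X) X g"
    by (simp add: homeomorphic_maps_def)
  moreover have "g x = decode X x" if "x \<in> topspace (copy X :: 'u topology)" for x
    using that g dec unfolding top homeomorphic_maps_def by auto
  ultimately show "continuous_map (copy X :: 'u topology) X (decode X)"
    using continuous_map_eq by blast
qed

definition copy_map :: "'a topology \<Rightarrow> 'b topology \<Rightarrow> ('a \<Rightarrow> 'b) \<Rightarrow> 'u \<Rightarrow> 'u" where
  "copy_map X Y f = encode Y \<circ> f \<circ> decode X"

lemma coh_ind_copy_map:
  "coh_ind h k X A Y B f = Ind h k (copy X) (encode X ` A) (copy Y) (encode Y ` B) (copy_map X Y f)"
  by (simp add: coh_ind_def copy_map_def)

text \<open>The subset \<open>F\<close> is encoded as part of \<open>X\<close> and not by an
  encoding of its own: in the support argument the maps are continuous only on \<open>F\<close>,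
  while the homotopy and the excision take place in all of \<open>X\<close>.\<close>

lemma continuous_copy_map:
  fixes X :: "'a topology" and Y :: "'b topology"
  assumes "topspace X \<lesssim> (UNIV :: 'u set)" "topspace Y \<lesssim> (UNIV :: 'u set)"
    and "continuous_map (subtopology X F) Y f" and "F \<subseteq> topspace X"
  shows "continuous_map (subtopology (copy X :: 'u topology) (encode X ` F)) (copy Y) (copy_map X Y f)"
proof -
  have "continuous_map (subtopology (copy X :: 'u topology) (encode X ` F)) (subtopology X F) (decode X)"
    using assms continuous_map_decode[OF assms(1)] decode_encode[OF assms(1)]
    by (auto simp: continuous_map_in_subtopology continuous_map_from_subtopology subset_iff)
  then show ?thesis
    unfolding copy_map_def
    using assms continuous_map_encode[OF assms(2)] by (metis continuous_map_compose)
qed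

lemma pair_map_copy_map:
  fixes X :: "'a topology" and Y :: "'b topology"
  assumes "topspace X \<lesssim> (UNIV :: 'u set)" "topspace Y \<lesssim> (UNIV :: 'u set)"
    and f: "pair_map X A Y B f"
  shows "pair_map (copy X :: 'u topology) (encode X ` A) (copy Y) (encode Y ` B) (copy_map X Y f)"
proof -
  have AX: "A \<subseteq> topspace X" and BY: "B \<subseteq> topspace Y" and cont: "continuous_map X Y f" and AB: "f ` A \<subseteq> B"
    using f by (auto simp: pair_map_def)
  have "subtopology (copy X :: 'u topology) (encode X ` topspace X) = copy X"
    using topspace_copy[OF assms(1)] by (metis subtopology_topspace)
  then have "continuous_map (copy X :: 'u topology) (copy Y) (copy_map X Y f)"
    using continuous_copy_map[OF assms(1,2), where F = "topspace X"] cont by simp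
  moreover have "copy_map X Y f (encode X x :: 'u) = encode Y (f x)" if "x \<in> A" for x
    using decode_encode[OF assms(1), of x] AX that by (auto simp: copy_map_def)
  ultimately show ?thesis
    using AX BY AB topspace_copy[OF assms(1)] topspace_copy[OF assms(2)]
    by (auto simp: pair_map_def)
qed

text \<open>The equation is restricted to the points of the copy because decoding is arbitrary
  elsewhere; \<open>ind_cong\<close> makes this sufficient.\<close>

lemma copy_map_comp:
  fixes X :: "'a topology" and Y :: "'b topology" and Z :: "'z topology"
  assumes "topspace X \<lesssim> (UNIV :: 'u set)" "topspace Y \<lesssim> (UNIV :: 'u set)"
    and "f ` topspace X \<subseteq> topspace Y" and "x \<in> topspace (copy X :: 'u topology)"
  shows "copy_map X Z (g \<circ> f) x = (copy_map Y Z g \<circ> copy_map X Y f) x"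
proof -
  obtain y where y: "y \<in> topspace X" "x = encode X y"
    using assms(4) topspace_copy[OF assms(1)] by auto
  then have "f y \<in> topspace Y"
    using assms(3) by auto
  with y show ?thesis
    using decode_encode[OF assms(1)] decode_encode[OF assms(2)] by (simp add: copy_map_def)
qed

context
  fixes h :: "('u, 'c) cohomology"
  assumes cohomology: "cohomology_theory h"
begin

interpretation cohomology_theory h by (fact cohomology)

lemma coh_ind_closed:
  assumes "topspace X \<lesssim> (UNIV :: 'u set)" "topspace Y \<lesssim> (UNIV :: 'u set)"
    and "pair_map X A Y B f" and "y \<in> carrier (coh h k Y B)"
  shows "coh_ind h k X A Y B f y \<in> carrier (coh h k X A)"
  using ind_closed[OF pair_map_copy_map[OF assms(1-3)]] assms(4)
  by (simp add: coh_def coh_ind_copy_map)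

lemma coh_ind_comp:
  assumes X: "topspace X \<lesssim> (UNIV :: 'u set)" and Y: "topspace Y \<lesssim> (UNIV :: 'u set)"
    and Z: "topspace Z \<lesssim> (UNIV :: 'u set)"
    and f: "pair_map X A Y B f" and g: "pair_map Y B Z C g" and z: "z \<in> carrier (coh h k Z C)"
  shows "coh_ind h k X A Z C (g \<circ> f) z = coh_ind h k X A Y B f (coh_ind h k Y B Z C g z)"
proof -
  have gf: "pair_map X A Z C (g \<circ> f)"
    using f g by (auto simp: pair_map_def image_subset_iff intro: continuous_map_compose)
  have z': "z \<in> carrier (Grp h k (copy Z) (encode Z ` C))"
    using z by (simp add: coh_def)
  have fXY: "f ` topspace X \<subseteq> topspace Y"
    using f by (auto simp: pair_map_def continuous_map_def)
  have "Ind h k (copy X) (encode X ` A) (copy Z) (encode Z ` C) (copy_map X Z (g \<circ> f)) z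
      = Ind h k (copy X) (encode X ` A) (copy Z) (encode Z ` C) (copy_map Y Z g \<circ> copy_map X Y f) z"
    by (rule ind_cong[OF pair_map_copy_map[OF X Z gf] copy_map_comp[OF X Y fXY] z'])
  also have "\<dots> = Ind h k (copy X) (encode X ` A) (copy Y) (encode Y ` B) (copy_map X Y f)
      (Ind h k (copy Y) (encode Y ` B) (copy Z) (encode Z ` C) (copy_map Y Z g) z)"
    by (rule ind_comp[OF pair_map_copy_map[OF X Y f] pair_map_copy_map[OF Y Z g] z'])
  finally show ?thesis
    by (simp only: coh_ind_copy_map)
qed

lemma coh_ind_homotopic:
  assumes X: "topspace X \<lesssim> (UNIV :: 'u set)" and Y: "topspace Y \<lesssim> (UNIV :: 'u set)"
    and hom: "homotopic_with (\<lambda>_. True) X Y f g" and y: "y \<in> carrier (coh h k Y {})"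
  shows "coh_ind h k X {} Y {} f y = coh_ind h k X {} Y {} g y"
proof -
  have fg: "pair_map X {} Y {} f" "pair_map X {} Y {} g"
    using homotopic_with_imp_continuous_maps[OF hom] by (auto simp: pair_map_def)
  have "homotopic_with (\<lambda>_. True) (copy X :: 'u topology) (copy Y) (copy_map X Y f) (copy_map X Y g)"
    unfolding copy_map_def
    by (rule homotopic_with_compose_continuous_map_right[OF
          homotopic_with_compose_continuous_map_left[OF hom continuous_map_encode[OF Y]]
          continuous_map_decode[OF X]]) auto
  then show ?thesis
    unfolding coh_ind_copy_map
    using homotopy[OF pair_map_copy_map[OF X Y fg(1)] pair_map_copy_map[OF X Y fg(2)]] y
    by (simp add: coh_def)
qed

lemma coh_ind_cong:
  assumes X: "topspace X \<lesssim> (UNIV :: 'u set)" and Y: "topspace Y \<lesssim> (UNIV :: 'u set)"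
    and f: "pair_map X A Y B f" and eq: "\<And>x. x \<in> topspace X \<Longrightarrow> f x = g x"
    and y: "y \<in> carrier (coh h k Y B)"
  shows "coh_ind h k X A Y B f y = coh_ind h k X A Y B g y"
proof -
  have "copy_map X Y f x = copy_map X Y g x" if "x \<in> topspace (copy X :: 'u topology)" for x
    using that eq decode_encode[OF X] unfolding topspace_copy[OF X] copy_map_def by auto
  with ind_cong[OF pair_map_copy_map[OF X Y f]] y show ?thesis
    unfolding coh_ind_copy_map coh_def by blast
qed

lemma coh_ind_id:
  assumes X: "topspace X \<lesssim> (UNIV :: 'u set)" and x: "x \<in> carrier (coh h k X {})"
  shows "coh_ind h k X {} X {} id x = x"
proof -
  have "pair_map X {} X {} id"
    by (simp add: pair_map_def)
  note pm = pair_map_copy_map[OF X X this]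
  have x': "x \<in> carrier (Grp h k (copy X) (encode X ` {}))"
    using x by (simp add: coh_def)
  have "copy_map X X id y = id y" if "y \<in> topspace (copy X :: 'u topology)" for y
    using that decode_encode[OF X] unfolding topspace_copy[OF X] copy_map_def by auto
  from ind_cong[OF pm this x'] show ?thesis
    unfolding coh_ind_copy_map using ind_id[of "{}" "copy X" x k] x' by (simp add: id_def)
qed

end

text \<open>The encoding is a homeomorphism onto the copy, so it carries \<open>F\<close> and
  \<open>G\<close> to an open and a closed set, and \<open>cup_homotopic_supported\<close> applies
  to their images.\<close>

lemma coh_cup_homotopic_supported:
  fixes h :: "('u, 'c) cohomology"
  assumes mult: "multiplicative_cohomology_theory h"
    and X: "topspace X \<lesssim> (UNIV :: 'u set)" and T: "topspace T \<lesssim> (UNIV :: 'u set)"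
    and E: "topspace E \<lesssim> (UNIV :: 'u set)" and E': "topspace E' \<lesssim> (UNIV :: 'u set)"
    and F: "openin X F" and G: "closedin X G" and GF: "G \<subseteq> F"
    and \<phi>: "continuous_map (subtopology X F) T \<phi>" and \<phi>T0: "\<phi> ` (F - G) \<subseteq> T0"
    and T0: "T0 \<subseteq> topspace T"
    and c: "continuous_map (subtopology X F) E' c"
    and hom: "homotopic_with (\<lambda>_. True) E X i j"
    and iF: "i ` topspace E \<subseteq> F" and jF: "j ` topspace E \<subseteq> F"
    and b: "b \<in> carrier (coh h p E' {})" and t: "t \<in> carrier (coh h q T T0)"
  shows "coh_cup h E {} {} p q (coh_ind h p E {} E' {} (c \<circ> i) b) (coh_ind h q E {} T T0 (\<phi> \<circ> i) t)
       = coh_cup h E {} {} p q (coh_ind h p E {} E' {} (c \<circ> j) b) (coh_ind h q E {} T T0 (\<phi> \<circ> j) t)"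
proof -
  interpret multiplicative_cohomology_theory h by fact
  have FX: "F \<subseteq> topspace X" and GX: "G \<subseteq> topspace X"
    using F G by (auto simp: openin_subset closedin_subset)
  have homeo: "homeomorphic_map X (copy X :: 'u topology) (encode X)"
    by (rule homeomorphic_map_encode[OF X])
  have i: "continuous_map E X i" and j: "continuous_map E X j"
    using homotopic_with_imp_continuous_maps[OF hom] by auto
  have pull: "coh_ind h r E {} Y B (f \<circ> l) y
      = Ind h r (copy E) {} (copy Y) (encode Y ` B) (copy_map X Y f \<circ> copy_map E X l) y"
    if Y: "topspace Y \<lesssim> (UNIV :: 'u set)" and f: "continuous_map (subtopology X F) Y f"
      and l: "continuous_map E X l" "l ` topspace E \<subseteq> F"
      and B: "B \<subseteq> topspace Y" and y: "y \<in> carrier (coh h r Y B)"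
    for Y :: "'y topology" and B f l y r
  proof -
    have "continuous_map E (subtopology X F) l"
      using l by (simp add: continuous_map_in_subtopology image_subset_iff_funcset)
    then have "pair_map E {} Y B (f \<circ> l)"
      using f B by (auto simp: pair_map_def intro: continuous_map_compose)
    moreover have "l ` topspace E \<subseteq> topspace X"
      using l FX by auto
    ultimately have "Ind h r (copy E) (encode E ` {}) (copy Y) (encode Y ` B) (copy_map E Y (f \<circ> l)) y
      = Ind h r (copy E) (encode E ` {}) (copy Y) (encode Y ` B) (copy_map X Y f \<circ> copy_map E X l) y"
      using y by (intro ind_cong[OF pair_map_copy_map[OF E Y] copy_map_comp[OF E X]]) (auto simp: coh_def)
    then show ?thesis
      by (simp add: coh_ind_copy_map)
  qed
  have image: "copy_map E X l ` topspace (copy E :: 'u topology) \<subseteq> encode X ` F"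
    if "l ` topspace E \<subseteq> F" for l
    using that decode_encode[OF E] by (auto simp: topspace_copy[OF E] copy_map_def)
  have hom': "homotopic_with (\<lambda>_. True) (copy E :: 'u topology) (copy X) (copy_map E X i) (copy_map E X j)"
    unfolding copy_map_def
    by (rule homotopic_with_compose_continuous_map_right[OF
          homotopic_with_compose_continuous_map_left[OF hom continuous_map_encode[OF X]]
          continuous_map_decode[OF E]]) auto
  have inj: "inj_on (encode X :: _ \<Rightarrow> 'u) (topspace X)"
    by (rule inj_on_encode[OF X])
  have "Cup h (copy E) {} {} p q
      (Ind h p (copy E) {} (copy E') {} (copy_map X E' c \<circ> copy_map E X i) b)
      (Ind h q (copy E) {} (copy T) (encode T ` T0) (copy_map X T \<phi> \<circ> copy_map E X i) t)
    = Cup h (copy E) {} {} p q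
      (Ind h p (copy E) {} (copy E') {} (copy_map X E' c \<circ> copy_map E X j) b)
      (Ind h q (copy E) {} (copy T) (encode T ` T0) (copy_map X T \<phi> \<circ> copy_map E X j) t)"
  proof (rule cup_homotopic_supported[OF mult, where F = "encode X ` F" and G = "encode X ` G"])
    show "openin (copy X :: 'u topology) (encode X ` F)"
      using homeo F FX homeomorphic_map_openness_eq by blast
    show "closedin (copy X :: 'u topology) (encode X ` G)"
      using homeo G GX homeomorphic_map_closedness_eq by blast
    have "encode X ` F - encode X ` G = (encode X ` (F - G) :: 'u set)"
      using inj_on_image_set_diff[OF inj, of F G] FX GX by blast
    moreover have "copy_map X T \<phi> (encode X x :: 'u) = encode T (\<phi> x)" if "x \<in> F" for x
      using that FX decode_encode[OF X] by (auto simp: copy_map_def)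
    ultimately show "copy_map X T \<phi> ` (encode X ` F - encode X ` G) \<subseteq> (encode T ` T0 :: 'u set)"
      using \<phi>T0 by auto
    show "b \<in> carrier (Grp h p (copy E') {})" "t \<in> carrier (Grp h q (copy T) (encode T ` T0))"
      using b t by (auto simp: coh_def)
    show "encode T ` T0 \<subseteq> topspace (copy T :: 'u topology)"
      using T0 topspace_copy[OF T] by auto
  qed (use GF hom' image[OF iF] image[OF jF] continuous_copy_map[OF X T \<phi> FX]
      continuous_copy_map[OF X E' c FX] in auto)
  then show ?thesis
    unfolding pull[OF E' c i iF empty_subsetI b] pull[OF E' c j jF empty_subsetI b]
      pull[OF T \<phi> i iF T0 t] pull[OF T \<phi> j jF T0 t]
    by (simp add: coh_cup_def)
qed

section \<open>Maps out of a wedge of circles\<close>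

abbreviation I01 :: "real topology" where "I01 \<equiv> top_of_set {0..1}"

text \<open>An inverse of the parametrization of the circle by [0, 1], discontinuous at 1. It is
  used to write down maps on the wedge; their continuity is always checked after composing with the
  quotient map from [0, 1].\<close>

definition turn :: "complex \<Rightarrow> real" where
  "turn z = Arg2pi z / (2 * pi)"

lemma turn_bounds: "0 \<le> turn z" "turn z < 1"
  using Arg2pi[of z] by (auto simp: turn_def field_simps)

lemma cis_turn: "norm z = 1 \<Longrightarrow> cis (2 * pi * turn z) = z"
  using complex_norm_eq_1_exp[of z] by (simp add: turn_def cis_conv_exp)

lemma turn_cis: "0 \<le> \<theta> \<Longrightarrow> \<theta> < 1 \<Longrightarrow> turn (cis (2 * pi * \<theta>)) = \<theta>"
  using Arg2pi_unique[of 1 "2 * pi * \<theta>" "cis (2 * pi * \<theta>)"]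
  by (auto simp: turn_def cis_conv_exp)

lemma quotient_map_circle: "quotient_map I01 circle (\<lambda>\<theta>. cis (2 * pi * \<theta>))"
proof (rule continuous_closed_imp_quotient_map)
  show cont: "continuous_map I01 circle (\<lambda>\<theta>. cis (2 * pi * \<theta>))"
    by (auto intro!: continuous_intros)
  show "closed_map I01 circle (\<lambda>\<theta>. cis (2 * pi * \<theta>))"
    by (rule continuous_imp_closed_map_gen[OF _ _ cont])
      (auto simp: compact_space_subtopology intro!: Hausdorff_imp_kc_space Hausdorff_space_subtopology)
  show "(\<lambda>\<theta>. cis (2 * pi * \<theta>)) ` topspace I01 = topspace circle"
  proof
    show "topspace circle \<subseteq> (\<lambda>\<theta>. cis (2 * pi * \<theta>)) ` topspace I01"
    proof
      fix z :: complex assume "z \<in> topspace circle"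
      then have "cis (2 * pi * turn z) = z"
        by (intro cis_turn) auto
      then show "z \<in> (\<lambda>\<theta>. cis (2 * pi * \<theta>)) ` topspace I01"
        using turn_bounds[of z] by (intro image_eqI[of _ _ "turn z"]) auto
    qed
  qed auto
qed

text \<open>The case distinction is made on the point of the circle, as in the quotient map that
  defines the wedge, so the loop is literally the composite of the two quotient maps.\<close>

definition wedge_loop :: "nat \<Rightarrow> nat \<Rightarrow> real \<Rightarrow> nat \<times> complex" where
  "wedge_loop n i \<theta> = (if cis (2 * pi * \<theta>) = 1 then wedge_base n else (i, cis (2 * pi * \<theta>)))"

lemma wedge_loop_ends: "wedge_loop n i 0 = wedge_base n" "wedge_loop n i 1 = wedge_base n"
  by (auto simp: wedge_loop_def)

lemma wedge_loop_eq:
  assumes "0 < \<theta>" "\<theta> < 1"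
  shows "wedge_loop n i \<theta> = (i, cis (2 * pi * \<theta>))"
proof -
  have "turn (cis (2 * pi * \<theta>)) = \<theta>"
    using assms by (intro turn_cis) auto
  moreover have "turn 1 = 0"
    by (simp add: turn_def Arg2pi_of_real[of 1, simplified])
  ultimately show ?thesis
    using assms by (auto simp: wedge_loop_def)
qed

lemma wedge_loop_turn:
  assumes "norm z = 1" "z \<noteq> 1"
  shows "wedge_loop n i (turn z) = (i, z)"
  using cis_turn[OF assms(1)] assms(2) by (simp add: wedge_loop_def)

lemma quotient_map_wedge:
  "quotient_map (sum_topology (\<lambda>i. if i < n then circle else subtopology circle {1}) {..n})
     (wedge_circles n) (\<lambda>(i, z). if z = 1 then wedge_base n else (i, z))"
  unfolding wedge_circles_def by (rule quotient_map_quotient_topology)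

lemma topspace_wedge_circles:
  "topspace (wedge_circles n) = insert (wedge_base n) {(i, z). i < n \<and> norm z = 1 \<and> z \<noteq> 1}"
    (is "_ = ?R")
proof -
  have "topspace (wedge_circles n)
      = (\<lambda>(i, z). if z = 1 then wedge_base n else (i, z)) `
        Sigma {..n} (topspace \<circ> (\<lambda>i. if i < n then circle else subtopology circle {1}))"
    using quotient_imp_surjective_map[OF quotient_map_wedge, of n] by simp
  also have "\<dots> = ?R"
  proof (intro equalityI subsetI)
    fix w assume "w \<in> (\<lambda>(i, z). if z = 1 then wedge_base n else (i, z)) `
        Sigma {..n} (topspace \<circ> (\<lambda>i. if i < n then circle else subtopology circle {1}))"
    then show "w \<in> ?R"
      by (auto split: if_splits)
  next
    fix w assume "w \<in> ?R"
    then consider "w = wedge_base n" | i z where "w = (i, z)" "i < n" "norm z = 1" "z \<noteq> 1"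
      by auto
    then show "w \<in> (\<lambda>(i, z). if z = 1 then wedge_base n else (i, z)) `
        Sigma {..n} (topspace \<circ> (\<lambda>i. if i < n then circle else subtopology circle {1}))"
    proof cases
      case 1
      then show ?thesis
        by (intro image_eqI[of _ _ "(n, 1)"]) auto
    next
      case 2
      then show ?thesis
        by (intro image_eqI[of _ _ "(i, z)"]) auto
    qed
  qed
  finally show ?thesis .
qed

lemma wedge_base_in_topspace: "wedge_base n \<in> topspace (wedge_circles n)"
  by (simp add: topspace_wedge_circles)

lemma wedge_cases:
  assumes "w \<in> topspace (wedge_circles n)"
  obtains "w = wedge_base n"
  | i \<theta> where "i < n" "0 \<le> \<theta>" "\<theta> \<le> 1" "w = wedge_loop n i \<theta>"
  using assms wedge_loop_turn turn_bounds unfolding topspace_wedge_circles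
  by (smt (verit, best) case_prodE insertE mem_Collect_eq)

lemma continuous_map_wedge_circle:
  assumes "i < n"
  shows "continuous_map circle (wedge_circles n) (\<lambda>z. if z = 1 then wedge_base n else (i, z))"
proof -
  have "continuous_map circle (sum_topology (\<lambda>i. if i < n then circle else subtopology circle {1}) {..n})
      (\<lambda>z. (i, z))"
    using continuous_map_component_injection[of i "{..n}" "\<lambda>i. if i < n then circle else subtopology circle {1}"]
      assms by simp
  from continuous_map_compose[OF this quotient_imp_continuous_map[OF quotient_map_wedge]]
  show ?thesis
    by (simp add: comp_def)
qed

lemma continuous_map_wedge_loop:
  assumes "i < n"
  shows "continuous_map I01 (wedge_circles n) (wedge_loop n i)"
  using continuous_map_compose[OF quotient_imp_continuous_map[OF quotient_map_circle]
      continuous_map_wedge_circle[OF assms]]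
  by (simp add: comp_def wedge_loop_def[abs_def])

lemma wedge_loop_in_topspace:
  assumes "i < n" "0 \<le> \<theta>" "\<theta> \<le> 1"
  shows "wedge_loop n i \<theta> \<in> topspace (wedge_circles n)"
  using continuous_map_wedge_loop[OF assms(1)] assms(2,3)
  by (auto simp: continuous_map_def Pi_iff)

lemma continuous_map_from_sum_topology:
  assumes "\<And>i. i \<in> I \<Longrightarrow> continuous_map (X i) Z (\<lambda>x. f (i, x))"
  shows "continuous_map (sum_topology X I) Z f"
  using assms by (auto simp: continuous_map_def openin_sum_topology Pi_iff)

lemma continuous_map_from_wedge_circle:
  assumes base: "g (wedge_base n) \<in> topspace Z"
    and loops: "\<And>i. i < n \<Longrightarrow> continuous_map circle Z (\<lambda>z. g (if z = 1 then wedge_base n else (i, z)))"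
  shows "continuous_map (wedge_circles n) Z g"
proof (rule continuous_compose_quotient_map[OF quotient_map_wedge continuous_map_from_sum_topology])
  fix i assume i: "i \<in> {..n}"
  show "continuous_map (if i < n then circle else subtopology circle {1}) Z
         (\<lambda>x. (g \<circ> (\<lambda>(i, z). if z = 1 then wedge_base n else (i, z))) (i, x))"
  proof (cases "i < n")
    case True
    then show ?thesis
      using loops by (simp add: comp_def)
  next
    case False
    have "continuous_map (subtopology circle {1}) Z (\<lambda>x. g (wedge_base n))"
      using base by simp
    then have "continuous_map (subtopology circle {1}) Z
        (\<lambda>x. (g \<circ> (\<lambda>(i, z). if z = 1 then wedge_base n else (i, z))) (i, x))"
      by (rule continuous_map_eq) auto
    then show ?thesis
      using False by simp
  qed
qed

lemma continuous_map_from_wedge: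
  assumes base: "g (wedge_base n) \<in> topspace Z"
    and loops: "\<And>i. i < n \<Longrightarrow> continuous_map I01 Z (\<lambda>\<theta>. g (wedge_loop n i \<theta>))"
  shows "continuous_map (wedge_circles n) Z g"
proof (rule continuous_map_from_wedge_circle[of g, OF base])
  fix i assume "i < n"
  from loops[OF this]
  show "continuous_map circle Z (\<lambda>z. g (if z = 1 then wedge_base n else (i, z)))"
    by (intro continuous_compose_quotient_map[OF quotient_map_circle])
      (simp add: comp_def wedge_loop_def)
qed

text \<open>Collapsing all circles but the \<open>j\<close>-th gives a coordinate with values in the
  plane. Together these coordinates inject the wedge continuously into a product of Hausdorff
  spaces. The property is needed so that compact subsets of the wedge have compact preimages under
  the loops.\<close>

lemma Hausdorff_wedge_circles: "Hausdorff_space (wedge_circles n)"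
proof -
  define f :: "nat \<times> complex \<Rightarrow> nat \<Rightarrow> complex" where
    "f w = (\<lambda>j. if fst w = j then snd w else 1)" for w
  have cont: "continuous_map (wedge_circles n) euclidean f"
    unfolding euclidean_product_topology[symmetric] continuous_map_componentwise_UNIV
  proof
    fix j
    show "continuous_map (wedge_circles n) euclidean (\<lambda>w. f w j)"
    proof (rule continuous_map_from_wedge_circle)
      fix i
      have "(\<lambda>z. f (if z = 1 then wedge_base n else (i, z)) j) = (\<lambda>z. if i = j then z else 1)"
        by (auto simp: f_def wedge_base_def)
      then show "continuous_map circle euclidean (\<lambda>z. f (if z = 1 then wedge_base n else (i, z)) j)"
        by (cases "i = j") (auto intro: continuous_intros)
    qed simp
  qed
  have inj: "inj_on f (topspace (wedge_circles n))"
  proof (rule inj_onI)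
    fix v w assume vw: "v \<in> topspace (wedge_circles n)" "w \<in> topspace (wedge_circles n)" "f v = f w"
    obtain i y where v: "v = (i, y)" by force
    obtain j z where w: "w = (j, z)" by force
    have "f v i = f w i" "f v j = f w j" using vw by auto
    then show "v = w"
      using vw unfolding v w topspace_wedge_circles
      by (auto simp: f_def wedge_base_def split: if_splits)
  qed
  show ?thesis
    using Hausdorff_space_injective_preimage[OF _ cont inj] by simp
qed

lemma compactin_wedge_loop_preimage:
  assumes K: "compactin (wedge_circles n) K" and i: "i < n"
  shows "compactin I01 {\<theta> \<in> {0..1}. wedge_loop n i \<theta> \<in> K}"
proof -
  have "closedin (wedge_circles n) K"
    using Hausdorff_wedge_circles K by (rule compactin_imp_closedin)
  then have "closedin I01 {\<theta> \<in> topspace I01. wedge_loop n i \<theta> \<in> K}"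
    by (rule closedin_continuous_map_preimage[OF continuous_map_wedge_loop[OF i]])
  moreover have "compact_space I01"
    by (simp add: compact_space_subtopology)
  ultimately show ?thesis
    by (simp add: closedin_compact_space)
qed

section \<open>The compact-open topology: evaluation along paths and maps into the mapping
  space\<close>

lemma Union_mapping_space_subbase:
  fixes X :: "'a topology" and Y :: "'b topology"
  defines "C \<equiv> {f \<in> extensional (topspace X). continuous_map X Y f}"
  shows "\<Union>{{f \<in> C. f ` K \<subseteq> U} |K U. compactin X K \<and> openin Y U} = C"
proof
  have "C = {f \<in> C. f ` {} \<subseteq> topspace Y}"
    by auto
  then show "C \<subseteq> \<Union>{{f \<in> C. f ` K \<subseteq> U} |K U. compactin X K \<and> openin Y U}"
    by (intro Union_upper CollectI exI[of _ "{}"] exI[of _ "topspace Y"]) auto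
qed auto

lemma topspace_mapping_space:
  "topspace (mapping_space X Y) = {f \<in> extensional (topspace X). continuous_map X Y f}"
  unfolding mapping_space_def Let_def topology_generated_by_topspace
  by (rule Union_mapping_space_subbase)

lemma openin_mapping_space:
  assumes "compactin X K" "openin Y U"
  shows "openin (mapping_space X Y) {f \<in> topspace (mapping_space X Y). f ` K \<subseteq> U}"
  unfolding topspace_mapping_space unfolding mapping_space_def Let_def
  using assms by (intro topology_generated_by_Basis) blast

lemma continuous_map_eval:
  assumes "x \<in> topspace X"
  shows "continuous_map (mapping_space X Y) Y (\<lambda>\<gamma>. \<gamma> x)"
proof -
  have "openin (mapping_space X Y) {\<gamma> \<in> topspace (mapping_space X Y). \<gamma> x \<in> U}" if "openin Y U" for U
    using openin_mapping_space[of X "{x}" Y U] assms that by simp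
  then show ?thesis
    using assms by (auto simp: continuous_map_def topspace_mapping_space Pi_iff)
qed

text \<open>Joint continuity comes from the local compactness of [0, 1]: a compact neighbourhood of
  the time gives a compact image in \<open>X\<close>, hence a subbasic open set of maps.\<close>

lemma continuous_map_eval_path:
  assumes e: "continuous_map I01 X e"
  shows "continuous_map (prod_topology (mapping_space X Y) I01) Y (\<lambda>(\<gamma>, \<theta>). \<gamma> (e \<theta>))"
proof -
  let ?E = "mapping_space X Y"
  have eX: "e \<theta> \<in> topspace X" if "\<theta> \<in> {0..1}" for \<theta>
    using e that by (auto simp: continuous_map_def Pi_iff)
  have "openin (prod_topology ?E I01) {p \<in> topspace (prod_topology ?E I01). (\<lambda>(\<gamma>, \<theta>). \<gamma> (e \<theta>)) p \<in> U}"
    if U: "openin Y U" for U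
  proof (subst openin_subopen, intro ballI)
    fix p assume p: "p \<in> {p \<in> topspace (prod_topology ?E I01). (\<lambda>(\<gamma>, \<theta>). \<gamma> (e \<theta>)) p \<in> U}"
    obtain \<gamma> \<theta> where p_eq: "p = (\<gamma>, \<theta>)"
      by force
    have \<gamma>: "\<gamma> \<in> topspace ?E" and \<theta>: "0 \<le> \<theta>" "\<theta> \<le> 1" and U\<gamma>: "\<gamma> (e \<theta>) \<in> U"
      using p by (auto simp: p_eq)
    have "continuous_map I01 Y (\<gamma> \<circ> e)"
      using \<gamma> e by (auto simp: topspace_mapping_space intro: continuous_map_compose)
    then have "openin I01 {\<theta> \<in> topspace I01. (\<gamma> \<circ> e) \<theta> \<in> U}"
      using U by (rule openin_continuous_map_preimage)
    then obtain d where d: "d > 0" "ball \<theta> d \<inter> {0..1} \<subseteq> {\<theta> \<in> topspace I01. (\<gamma> \<circ> e) \<theta> \<in> U}"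
      unfolding openin_contains_ball using \<theta> U\<gamma> by auto
    \<comment> \<open>Halving the radius makes the closed interval fit into the open one on which
      the values of \<gamma> are known to lie in \<open>U\<close>.\<close>
    define J where "J = cball \<theta> (d / 2) \<inter> {0..1}"
    have J_U: "\<gamma> (e \<theta>') \<in> U" if "\<theta>' \<in> J" for \<theta>'
      using that d unfolding J_def by (auto simp: subset_iff)
    have "compact J"
      unfolding J_def by (intro compact_Int) auto
    then have "compactin I01 J"
      by (auto simp: compactin_subtopology J_def)
    then have "compactin X (e ` J)"
      using e by (rule image_compactin)
    then have "openin ?E {f \<in> topspace ?E. f ` e ` J \<subseteq> U}"
      using U by (rule openin_mapping_space)
    moreover have "openin I01 (ball \<theta> (d / 2) \<inter> {0..1})"
      by (metis inf_commute openin_open_Int open_ball)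
    ultimately have "openin (prod_topology ?E I01)
        ({f \<in> topspace ?E. f ` e ` J \<subseteq> U} \<times> (ball \<theta> (d / 2) \<inter> {0..1}))"
      by (simp add: openin_prod_Times_iff)
    moreover have "p \<in> {f \<in> topspace ?E. f ` e ` J \<subseteq> U} \<times> (ball \<theta> (d / 2) \<inter> {0..1})"
      using \<gamma> \<theta> d(1) J_U by (auto simp: p_eq)
    moreover have "{f \<in> topspace ?E. f ` e ` J \<subseteq> U} \<times> (ball \<theta> (d / 2) \<inter> {0..1})
        \<subseteq> {p \<in> topspace (prod_topology ?E I01). (\<lambda>(\<gamma>, \<theta>). \<gamma> (e \<theta>)) p \<in> U}"
      by (auto simp: J_def image_subset_iff)
    ultimately show "\<exists>T. openin (prod_topology ?E I01) T \<and> p \<in> T \<and>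
       T \<subseteq> {p \<in> topspace (prod_topology ?E I01). (\<lambda>(\<gamma>, \<theta>). \<gamma> (e \<theta>)) p \<in> U}"
      by blast
  qed
  then show ?thesis
    using eX by (auto simp: continuous_map_def topspace_mapping_space Pi_iff)
qed

lemma openin_slice_compactin:
  assumes V: "openin (prod_topology Z Y) V" and K: "compactin Y K"
  shows "openin Z {z \<in> topspace Z. \<forall>y\<in>K. (z, y) \<in> V}"
proof (subst openin_subopen, clarify)
  fix z assume z: "z \<in> topspace Z" "\<forall>y\<in>K. (z, y) \<in> V"
  then have "{z} \<times> K \<subseteq> V"
    by auto
  then obtain S T where "openin Z S" "openin Y T" "z \<in> S" "K \<subseteq> T" "S \<times> T \<subseteq> V"
    using tube_lemma_right[OF V K z(1)] by blast
  moreover have "S \<subseteq> topspace Z"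
    by (simp add: \<open>openin Z S\<close> openin_subset)
  ultimately show "\<exists>T. openin Z T \<and> z \<in> T \<and> T \<subseteq> {z \<in> topspace Z. \<forall>y\<in>K. (z, y) \<in> V}"
    by (intro exI[of _ S]) blast
qed

text \<open>An exponential law tested loop by loop. That \<open>f z\<close> sends \<open>K\<close>
  into \<open>U\<close> is a condition on the compact preimage of \<open>K\<close> under each of the
  n loops, open in \<open>z\<close> by the tube lemma, and one condition at the base point if
  \<open>K\<close> contains it. The base point is treated separately since for n = 0 no loop passes
  through it.\<close>

lemma continuous_map_into_wedge_maps:
  assumes ext: "\<And>z. z \<in> topspace Z \<Longrightarrow> f z \<in> extensional (topspace (wedge_circles n))"
    and base: "continuous_map Z Y (\<lambda>z. f z (wedge_base n))"
    and loops: "\<And>i. i < n \<Longrightarrow> continuous_map (prod_topology Z I01) Y (\<lambda>(z, \<theta>). f z (wedge_loop n i \<theta>))"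
  shows "continuous_map Z (mapping_space (wedge_circles n) Y) f"
proof -
  let ?W = "wedge_circles n"
  let ?C = "{f \<in> extensional (topspace ?W). continuous_map ?W Y f}"
  have fC: "f z \<in> ?C" if z: "z \<in> topspace Z" for z
  proof -
    have "continuous_map I01 Y (\<lambda>\<theta>. f z (wedge_loop n i \<theta>))" if "i < n" for i
      using continuous_map_compose[OF _ loops[OF that], of I01 "Pair z"] z
      by (simp add: comp_def continuous_map_pairwise)
    moreover have "f z (wedge_base n) \<in> topspace Y"
      using base z by (auto simp: continuous_map_def Pi_iff)
    ultimately show ?thesis
      using ext[OF z] by (simp add: continuous_map_from_wedge)
  qed
  have "openin Z (f -` {g \<in> ?C. g ` K \<subseteq> U} \<inter> topspace Z)"
    if K: "compactin ?W K" and U: "openin Y U" for K U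
  proof -
    let ?A = "\<lambda>i. {z \<in> topspace Z. \<forall>\<theta>\<in>{\<theta> \<in> {0..1}. wedge_loop n i \<theta> \<in> K}.
      (z, \<theta>) \<in> {p \<in> topspace (prod_topology Z I01). (\<lambda>(z, \<theta>). f z (wedge_loop n i \<theta>)) p \<in> U}}"
    let ?B = "{z \<in> topspace Z. f z (wedge_base n) \<in> U}"
    have A: "openin Z (?A i)" if "i < n" for i
      using that openin_continuous_map_preimage[OF loops U] compactin_wedge_loop_preimage[OF K]
      by (intro openin_slice_compactin) auto
    have B: "openin Z ?B"
      using base U by (rule openin_continuous_map_preimage)
    have KW: "K \<subseteq> topspace ?W"
      using K by (rule compactin_subset_topspace)
    have "f -` {g \<in> ?C. g ` K \<subseteq> U} \<inter> topspace Z
        = (topspace Z \<inter> (\<Inter>i<n. ?A i)) \<inter> (if wedge_base n \<in> K then ?B else topspace Z)"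
    proof (intro equalityI subsetI)
      fix z assume "z \<in> f -` {g \<in> ?C. g ` K \<subseteq> U} \<inter> topspace Z"
      then show "z \<in> (topspace Z \<inter> (\<Inter>i<n. ?A i)) \<inter> (if wedge_base n \<in> K then ?B else topspace Z)"
        by (auto simp: image_subset_iff)
    next
      fix z assume z: "z \<in> (topspace Z \<inter> (\<Inter>i<n. ?A i)) \<inter> (if wedge_base n \<in> K then ?B else topspace Z)"
      have "f z w \<in> U" if w: "w \<in> K" for w
      proof -
        have "w \<in> topspace ?W"
          using w KW by auto
        then show ?thesis
        proof (cases rule: wedge_cases)
          case 1
          then show ?thesis
            using z w by auto
        next
          case (2 i \<theta>)
          then show ?thesis
            using z w by auto
        qed
      qed
      then show "z \<in> f -` {g \<in> ?C. g ` K \<subseteq> U} \<inter> topspace Z"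
        using z fC by (auto split: if_splits)
    qed
    moreover have "openin Z (topspace Z \<inter> (\<Inter>i<n. ?A i))"
      using A by (cases "n = 0") (auto intro!: openin_Int openin_INT)
    ultimately show ?thesis
      using B by (auto intro!: openin_Int)
  qed
  moreover have "f ` topspace Z \<subseteq> topspace (mapping_space ?W Y)"
    using fC unfolding topspace_mapping_space by blast
  ultimately show ?thesis
    unfolding topspace_mapping_space
    unfolding mapping_space_def Let_def continuous_on_generated_topo_iff Union_mapping_space_subbase
    by blast
qed

section \<open>Cardinalities\<close>

text \<open>A real number is coded by a set of naturals, and a sequence of such sets is merged into
  a single one by a pairing function.\<close>

lemma lepoll_nat_fun_real: "(UNIV :: (nat \<Rightarrow> real) set) \<lesssim> (UNIV :: real set)"
proof -
  obtain g :: "real \<Rightarrow> nat set" where g: "inj g"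
    using eqpoll_imp_lepoll[OF eqpoll_sym[OF nat_sets_eqpoll_reals]] by (auto simp: lepoll_def)
  define F :: "(nat \<Rightarrow> real) \<Rightarrow> nat set" where "F x = {prod_encode (i, j) | i j. j \<in> g (x i)}" for x
  have "inj F"
  proof (rule injI)
    fix x y assume xy: "F x = F y"
    have "j \<in> g (x i) \<longleftrightarrow> prod_encode (i, j) \<in> F x" "j \<in> g (y i) \<longleftrightarrow> prod_encode (i, j) \<in> F y" for i j
      by (auto simp: F_def)
    then have "g (x i) = g (y i)" for i
      using xy by blast
    then show "x = y"
      using g by (auto simp: inj_def)
  qed
  then have "(UNIV :: (nat \<Rightarrow> real) set) \<lesssim> (UNIV :: nat set set)"
    by (auto simp: lepoll_def)
  then show ?thesis
    using nat_sets_eqpoll_reals by (rule lepoll_trans2)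
qed

lemma lepoll_real_Times:
  assumes "A \<lesssim> (UNIV :: real set)" "B \<lesssim> (UNIV :: real set)"
  shows "A \<times> B \<lesssim> (UNIV :: real set)"
proof -
  obtain f :: "_ \<Rightarrow> real" and g :: "_ \<Rightarrow> real" where fg: "inj_on f A" "inj_on g B"
    using assms by (auto simp: lepoll_def)
  define F where "F = (\<lambda>p (k :: nat). if k = 0 then f (fst p) else g (snd p))"
  have "inj_on F (A \<times> B)"
  proof (rule inj_onI)
    fix p q assume pq: "p \<in> A \<times> B" "q \<in> A \<times> B" "F p = F q"
    have "f (fst p) = f (fst q)" "g (snd p) = g (snd q)"
      using fun_cong[OF pq(3), of 0] fun_cong[OF pq(3), of 1] by (simp_all add: F_def)
    then show "p = q"
      using pq(1,2) inj_onD[OF fg(1)] inj_onD[OF fg(2)] by (simp add: mem_Times_iff prod_eq_iff)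
  qed
  then have "A \<times> B \<lesssim> (UNIV :: (nat \<Rightarrow> real) set)"
    by (auto simp: lepoll_def)
  then show ?thesis
    using lepoll_nat_fun_real by (rule lepoll_trans)
qed

text \<open>In a Hausdorff space a point is determined by the members of a countable base that
  contain it, hence by a set of naturals.\<close>

lemma second_countable_lepoll_real:
  assumes haus: "Hausdorff_space M" and sc: "second_countable M"
  shows "topspace M \<lesssim> (UNIV :: real set)"
proof -
  obtain \<B> where \<B>: "countable \<B>" "\<forall>U x. openin M U \<and> x \<in> U \<longrightarrow> (\<exists>V\<in>\<B>. x \<in> V \<and> V \<subseteq> U)"
    using sc by (auto simp: second_countable_def)
  obtain c :: "'a set \<Rightarrow> nat" where c: "inj_on c \<B>"
    using \<B>(1) by (auto simp: countable_def)
  have "inj_on (\<lambda>x. c ` {V \<in> \<B>. x \<in> V}) (topspace M)"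
  proof (rule inj_onI, rule ccontr)
    fix x y assume xy: "x \<in> topspace M" "y \<in> topspace M" "c ` {V \<in> \<B>. x \<in> V} = c ` {V \<in> \<B>. y \<in> V}" "x \<noteq> y"
    obtain U where "openin M U" "x \<in> U" "y \<notin> U"
      using haus xy(1,2,4) unfolding Hausdorff_space_def disjnt_iff by metis
    then obtain V where V: "V \<in> \<B>" "x \<in> V" "y \<notin> V"
      using \<B>(2) by (meson subsetD)
    then have "c V \<in> c ` {V \<in> \<B>. y \<in> V}"
      using xy(3) by blast
    then obtain V' where "V' \<in> \<B>" "y \<in> V'" "c V = c V'"
      by blast
    then show False
      using c V by (metis inj_onD)
  qed
  then have "topspace M \<lesssim> (UNIV :: nat set set)"
    unfolding lepoll_def by blast
  then show ?thesis
    using nat_sets_eqpoll_reals by (rule lepoll_trans2)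
qed

lemma rational_closure_I01:
  assumes "x \<in> {0..1}"
  shows "x \<in> I01 closure_of (\<rat> \<inter> {0..1})"
  unfolding in_closure_of
proof (intro conjI allI impI)
  fix T assume T: "x \<in> T \<and> openin I01 T"
  then obtain e where e: "e > 0" "ball x e \<inter> {0..1} \<subseteq> T"
    unfolding openin_contains_ball by blast
  have "max 0 (x - e) < min 1 (x + e)"
    using assms e(1) by auto
  then obtain q where "q \<in> \<rat>" "max 0 (x - e) < q" "q < min 1 (x + e)"
    using Rats_dense_in_real by blast
  then show "\<exists>y. y \<in> \<rat> \<inter> {0..1} \<and> y \<in> T"
    using e(2) by (intro exI[of _ q]) (auto simp: subset_iff dist_real_def)
qed (use assms in simp)

text \<open>A continuous map into a Hausdorff space is determined by its values on a dense set, and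
  the rational points of the loops together with the base point are countable.\<close>

lemma wedge_maps_lepoll_real:
  assumes haus: "Hausdorff_space M" and sc: "second_countable M"
  shows "topspace (mapping_space (wedge_circles n) M) \<lesssim> (UNIV :: real set)"
proof -
  let ?W = "wedge_circles n"
  obtain g :: "_ \<Rightarrow> real" where g: "inj_on g (topspace M)"
    using second_countable_lepoll_real[OF assms] by (auto simp: lepoll_def)
  define D where "D = insert (wedge_base n) (\<Union>i<n. wedge_loop n i ` (\<rat> \<inter> {0..1}))"
  have D: "countable D"
    unfolding D_def by (auto simp: countable_rat countable_Int1 intro!: countable_UN)
  have DW: "D \<subseteq> topspace ?W"
    using wedge_loop_in_topspace wedge_base_in_topspace by (fastforce simp: D_def)
  have D_enum: "range (from_nat_into D) = D"
    using D by (intro range_from_nat_into) (auto simp: D_def)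
  have "inj_on (\<lambda>\<gamma> k. g (\<gamma> (from_nat_into D k))) (topspace (mapping_space ?W M))"
  proof (rule inj_onI)
    fix \<gamma> \<delta> assume *: "\<gamma> \<in> topspace (mapping_space ?W M)" "\<delta> \<in> topspace (mapping_space ?W M)"
      "(\<lambda>k. g (\<gamma> (from_nat_into D k))) = (\<lambda>k. g (\<delta> (from_nat_into D k)))"
    have cont: "continuous_map ?W M \<gamma>" "continuous_map ?W M \<delta>"
      and ext: "\<gamma> \<in> extensional (topspace ?W)" "\<delta> \<in> extensional (topspace ?W)"
      using *(1,2) by (auto simp: topspace_mapping_space)
    have onD: "\<gamma> w = \<delta> w" if w: "w \<in> D" for w
    proof -
      obtain k where "w = from_nat_into D k"
        using w D_enum by blast
      then have "g (\<gamma> w) = g (\<delta> w)"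
        using fun_cong[OF *(3), of k] by simp
      moreover have "\<gamma> w \<in> topspace M" "\<delta> w \<in> topspace M"
        using cont w DW by (auto simp: continuous_map_def Pi_iff)
      ultimately show ?thesis
        using g by (auto simp: inj_on_def)
    qed
    have "\<gamma> w = \<delta> w" if "w \<in> topspace ?W" for w
      using that
    proof (cases rule: wedge_cases)
      case 1
      then show ?thesis
        using onD by (simp add: D_def)
    next
      case (2 i \<theta>)
      have "(\<gamma> \<circ> wedge_loop n i) \<theta> = (\<delta> \<circ> wedge_loop n i) \<theta>"
      proof (rule forall_in_closure_of_eq[OF rational_closure_I01 haus])
        show "continuous_map I01 M (\<gamma> \<circ> wedge_loop n i)" "continuous_map I01 M (\<delta> \<circ> wedge_loop n i)"
          using cont continuous_map_wedge_loop[OF 2(1)] by (auto intro: continuous_map_compose)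
        show "(\<gamma> \<circ> wedge_loop n i) q = (\<delta> \<circ> wedge_loop n i) q" if "q \<in> \<rat> \<inter> {0..1}" for q
        proof -
          have "wedge_loop n i q \<in> D"
            using that 2(1) unfolding D_def by blast
          then show ?thesis
            using onD by simp
        qed
      qed (use 2 in auto)
      then show ?thesis
        by (simp add: 2(4))
    qed
    then show "\<gamma> = \<delta>"
      using ext by (auto intro: extensionalityI)
  qed
  then have "topspace (mapping_space ?W M) \<lesssim> (UNIV :: (nat \<Rightarrow> real) set)"
    unfolding lepoll_def by blast
  then show ?thesis
    using lepoll_nat_fun_real by (rule lepoll_trans)
qed

section \<open>Shrinking one circle\<close>

text \<open>For a singleton \<open>S\<close> this is one retraction \<open>r\<^sub>i\<close>.
  General \<open>S\<close> records the composite of those already performed; for all n indices it is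
  the constant map at the base value.\<close>

definition shrink_circles :: "nat \<Rightarrow> nat set \<Rightarrow> (nat \<times> complex \<Rightarrow> 'p) \<Rightarrow> nat \<times> complex \<Rightarrow> 'p" where
  "shrink_circles n S \<gamma> =
     (\<lambda>w\<in>topspace (wedge_circles n). if fst w \<in> S then \<gamma> (wedge_base n) else \<gamma> w)"

lemma continuous_map_shrink_circles:
  "continuous_map (mapping_space (wedge_circles n) M) (mapping_space (wedge_circles n) M) (shrink_circles n S)"
proof (rule continuous_map_into_wedge_maps)
  have base: "continuous_map (mapping_space (wedge_circles n) M) M (\<lambda>\<gamma>. \<gamma> (wedge_base n))"
    by (rule continuous_map_eval[OF wedge_base_in_topspace])
  then show "continuous_map (mapping_space (wedge_circles n) M) M (\<lambda>\<gamma>. shrink_circles n S \<gamma> (wedge_base n))"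
    by (simp add: shrink_circles_def wedge_base_in_topspace)
  fix j assume j: "j < n"
  let ?X = "prod_topology (mapping_space (wedge_circles n) M) I01"
  have "continuous_map ?X M (if j \<in> S then (\<lambda>\<gamma>. \<gamma> (wedge_base n)) \<circ> fst else (\<lambda>(\<gamma>, \<theta>). \<gamma> (wedge_loop n j \<theta>)))"
    using continuous_map_compose[OF continuous_map_fst base, of I01]
      continuous_map_eval_path[OF continuous_map_wedge_loop[OF j], where Y = M]
    by (cases "j \<in> S") (simp_all only: if_True if_False)
  then show "continuous_map ?X M (\<lambda>(\<gamma>, \<theta>). shrink_circles n S \<gamma> (wedge_loop n j \<theta>))"
  proof (rule continuous_map_eq)
    fix p assume "p \<in> topspace ?X"
    then obtain \<gamma> \<theta> where p: "p = (\<gamma>, \<theta>)" "0 \<le> \<theta>" "\<theta> \<le> 1"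
      by auto
    show "(if j \<in> S then (\<lambda>\<gamma>. \<gamma> (wedge_base n)) \<circ> fst else (\<lambda>(\<gamma>, \<theta>). \<gamma> (wedge_loop n j \<theta>))) p
        = (\<lambda>(\<gamma>, \<theta>). shrink_circles n S \<gamma> (wedge_loop n j \<theta>)) p"
      using wedge_loop_in_topspace[OF j p(2,3)] by (auto simp: p(1) shrink_circles_def wedge_loop_def)
  qed
qed (simp add: shrink_circles_def)

text \<open>The step for one loop. The smooth structure enters only through the maps \<phi> and
  \<open>P\<close> near the diagonal; \<open>z\<close> stands for the zero section and
  \<open>T0\<close> for its complement. That \<open>P\<close> is stationary on the diagonal makes
  the two ends of the deformation exact formulas.\<close>

lemma coh_cup_shrink_circle:
  fixes h :: "('u, 'c) cohomology" and M :: "'p topology" and T :: "'t topology"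
  defines "E \<equiv> \<lambda>n. mapping_space (wedge_circles n) M"
  defines "ev \<equiv> \<lambda>n (\<gamma> :: nat \<times> complex \<Rightarrow> 'p). \<gamma> (wedge_base n)"
  assumes mult: "multiplicative_cohomology_theory h"
    and leE: "topspace (prod_topology (E n) I01) \<lesssim> (UNIV :: 'u set)" "topspace (E n) \<lesssim> (UNIV :: 'u set)"
    and leT: "topspace T \<lesssim> (UNIV :: 'u set)"
    and haus: "Hausdorff_space M"
    and N: "openin (prod_topology M M) N" and diag: "\<And>x. x \<in> topspace M \<Longrightarrow> (x, x) \<in> N"
    and \<phi>: "continuous_map (subtopology (prod_topology M M) N) T \<phi>"
    and \<phi>diag: "\<And>x. x \<in> topspace M \<Longrightarrow> \<phi> (x, x) = z x"
    and \<phi>T0: "\<And>x y. (x, y) \<in> N \<Longrightarrow> x \<noteq> y \<Longrightarrow> \<phi> (x, y) \<in> T0" and T0: "T0 \<subseteq> topspace T"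
    and P: "continuous_map (prod_topology (subtopology (prod_topology M M) N) I01) M P"
    and P0: "\<And>x y. (x, y) \<in> N \<Longrightarrow> P ((x, y), 0) = y" and P1: "\<And>x y. (x, y) \<in> N \<Longrightarrow> P ((x, y), 1) = x"
    and Pdiag: "\<And>x u. x \<in> topspace M \<Longrightarrow> 0 \<le> u \<Longrightarrow> u \<le> 1 \<Longrightarrow> P ((x, x), u) = x"
    and i: "i < n"
    and b: "b \<in> carrier (coh h p (E n) {})" and t: "t \<in> carrier (coh h q T T0)"
  shows "coh_cup h (E n) {} {} p q b (coh_ind h q (E n) {} T T0 (z \<circ> ev n) t)
       = coh_cup h (E n) {} {} p q (coh_ind h p (E n) {} (E n) {} (shrink_circles n {i}) b)
           (coh_ind h q (E n) {} T T0 (z \<circ> ev n) t)"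
proof -
  interpret multiplicative_cohomology_theory h by fact
  have coh: "cohomology_theory h" by unfold_locales
  let ?W = "wedge_circles n" and ?E = "E n" and ?x = "wedge_base n" and ?e = "wedge_loop n i"
  let ?X = "prod_topology ?E I01"
  have topE: "\<gamma> \<in> topspace ?E \<longleftrightarrow> \<gamma> \<in> extensional (topspace ?W) \<and> continuous_map ?W M \<gamma>" for \<gamma>
    by (simp add: E_def topspace_mapping_space)
  have ev_cont: "continuous_map ?E M (\<lambda>\<gamma>. \<gamma> ?x)"
    unfolding E_def by (rule continuous_map_eval[OF wedge_base_in_topspace])
  have eval: "continuous_map (prod_topology ?E I01) M (\<lambda>(\<gamma>, \<theta>). \<gamma> (wedge_loop n j \<theta>))" if "j < n" for j
    unfolding E_def by (rule continuous_map_eval_path[OF continuous_map_wedge_loop[OF that]])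
  have ev_in: "\<gamma> ?x \<in> topspace M" if "\<gamma> \<in> topspace ?E" for \<gamma>
    using ev_cont that by (auto simp: continuous_map_def Pi_iff)
  have ends: "\<gamma> (?e 0) = \<gamma> ?x" "\<gamma> (?e 1) = \<gamma> ?x" for \<gamma> :: "nat \<times> complex \<Rightarrow> 'p"
    by (simp_all add: wedge_loop_ends)
  define \<pi> where "\<pi> = (\<lambda>(\<gamma> :: nat \<times> complex \<Rightarrow> 'p, s). (\<gamma> ?x, \<gamma> (?e s)))"
  have ev_X: "continuous_map ?X M (\<lambda>(\<gamma>, s). \<gamma> ?x)"
    using continuous_map_compose[OF continuous_map_fst ev_cont, of I01] by (simp add: comp_def case_prod_unfold)
  have \<pi>: "continuous_map ?X (prod_topology M M) \<pi>"
    using ev_X eval[OF i] by (simp add: continuous_map_pairwise \<pi>_def comp_def case_prod_unfold)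
  \<comment> \<open>\<open>F\<close> collects the cut loops whose two end points are close enough to
    be joined by \<open>P\<close>; \<open>G\<close> collects those already closed.\<close>
  define F where "F = {p \<in> topspace ?X. \<pi> p \<in> N}"
  define G where "G = {p \<in> topspace ?X. (\<lambda>(\<gamma>, s). \<gamma> ?x) p = (\<lambda>(\<gamma>, s). \<gamma> (?e s)) p}"
  have F: "openin ?X F"
    unfolding F_def using \<pi> N by (rule openin_continuous_map_preimage)
  have G: "closedin ?X G"
    unfolding G_def by (rule closedin_continuous_maps_eq[OF haus ev_X eval[OF i]])
  have GF: "G \<subseteq> F"
    using diag ev_in by (fastforce simp: G_def F_def \<pi>_def)
  have \<pi>F: "continuous_map (subtopology ?X F) (subtopology (prod_topology M M) N) \<pi>"
    using \<pi> by (auto simp: continuous_map_in_subtopology F_def continuous_map_from_subtopology)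
  have \<phi>F: "continuous_map (subtopology ?X F) T (\<phi> \<circ> \<pi>)"
    by (rule continuous_map_compose[OF \<pi>F \<phi>])
  have \<phi>FG: "(\<phi> \<circ> \<pi>) ` (F - G) \<subseteq> T0"
    using \<phi>T0 by (auto simp: F_def G_def \<pi>_def)
  \<comment> \<open>In the first half of the time the loop is followed at double speed up to the cut
    \<open>s\<close>, where it waits; in the second half \<open>P\<close> leads from the cut back to
    the base value.\<close>
  define \<Lambda> where "\<Lambda> = (\<lambda>((\<gamma> :: nat \<times> complex \<Rightarrow> 'p, s), \<theta>).
    if \<theta> \<le> 1 / 2 then \<gamma> (?e (min s (2 * \<theta>))) else P ((\<gamma> ?x, \<gamma> (?e s)), 2 * \<theta> - 1))"
  \<comment> \<open>The base point of the wedge has index \<open>n\<close>, so it never falls under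
    \<open>fst w = i\<close>, and \<open>turn\<close> is evaluated only away from its
    discontinuity.\<close>
  define c where "c = (\<lambda>(\<gamma> :: nat \<times> complex \<Rightarrow> 'p, s). \<lambda>w\<in>topspace ?W.
    if fst w = i then \<Lambda> ((\<gamma>, s), turn (snd w)) else \<gamma> w)"
  let ?Z = "prod_topology (subtopology ?X F) I01"
  have topZ: "((\<gamma>, s), \<theta>) \<in> topspace ?Z \<longleftrightarrow>
      \<gamma> \<in> topspace ?E \<and> 0 \<le> s \<and> s \<le> 1 \<and> (\<gamma> ?x, \<gamma> (?e s)) \<in> N \<and> 0 \<le> \<theta> \<and> \<theta> \<le> 1" for \<gamma> s \<theta>
    by (auto simp: F_def \<pi>_def)
  have \<theta>_cont: "continuous_map ?Z euclideanreal snd"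
    using continuous_map_snd continuous_map_into_fulltopology by blast
  have fst_Z: "continuous_map ?Z ?X fst"
    using continuous_map_fst continuous_map_into_fulltopology by blast
  have s_cont: "continuous_map ?Z euclideanreal (\<lambda>p. snd (fst p))"
    using continuous_map_compose[OF fst_Z continuous_map_snd] continuous_map_into_fulltopology
    by (auto simp: comp_def)
  have \<gamma>_cont: "continuous_map ?Z ?E (\<lambda>p. fst (fst p))"
    using continuous_map_compose[OF fst_Z continuous_map_fst] by (simp add: comp_def)
  have \<Lambda>_cont: "continuous_map ?Z M \<Lambda>"
  proof -
    have 1: "continuous_map ?Z M (\<lambda>p. fst (fst p) (?e (min (snd (fst p)) (2 * snd p))))"
    proof -
      have "continuous_map ?Z euclideanreal (\<lambda>p. min (snd (fst p)) (2 * snd p))"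
        by (intro continuous_intros s_cont \<theta>_cont)
      then have "continuous_map ?Z I01 (\<lambda>p. min (snd (fst p)) (2 * snd p))"
        by (auto simp: continuous_map_in_subtopology min_def)
      then have "continuous_map ?Z ?X (\<lambda>p. (fst (fst p), min (snd (fst p)) (2 * snd p)))"
        using \<gamma>_cont by (simp add: continuous_map_pairwise comp_def)
      from continuous_map_compose[OF this eval[OF i]] show ?thesis
        by (simp add: comp_def)
    qed
    have 2: "continuous_map (subtopology ?Z {p \<in> topspace ?Z. 1 / 2 \<le> snd p}) M
        (\<lambda>p. P (\<pi> (fst p), 2 * snd p - 1))" (is "continuous_map ?Z2 _ _")
    proof -
      have "continuous_map ?Z euclideanreal (\<lambda>p. 2 * snd p - 1)"
        by (intro continuous_intros \<theta>_cont)
      then have "continuous_map ?Z2 I01 (\<lambda>p. 2 * snd p - 1)"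
        by (auto simp: continuous_map_in_subtopology continuous_map_from_subtopology)
      moreover have "continuous_map ?Z2 (subtopology (prod_topology M M) N) (\<lambda>p. \<pi> (fst p))"
        using continuous_map_compose[OF continuous_map_fst \<pi>F] continuous_map_from_subtopology
        by (fastforce simp: comp_def)
      ultimately have "continuous_map ?Z2 (prod_topology (subtopology (prod_topology M M) N) I01)
          (\<lambda>p. (\<pi> (fst p), 2 * snd p - 1))"
        by (simp add: continuous_map_pairwise comp_def)
      from continuous_map_compose[OF this P] show ?thesis
        by (simp add: comp_def)
    qed
    \<comment> \<open>At the midpoint the first formula has reached the cut, since \<open>s\<close>
      is at most 1, and \<open>P\<close> starts there.\<close>
    have "continuous_map ?Z M (\<lambda>p. if snd p \<le> 1 / 2 then fst (fst p) (?e (min (snd (fst p)) (2 * snd p)))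
        else P (\<pi> (fst p), 2 * snd p - 1))"
    proof (rule continuous_map_cases_le[OF \<theta>_cont _ continuous_map_from_subtopology[OF 1] 2])
      fix p assume p: "p \<in> topspace ?Z" "snd p = 1 / 2"
      obtain \<gamma> s \<theta> where pe: "p = ((\<gamma>, s), \<theta>)" by (metis surj_pair)
      have "(\<gamma> ?x, \<gamma> (?e s)) \<in> N" "s \<le> 1"
        using p topZ pe by auto
      moreover have \<theta>: "2 * \<theta> = 1"
        using p(2) pe by simp
      ultimately show "fst (fst p) (?e (min (snd (fst p)) (2 * snd p))) = P (\<pi> (fst p), 2 * snd p - 1)"
        using P0 by (simp add: pe \<pi>_def \<theta>)
    qed simp
    then show ?thesis
      by (rule continuous_map_eq) (auto simp: \<Lambda>_def \<pi>_def)
  qed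
  have base_fst: "fst ?x \<noteq> i"
    using i by (simp add: wedge_base_def)
  \<comment> \<open>The times 0 and 1 both give the base point, where \<open>turn\<close> cannot
    distinguish them. The formula survives because \<Lambda> has the base value at both: the loop
    starts there and \<open>P\<close> ends there.\<close>
  have c_loop: "c (\<gamma>, s) (wedge_loop n j \<theta>) = (if j = i then \<Lambda> ((\<gamma>, s), \<theta>) else \<gamma> (wedge_loop n j \<theta>))"
    if "j < n" "((\<gamma>, s), \<theta>) \<in> topspace ?Z" for j \<gamma> s \<theta>
  proof -
    have s: "0 \<le> s" "s \<le> 1" and \<theta>: "0 \<le> \<theta>" "\<theta> \<le> 1" and N': "(\<gamma> ?x, \<gamma> (?e s)) \<in> N"
      using that(2) topZ by auto
    consider "\<theta> = 0" | "\<theta> = 1" | "0 < \<theta>" "\<theta> < 1"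
      using \<theta> by linarith
    then show ?thesis
    proof cases
      case 1
      then show ?thesis
        using s base_fst ends by (simp add: c_def \<Lambda>_def wedge_loop_ends wedge_base_in_topspace)
    next
      case 2
      then show ?thesis
        using P1[OF N'] base_fst by (simp add: c_def \<Lambda>_def wedge_loop_ends wedge_base_in_topspace)
    next
      case 3
      then show ?thesis
        using wedge_loop_in_topspace[OF that(1) \<theta>] turn_cis[of \<theta>] by (simp add: c_def wedge_loop_eq)
    qed
  qed
  have into_E: "continuous_map Z ?E f"
    if "\<And>z. z \<in> topspace Z \<Longrightarrow> f z \<in> extensional (topspace ?W)"
      and "continuous_map Z M (\<lambda>z. f z ?x)"
      and "\<And>j. j < n \<Longrightarrow> continuous_map (prod_topology Z I01) M (\<lambda>(z, \<theta>). f z (wedge_loop n j \<theta>))"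
    for Z :: "'z topology" and f
    unfolding E_def by (rule continuous_map_into_wedge_maps[OF that])
  have c: "continuous_map (subtopology ?X F) ?E c"
  proof (rule into_E)
    fix p assume "p \<in> topspace (subtopology ?X F)"
    then show "c p \<in> extensional (topspace ?W)"
      by (auto simp: c_def)
  next
    have "continuous_map (subtopology ?X F) M (\<lambda>(\<gamma>, s). \<gamma> ?x)"
      using ev_X by (rule continuous_map_from_subtopology)
    then show "continuous_map (subtopology ?X F) M (\<lambda>p. c p ?x)"
      by (rule continuous_map_eq) (use base_fst in \<open>auto simp: c_def wedge_base_in_topspace\<close>)
  next
    fix j assume j: "j < n"
    have "continuous_map ?Z M (\<lambda>p. if j = i then \<Lambda> p else (\<lambda>(\<gamma>, \<theta>). \<gamma> (wedge_loop n j \<theta>)) (fst (fst p), snd p))"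
    proof (cases "j = i")
      case False
      have "continuous_map ?Z ?X (\<lambda>p. (fst (fst p), snd p))"
        using \<gamma>_cont by (simp add: continuous_map_pairwise comp_def continuous_map_snd[unfolded comp_def])
      from continuous_map_compose[OF this eval[OF j]] False show ?thesis
        by (simp add: comp_def)
    qed (use \<Lambda>_cont in simp)
    then show "continuous_map ?Z M (\<lambda>(p, \<theta>). c p (wedge_loop n j \<theta>))"
    proof (rule continuous_map_eq)
      fix p assume p: "p \<in> topspace ?Z"
      obtain \<gamma> s \<theta> where pe: "p = ((\<gamma>, s), \<theta>)" by (metis surj_pair)
      show "(if j = i then \<Lambda> p else (\<lambda>(\<gamma>, \<theta>). \<gamma> (wedge_loop n j \<theta>)) (fst (fst p), snd p))
          = (\<lambda>(p, \<theta>). c p (wedge_loop n j \<theta>)) p"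
        using c_loop[OF j p[unfolded pe]] by (simp add: pe)
    qed
  qed
  have hom: "homotopic_with (\<lambda>_. True) ?E ?X (\<lambda>\<gamma>. (\<gamma>, 0)) (\<lambda>\<gamma>. (\<gamma>, 1))"
    unfolding homotopic_with_def
  proof (intro exI conjI)
    show "continuous_map (prod_topology I01 ?E) ?X (\<lambda>(s, \<gamma>). (\<gamma>, s))"
      by (simp add: case_prod_unfold continuous_map_pairwise comp_def
          continuous_map_fst[unfolded comp_def] continuous_map_snd[unfolded comp_def])
  qed auto
  have im: "(\<lambda>\<gamma>. (\<gamma>, s)) ` topspace ?E \<subseteq> F" if "s = 0 \<or> s = 1" for s :: real
    using that diag ev_in by (auto simp: F_def \<pi>_def ends)
  have key: "coh_cup h ?E {} {} p q
        (coh_ind h p ?E {} ?E {} (c \<circ> (\<lambda>\<gamma>. (\<gamma>, 0))) b)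
        (coh_ind h q ?E {} T T0 (\<phi> \<circ> \<pi> \<circ> (\<lambda>\<gamma>. (\<gamma>, 0))) t)
    = coh_cup h ?E {} {} p q
        (coh_ind h p ?E {} ?E {} (c \<circ> (\<lambda>\<gamma>. (\<gamma>, 1))) b)
        (coh_ind h q ?E {} T T0 (\<phi> \<circ> \<pi> \<circ> (\<lambda>\<gamma>. (\<gamma>, 1))) t)"
    by (rule coh_cup_homotopic_supported[OF mult leE(1) leT leE(2) leE(2) F G GF \<phi>F \<phi>FG T0 c hom im im b t]) auto
  have restr: "continuous_map ?E (subtopology ?X F) (\<lambda>\<gamma>. (\<gamma>, s))" if "s = 0 \<or> s = 1" for s :: real
    using that im[OF that] homotopic_with_imp_continuous_maps[OF hom]
    by (auto simp: continuous_map_in_subtopology)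
  have \<phi>_end: "coh_ind h q ?E {} T T0 (\<phi> \<circ> \<pi> \<circ> (\<lambda>\<gamma>. (\<gamma>, s))) t = coh_ind h q ?E {} T T0 (z \<circ> ev n) t"
    if s: "s = 0 \<or> s = 1" for s :: real
  proof (rule coh_ind_cong[OF coh leE(2) leT _ _ t])
    show "pair_map ?E {} T T0 (\<phi> \<circ> \<pi> \<circ> (\<lambda>\<gamma>. (\<gamma>, s)))"
      using continuous_map_compose[OF restr[OF s] \<phi>F] T0 by (simp add: pair_map_def)
    show "(\<phi> \<circ> \<pi> \<circ> (\<lambda>\<gamma>. (\<gamma>, s))) \<gamma> = (z \<circ> ev n) \<gamma>" if "\<gamma> \<in> topspace ?E" for \<gamma>
      using s \<phi>diag[OF ev_in[OF that]] by (auto simp: \<pi>_def ev_def ends)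
  qed
  have c_pair: "pair_map ?E {} ?E {} (c \<circ> (\<lambda>\<gamma>. (\<gamma>, s)))" if "s = 0 \<or> s = 1" for s :: real
    using continuous_map_compose[OF restr[OF that] c] by (simp add: pair_map_def)
  \<comment> \<open>With the cut at time 0 the first half waits at the base value and the second
    half is \<open>P\<close> on the diagonal, so the loop is constant.\<close>
  have c0: "coh_ind h p ?E {} ?E {} (c \<circ> (\<lambda>\<gamma>. (\<gamma>, 0))) b = coh_ind h p ?E {} ?E {} (shrink_circles n {i}) b"
  proof (rule coh_ind_cong[OF coh leE(2) leE(2) c_pair _ b])
    fix \<gamma> assume \<gamma>: "\<gamma> \<in> topspace ?E"
    have "\<Lambda> ((\<gamma>, 0), turn z) = \<gamma> ?x" for z
      using turn_bounds[of z] Pdiag[OF ev_in[OF \<gamma>]] by (simp add: \<Lambda>_def ends min_def)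
    then show "(c \<circ> (\<lambda>\<gamma>. (\<gamma>, 0))) \<gamma> = shrink_circles n {i} \<gamma>"
      by (auto simp: c_def shrink_circles_def)
  qed simp
  \<comment> \<open>With the cut at time 1 the loop is run at double speed and then waits. The speed
    1 + v deforms the original loop (v = 0) into this one (v = 1).\<close>
  define H where "H = (\<lambda>(v :: real, \<gamma> :: nat \<times> complex \<Rightarrow> 'p). \<lambda>w\<in>topspace ?W.
    if fst w = i then \<gamma> (?e (min 1 ((1 + v) * turn (snd w)))) else \<gamma> w)"
  let ?Y = "prod_topology I01 ?E"
  let ?V = "prod_topology ?Y I01"
  have H_loop: "H (v, \<gamma>) (wedge_loop n j \<theta>)
      = (if j = i then \<gamma> (?e (min 1 ((1 + v) * \<theta>))) else \<gamma> (wedge_loop n j \<theta>))"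
    if "j < n" "0 \<le> v" "0 \<le> \<theta>" "\<theta> \<le> 1" for j v \<gamma> \<theta>
  proof -
    have "0 \<le> \<theta>" "\<theta> \<le> 1"
      by fact+
    then consider "\<theta> = 0" | "\<theta> = 1" | "0 < \<theta>" "\<theta> < 1"
      by linarith
    then show ?thesis
    proof cases
      case 3
      then show ?thesis
        using wedge_loop_in_topspace[OF that(1,3,4)] turn_cis[of \<theta>] by (simp add: H_def wedge_loop_eq)
    qed (use that base_fst in \<open>simp_all add: H_def wedge_loop_ends wedge_base_in_topspace\<close>)
  qed
  have "continuous_map ?Y ?E H"
  proof (rule into_E)
    fix p assume "p \<in> topspace ?Y"
    then show "H p \<in> extensional (topspace ?W)"
      by (auto simp: H_def)
  next
    have "continuous_map ?Y M (\<lambda>p. snd p ?x)"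
      using continuous_map_compose[OF continuous_map_snd ev_cont, of I01] by (simp add: comp_def)
    then show "continuous_map ?Y M (\<lambda>p. H p ?x)"
      by (rule continuous_map_eq) (use base_fst in \<open>auto simp: H_def wedge_base_in_topspace\<close>)
  next
    fix j assume j: "j < n"
    have fst_V: "continuous_map ?V ?Y fst" and snd_V: "continuous_map ?V I01 snd"
      by (rule continuous_map_fst, rule continuous_map_snd)
    have \<gamma>V: "continuous_map ?V ?E (\<lambda>p. snd (fst p))"
      using continuous_map_compose[OF fst_V continuous_map_snd] by (simp add: comp_def)
    have vV: "continuous_map ?V euclideanreal (\<lambda>p. fst (fst p))"
      using continuous_map_compose[OF fst_V continuous_map_fst] continuous_map_into_fulltopology
      by (auto simp: comp_def)
    have \<theta>V: "continuous_map ?V euclideanreal snd"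
      using snd_V continuous_map_into_fulltopology by blast
    have "continuous_map ?V euclideanreal (\<lambda>p. if j = i then min 1 ((1 + fst (fst p)) * snd p) else snd p)"
      by (cases "j = i") (auto intro!: continuous_intros vV \<theta>V)
    then have "continuous_map ?V I01 (\<lambda>p. if j = i then min 1 ((1 + fst (fst p)) * snd p) else snd p)"
      by (auto simp: continuous_map_in_subtopology min_def)
    then have "continuous_map ?V ?X
        (\<lambda>p. (snd (fst p), if j = i then min 1 ((1 + fst (fst p)) * snd p) else snd p))"
      using \<gamma>V by (simp add: continuous_map_pairwise comp_def)
    from continuous_map_compose[OF this eval[OF j]]
    show "continuous_map ?V M (\<lambda>(p, \<theta>). H p (wedge_loop n j \<theta>))"
      by (rule continuous_map_eq) (use H_loop[OF j] in auto)
  qed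
  then have H: "homotopic_with (\<lambda>_. True) ?E ?E (\<lambda>\<gamma>. H (0, \<gamma>)) (\<lambda>\<gamma>. H (1, \<gamma>))"
    unfolding homotopic_with_def by (intro exI[of _ H]) auto
  have H0_pair: "pair_map ?E {} ?E {} (\<lambda>\<gamma>. H (0, \<gamma>))"
    using homotopic_with_imp_continuous_maps[OF H] by (simp add: pair_map_def)
  have "coh_ind h p ?E {} ?E {} (c \<circ> (\<lambda>\<gamma>. (\<gamma>, 1))) b = coh_ind h p ?E {} ?E {} (\<lambda>\<gamma>. H (1, \<gamma>)) b"
  proof (rule coh_ind_cong[OF coh leE(2) leE(2) c_pair _ b])
    fix \<gamma> assume \<gamma>: "\<gamma> \<in> topspace ?E"
    have "\<Lambda> ((\<gamma>, 1), turn z) = \<gamma> (?e (min 1 (2 * turn z)))" for z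
      using turn_bounds[of z] Pdiag[OF ev_in[OF \<gamma>]] by (simp add: \<Lambda>_def ends min_def)
    then show "(c \<circ> (\<lambda>\<gamma>. (\<gamma>, 1))) \<gamma> = H (1, \<gamma>)"
      by (auto simp: c_def H_def)
  qed simp
  also have "\<dots> = coh_ind h p ?E {} ?E {} (\<lambda>\<gamma>. H (0, \<gamma>)) b"
    using coh_ind_homotopic[OF coh leE(2) leE(2) H b] by simp
  also have "\<dots> = coh_ind h p ?E {} ?E {} id b"
  proof (rule coh_ind_cong[OF coh leE(2) leE(2) H0_pair _ b])
    fix \<gamma> assume \<gamma>: "\<gamma> \<in> topspace ?E"
    have "H (0, \<gamma>) w = \<gamma> w" for w
    proof (cases "w \<in> topspace ?W")
      case True
      then have "\<gamma> (?e (turn (snd w))) = \<gamma> w" if "fst w = i"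
        using that i base_fst wedge_loop_turn[of "snd w" n i]
        by (auto simp: topspace_wedge_circles)
      then show ?thesis
        using True turn_bounds[of "snd w"] by (simp add: H_def min_def)
    next
      case False
      then show ?thesis
        using \<gamma> topE extensional_arb[of \<gamma> "topspace ?W" w] by (simp add: H_def)
    qed
    then show "H (0, \<gamma>) = id \<gamma>"
      by auto
  qed
  also have "\<dots> = b"
    by (rule coh_ind_id[OF coh leE(2) b])
  finally have c1: "coh_ind h p ?E {} ?E {} (c \<circ> (\<lambda>\<gamma>. (\<gamma>, 1))) b = b" .
  from key show ?thesis
    unfolding c0 c1 using \<phi>_end by simp
qed

section \<open>Charts, bump functions and paths near the diagonal\<close>

text \<open>The formulas for \<phi> and \<open>P\<close> make sense everywhere but are continuous
  only near the diagonal. This local notion can be composed without tracking domains, and the points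
  where it holds form an open set, from which a neighbourhood is extracted at the end.\<close>

definition continuous_near :: "'a topology \<Rightarrow> 'b topology \<Rightarrow> ('a \<Rightarrow> 'b) \<Rightarrow> 'a \<Rightarrow> bool" where
  "continuous_near X Y f p \<longleftrightarrow>
     (\<exists>U. openin X U \<and> p \<in> U \<and> continuous_map (subtopology X U) Y f)"

lemma continuous_nearI:
  assumes "openin X U" "p \<in> U" "continuous_map (subtopology X U) Y f"
  shows "continuous_near X Y f p"
  using assms by (auto simp: continuous_near_def)

lemma continuous_map_imp_near:
  assumes "continuous_map X Y f" "p \<in> topspace X"
  shows "continuous_near X Y f p"
  using assms by (intro continuous_nearI[of X "topspace X"]) auto

lemma continuous_near_eq:
  assumes f: "continuous_near X Y f p" and U: "openin X U" "p \<in> U" and eq: "\<And>x. x \<in> U \<Longrightarrow> f x = g x"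
  shows "continuous_near X Y g p"
proof -
  obtain V where V: "openin X V" "p \<in> V" "continuous_map (subtopology X V) Y f"
    using f by (auto simp: continuous_near_def)
  have "continuous_map (subtopology X (U \<inter> V)) Y f"
    using continuous_map_from_subtopology_mono[OF V(3)] by blast
  then have "continuous_map (subtopology X (U \<inter> V)) Y g"
    by (rule continuous_map_eq) (use eq in auto)
  then show ?thesis
    using U V by (intro continuous_nearI[of X "U \<inter> V"]) auto
qed

lemma continuous_near_compose:
  assumes f: "continuous_near X Y f p" and g: "continuous_near Y Z g (f p)"
  shows "continuous_near X Z (\<lambda>x. g (f x)) p"
proof -
  obtain U where U: "openin X U" "p \<in> U" "continuous_map (subtopology X U) Y f"
    using f by (auto simp: continuous_near_def)
  obtain V where V: "openin Y V" "f p \<in> V" "continuous_map (subtopology Y V) Z g"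
    using g by (auto simp: continuous_near_def)
  let ?O = "{x \<in> topspace (subtopology X U). f x \<in> V}"
  have "openin (subtopology X U) ?O"
    using U(3) V(1) by (rule openin_continuous_map_preimage)
  then have O: "openin X ?O"
    using U(1) openin_trans_full by blast
  have OU: "?O \<subseteq> U"
    by auto
  have "continuous_map (subtopology X ?O) (subtopology Y V) f"
    using continuous_map_from_subtopology_mono[OF U(3) OU]
    by (auto simp: continuous_map_in_subtopology)
  from continuous_map_compose[OF this V(3)] show ?thesis
    using O U V openin_subset[OF U(1)] by (intro continuous_nearI[of X ?O]) (auto simp: comp_def)
qed

lemma continuous_near_pair:
  assumes "continuous_near X Y f p" "continuous_near X Z g p"
  shows "continuous_near X (prod_topology Y Z) (\<lambda>x. (f x, g x)) p"
proof -
  obtain U where U: "openin X U" "p \<in> U" "continuous_map (subtopology X U) Y f"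
    using assms by (auto simp: continuous_near_def)
  obtain V where V: "openin X V" "p \<in> V" "continuous_map (subtopology X V) Z g"
    using assms by (auto simp: continuous_near_def)
  have "continuous_map (subtopology X (U \<inter> V)) Y f" "continuous_map (subtopology X (U \<inter> V)) Z g"
    using continuous_map_from_subtopology_mono[OF U(3)] continuous_map_from_subtopology_mono[OF V(3)]
    by blast+
  then show ?thesis
    using U V by (intro continuous_nearI[of X "U \<inter> V"]) (auto simp: continuous_map_pairwise comp_def)
qed

lemma openin_continuous_near: "openin X {p. continuous_near X Y f p}"
proof (subst openin_subopen, clarify)
  fix p assume "continuous_near X Y f p"
  then obtain U where "openin X U" "p \<in> U" "continuous_map (subtopology X U) Y f"
    by (auto simp: continuous_near_def)
  then show "\<exists>T. openin X T \<and> p \<in> T \<and> T \<subseteq> {p. continuous_near X Y f p}"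
    by (intro exI[of _ U]) (auto intro: continuous_nearI)
qed

lemma continuous_map_if_near:
  assumes "\<And>p. p \<in> S \<Longrightarrow> continuous_near X Y f p"
  shows "continuous_map (subtopology X S) Y f"
  unfolding continuous_map_def
proof (intro conjI allI impI)
  show "f \<in> topspace (subtopology X S) \<rightarrow> topspace Y"
    using assms by (fastforce simp: continuous_near_def continuous_map_def Pi_iff)
  fix V assume V: "openin Y V"
  show "openin (subtopology X S) {x \<in> topspace (subtopology X S). f x \<in> V}"
  proof (subst openin_subopen, rule ballI)
    fix p assume p: "p \<in> {x \<in> topspace (subtopology X S). f x \<in> V}"
    then obtain U where U: "openin X U" "p \<in> U" "continuous_map (subtopology X U) Y f"
      using assms[of p] by (auto simp: continuous_near_def)
    have "openin (subtopology X U) {x \<in> topspace (subtopology X U). f x \<in> V}"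
      using U(3) V by (rule openin_continuous_map_preimage)
    then have "openin X {x \<in> topspace (subtopology X U). f x \<in> V}"
      using U(1) openin_trans_full by blast
    then have "openin (subtopology X S) ({x \<in> topspace (subtopology X U). f x \<in> V} \<inter> S)"
      by (rule openin_subtopology_Int)
    then show "\<exists>T. openin (subtopology X S) T \<and> p \<in> T \<and> T \<subseteq> {x \<in> topspace (subtopology X S). f x \<in> V}"
      using p U(2) by (intro exI[of _ "{x \<in> topspace (subtopology X U). f x \<in> V} \<inter> S"]) auto
  qed
qed

section \<open>Coordinate boxes in Euclidean space and bump functions in charts\<close>

lemma continuous_map_Euclidean_space_iff':
  "continuous_map X (Euclidean_space m) f \<longleftrightarrow>
     (\<forall>k. continuous_map X euclideanreal (\<lambda>x. f x k)) \<and> (\<forall>x\<in>topspace X. \<forall>k\<ge>m. f x k = 0)"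
  by (auto simp: Euclidean_space_def continuous_map_in_subtopology continuous_map_componentwise_UNIV Pi_iff)

lemma continuous_map_Euclidean_space_component: "continuous_map (Euclidean_space m) euclideanreal (\<lambda>x. x k)"
  using continuous_map_Euclidean_space_iff'[of "Euclidean_space m" m id] by simp

lemma openin_Euclidean_space_box:
  assumes V: "openin (Euclidean_space m) V" and y: "y \<in> V"
  obtains r where "r > 0"
    "\<And>z. z \<in> topspace (Euclidean_space m) \<Longrightarrow> (\<And>k. k < m \<Longrightarrow> \<bar>z k - y k\<bar> < r) \<Longrightarrow> z \<in> V"
proof -
  obtain V' where V': "openin (powertop_real UNIV) V'" and V_eq: "V = V' \<inter> {x. \<forall>i\<ge>m. x i = 0}"
    using V unfolding Euclidean_space_def openin_subtopology by blast
  have "y \<in> V'"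
    using y V_eq by simp
  with V' have "\<exists>W. finite {i \<in> UNIV. W i \<noteq> topspace euclideanreal} \<and>
      (\<forall>i\<in>UNIV. openin euclideanreal (W i)) \<and> y \<in> Pi\<^sub>E UNIV W \<and> Pi\<^sub>E UNIV W \<subseteq> V'"
    unfolding openin_product_topology_alt by (rule bspec)
  then obtain W where "\<forall>i\<in>UNIV. openin euclideanreal (W i)"
    and W: "y \<in> Pi\<^sub>E UNIV W" "Pi\<^sub>E UNIV W \<subseteq> V'"
    by (elim exE conjE)
  then have W': "\<And>i. open (W i)"
    by simp
  have "\<exists>r>0. \<forall>s. \<bar>s - y k\<bar> < r \<longrightarrow> s \<in> W k" for k
  proof -
    have "y k \<in> W k"
      using W(1) by (auto simp: PiE_iff)
    then obtain r where "r > 0" "ball (y k) r \<subseteq> W k"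
      using W' openE by blast
    then show ?thesis
      by (intro exI[of _ r]) (auto simp: subset_iff dist_real_def abs_minus_commute)
  qed
  then obtain \<rho> where \<rho>: "\<And>k. \<rho> k > 0" "\<And>k s. \<bar>s - y k\<bar> < \<rho> k \<Longrightarrow> s \<in> W k"
    by metis
  \<comment> \<open>The inserted 1 keeps the minimum defined for m = 0.\<close>
  define r where "r = Min (insert 1 (\<rho> ` {..<m}))"
  have r: "r > 0" "\<And>k. k < m \<Longrightarrow> r \<le> \<rho> k"
    using \<rho>(1) by (auto simp: r_def)
  moreover have "z \<in> V" if z: "z \<in> topspace (Euclidean_space m)" "\<And>k. k < m \<Longrightarrow> \<bar>z k - y k\<bar> < r" for z
  proof -
    have "z k \<in> W k" for k
    proof (cases "k < m")
      case True
      then show ?thesis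
        using z(2)[of k] r(2)[of k] \<rho>(2) by fastforce
    next
      case False
      then have "z k = y k"
        using z(1) y by (simp add: topspace_Euclidean_space V_eq)
      then show ?thesis
        using \<rho>(1) \<rho>(2)[of "z k" k] by simp
    qed
    then show ?thesis
      using W(2) z(1) by (auto simp: V_eq topspace_Euclidean_space PiE_iff)
  qed
  ultimately show ?thesis
    using that by blast
qed

lemma openin_Euclidean_box:
  "openin (Euclidean_space m) {z \<in> topspace (Euclidean_space m). \<forall>k<m. \<bar>z k - y k\<bar> < r}"
proof -
  have "openin (Euclidean_space m) {z \<in> topspace (Euclidean_space m). \<bar>z k - y k\<bar> \<in> {..<r}}" for k
    by (rule openin_continuous_map_preimage[where Y = euclideanreal])
      (auto intro!: continuous_intros continuous_map_Euclidean_space_component)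
  then have "openin (Euclidean_space m) (topspace (Euclidean_space m) \<inter>
      (\<Inter>k<m. {z \<in> topspace (Euclidean_space m). \<bar>z k - y k\<bar> \<in> {..<r}}))"
    by (cases "m = 0") (auto intro!: openin_Int openin_INT)
  then show ?thesis
    by (rule back_subst[of "openin (Euclidean_space m)"]) auto
qed

lemma compactin_Euclidean_box:
  assumes y: "y \<in> topspace (Euclidean_space m)"
  shows "compactin (Euclidean_space m) {z \<in> topspace (Euclidean_space m). \<forall>k<m. \<bar>z k - y k\<bar> \<le> r}"
proof -
  have "compactin (powertop_real UNIV) (Pi\<^sub>E UNIV (\<lambda>k. if k < m then {y k - r..y k + r} else {0}))"
    by (simp add: compactin_PiE)
  moreover have "Pi\<^sub>E UNIV (\<lambda>k. if k < m then {y k - r..y k + r} else {0})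
      = {z \<in> topspace (Euclidean_space m). \<forall>k<m. \<bar>z k - y k\<bar> \<le> r}"
    by (auto simp: topspace_Euclidean_space PiE_iff abs_le_iff split: if_splits)
      (smt (verit) not_less)+
  ultimately show ?thesis
    by (simp add: Euclidean_space_def compactin_subtopology) (auto simp: topspace_Euclidean_space)
qed

lemma chart_homeomorphism:
  assumes "is_chart m M c"
  shows "homeomorphic_maps (subtopology M (fst c)) (subtopology (Euclidean_space m) (snd c ` fst c))
           (snd c) (inv_into (fst c) (snd c))"
    and "openin (Euclidean_space m) (snd c ` fst c)" and "openin M (fst c)" and "inj_on (snd c) (fst c)"
    and "snd c ` fst c \<subseteq> topspace (Euclidean_space m)"
proof -
  obtain V where V: "openin (Euclidean_space m) V"
    and h: "homeomorphic_map (subtopology M (fst c)) (subtopology (Euclidean_space m) V) (snd c)"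
    and U: "openin M (fst c)"
    using assms by (auto simp: is_chart_def)
  have tU: "topspace (subtopology M (fst c)) = fst c"
    using openin_subset[OF U] by auto
  have im: "snd c ` fst c = V"
    using homeomorphic_imp_surjective_map[OF h] openin_subset[OF V] tU by auto
  show "openin M (fst c)" "openin (Euclidean_space m) (snd c ` fst c)"
    using U V im by auto
  then show "snd c ` fst c \<subseteq> topspace (Euclidean_space m)"
    by (simp add: openin_subset)
  show inj: "inj_on (snd c) (fst c)"
    using homeomorphic_imp_injective_map[OF h] tU by simp
  obtain g where g: "homeomorphic_maps (subtopology M (fst c)) (subtopology (Euclidean_space m) V) (snd c) g"
    using h homeomorphic_map_maps by blast
  have "g y = inv_into (fst c) (snd c) y" if "y \<in> V" for y
  proof -
    obtain x where "x \<in> fst c" "y = snd c x"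
      using \<open>y \<in> V\<close> im by auto
    then show ?thesis
      using g inj tU by (auto simp: homeomorphic_maps_def)
  qed
  then show "homeomorphic_maps (subtopology M (fst c)) (subtopology (Euclidean_space m) (snd c ` fst c))
           (snd c) (inv_into (fst c) (snd c))"
    unfolding im using g by (elim homeomorphic_maps_eq) auto
qed

text \<open>A coordinate box \<open>B\<close> around the image of \<open>p\<close> is convex, so
  segments between its points stay in the chart. The bump is a tent in the sum of the coordinate
  distances, supported in the closed box of half the size; that box is compact, hence its preimage
  \<open>K\<close> is closed in the Hausdorff space \<open>M\<close>.\<close>

lemma chart_bump:
  assumes haus: "Hausdorff_space M" and chart: "is_chart m M c" and p: "p \<in> fst c"
  obtains B K f where
    "openin (Euclidean_space m) B" "B \<subseteq> snd c ` fst c"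
    "\<And>y z u. y \<in> B \<Longrightarrow> z \<in> B \<Longrightarrow> 0 \<le> u \<Longrightarrow> u \<le> 1 \<Longrightarrow> (\<lambda>k. (1 - u) * y k + u * z k) \<in> B"
    "closedin M K" "K \<subseteq> {x \<in> fst c. snd c x \<in> B}"
    "continuous_map M euclideanreal f" "\<And>x. 0 \<le> f x" "\<And>x. f x \<le> 1" "\<And>x. x \<notin> K \<Longrightarrow> f x = 0" "f p = 1"
proof -
  let ?R = "Euclidean_space m" and ?U = "fst c" and ?\<psi> = "snd c"
  note hm = chart_homeomorphism[OF chart]
  have inj: "inj_on ?\<psi> ?U" and UM: "openin M ?U"
    by (rule hm)+
  have pR: "?\<psi> p \<in> topspace ?R"
    using hm(5) p by auto
  obtain r where r: "r > 0" "\<And>z. z \<in> topspace ?R \<Longrightarrow> (\<And>k. k < m \<Longrightarrow> \<bar>z k - ?\<psi> p k\<bar> < r) \<Longrightarrow> z \<in> ?\<psi> ` ?U"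
    using openin_Euclidean_space_box[OF hm(2), of "?\<psi> p"] p by blast
  define B where "B = {z \<in> topspace ?R. \<forall>k<m. \<bar>z k - ?\<psi> p k\<bar> < r}"
  define Q where "Q = {z \<in> topspace ?R. \<forall>k<m. \<bar>z k - ?\<psi> p k\<bar> \<le> r / 2}"
  have QB: "Q \<subseteq> B"
    using r(1) by (force simp: Q_def B_def)
  have B_sub: "B \<subseteq> ?\<psi> ` ?U"
    using r(2) by (auto simp: B_def)
  define K where "K = inv_into ?U ?\<psi> ` Q"
  have KU: "K \<subseteq> {x \<in> ?U. ?\<psi> x \<in> Q}"
    using QB B_sub by (auto simp: K_def subset_iff f_inv_into_f inv_into_into)
  have UK: "x \<in> K" if "x \<in> ?U" "?\<psi> x \<in> Q" for x
    using that inj by (auto simp: K_def image_iff intro!: bexI[of _ "?\<psi> x"])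
  have "compactin ?R Q"
    unfolding Q_def using pR by (rule compactin_Euclidean_box)
  then have "compactin (subtopology ?R (?\<psi> ` ?U)) Q"
    using QB B_sub by (auto simp: compactin_subtopology)
  then have "compactin (subtopology M ?U) K"
    unfolding K_def using hm(1) by (intro image_compactin) (auto simp: homeomorphic_maps_def)
  then have K: "closedin M K"
    using haus compactin_imp_closedin by (auto simp: compactin_subtopology)
  define f where "f x = (if x \<in> K then max 0 (1 - (\<Sum>k<m. \<bar>?\<psi> x k - ?\<psi> p k\<bar>) / (r / 2)) else 0)" for x
  \<comment> \<open>Off \<open>K\<close> some coordinate differs by more than r / 2, so the tent is
    already zero there. The cut-off formula is thus continuous across the boundary of
    \<open>K\<close>.\<close>
  have f_U: "f x = max 0 (1 - (\<Sum>k<m. \<bar>?\<psi> x k - ?\<psi> p k\<bar>) / (r / 2))" if x: "x \<in> ?U" for x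
  proof (cases "x \<in> K")
    case False
    then have "?\<psi> x \<notin> Q"
      using UK x by blast
    then obtain k where k: "k < m" "\<bar>?\<psi> x k - ?\<psi> p k\<bar> > r / 2"
      using hm(5) x by (auto simp: Q_def not_le)
    have "\<bar>?\<psi> x k - ?\<psi> p k\<bar> \<le> (\<Sum>k<m. \<bar>?\<psi> x k - ?\<psi> p k\<bar>)"
      using k(1) by (intro member_le_sum[of k "{..<m}" "\<lambda>k. \<bar>?\<psi> x k - ?\<psi> p k\<bar>"]) auto
    then have "1 \<le> (\<Sum>k<m. \<bar>?\<psi> x k - ?\<psi> p k\<bar>) / (r / 2)"
      using k(2) r(1) by (simp add: field_simps)
    then show ?thesis
      using False by (simp add: f_def)
  qed (simp add: f_def)
  have \<psi>k: "continuous_map (subtopology M ?U) euclideanreal (\<lambda>x. ?\<psi> x k)" for k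
  proof -
    have "continuous_map (subtopology M ?U) ?R ?\<psi>"
      using hm(1) by (auto simp: homeomorphic_maps_def continuous_map_in_subtopology)
    from continuous_map_compose[OF this continuous_map_Euclidean_space_component] show ?thesis
      by (simp add: comp_def)
  qed
  have "continuous_map (subtopology M ?U) euclideanreal
      (\<lambda>x. max 0 (1 - (\<Sum>k<m. \<bar>?\<psi> x k - ?\<psi> p k\<bar>) / (r / 2)))"
    using r(1) by (intro continuous_intros \<psi>k) auto
  then have 1: "continuous_map (subtopology M ?U) euclideanreal f"
    by (rule continuous_map_eq) (simp add: f_U)
  have "continuous_map (subtopology M (topspace M - K)) euclideanreal (\<lambda>x. 0)"
    by simp
  then have 2: "continuous_map (subtopology M (topspace M - K)) euclideanreal f"
    by (rule continuous_map_eq) (simp add: f_def)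
  have "continuous_near M euclideanreal f x" if x: "x \<in> topspace M" for x
  proof (cases "x \<in> ?U")
    case True
    then show ?thesis
      using 1 UM by (intro continuous_nearI[of M ?U]) auto
  next
    case False
    then show ?thesis
      using 2 K x KU by (intro continuous_nearI[of M "topspace M - K"]) auto
  qed
  then have f: "continuous_map M euclideanreal f"
    using continuous_map_if_near[of "topspace M" M euclideanreal f] by simp
  have f1: "f p = 1"
    using f_U[OF p] by simp
  have conv: "(\<lambda>k. (1 - u) * y k + u * z k) \<in> B" if yz: "y \<in> B" "z \<in> B" and u: "0 \<le> u" "u \<le> 1" for y z u
  proof -
    have "\<bar>((1 - u) * y k + u * z k) - ?\<psi> p k\<bar> < r" if k: "k < m" for k
    proof -
      have "convex (ball (?\<psi> p k) r)"
        by (rule convex_ball)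
      moreover have "y k \<in> ball (?\<psi> p k) r" "z k \<in> ball (?\<psi> p k) r"
        using yz k by (auto simp: B_def dist_real_def abs_minus_commute)
      ultimately have "(1 - u) *\<^sub>R y k + u *\<^sub>R z k \<in> ball (?\<psi> p k) r"
        using u by (intro convexD) auto
      then show ?thesis
        by (simp add: dist_real_def abs_minus_commute)
    qed
    then show ?thesis
      using yz by (auto simp: B_def topspace_Euclidean_space)
  qed
  have B: "openin ?R B"
    unfolding B_def by (rule openin_Euclidean_box)
  have f_bounds: "0 \<le> f x" "f x \<le> 1" for x
  proof -
    have "0 \<le> (\<Sum>k<m. \<bar>?\<psi> x k - ?\<psi> p k\<bar>) / (r / 2)"
      using r(1) by (auto intro!: divide_nonneg_pos sum_nonneg)
    then show "0 \<le> f x" "f x \<le> 1"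
      by (auto simp: f_def)
  qed
  show ?thesis
    by (rule that[OF B B_sub conv K _ f f_bounds _ f1]) (use KU QB in \<open>auto simp: f_def\<close>)
qed

text \<open>
  The family \<open>max 0 (f\<^sub>i - i \<Sum>\<^sub>j\<^sub><\<^sub>i f\<^sub>j)\<close> is locally finite and has the same union of supports as
  the \<open>f\<^sub>i\<close>; dividing by its maximum makes one member equal to 1 at each point.
\<close>

lemma locally_finite_normalization:
  fixes f :: "nat \<Rightarrow> 'a \<Rightarrow> real"
  assumes cont: "\<And>i. continuous_map M euclideanreal (f i)"
    and f0: "\<And>i x. 0 \<le> f i x" and f1: "\<And>i x. f i x \<le> 1"
    and pos: "\<And>x. x \<in> topspace M \<Longrightarrow> \<exists>i. 0 < f i x"
  obtains g where "\<And>i. continuous_map M euclideanreal (g i)"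
    "\<And>i x. x \<in> topspace M \<Longrightarrow> 0 \<le> g i x" "\<And>i x. x \<in> topspace M \<Longrightarrow> g i x \<le> (1 :: real)"
    "\<And>i x. x \<in> topspace M \<Longrightarrow> f i x = 0 \<Longrightarrow> g i x = 0"
    "\<And>x. x \<in> topspace M \<Longrightarrow> \<exists>i. g i x = 1"
    "\<And>x. x \<in> topspace M \<Longrightarrow> \<exists>S n. openin M S \<and> x \<in> S \<and> (\<forall>y\<in>S. \<forall>i\<ge>n. g i y = 0)"
proof -
  define e where "e i x = max 0 (f i x - real i * (\<Sum>j<i. f j x))" for i x
  have e_cont: "continuous_map M euclideanreal (e i)" for i
    unfolding e_def by (intro continuous_intros cont) auto
  have e0: "0 \<le> e i x" for i x
    by (simp add: e_def)
  have ef: "e i x = 0" if "f i x = 0" for i x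
    using that f0 by (simp add: e_def sum_nonneg)
  have e_pos: "\<exists>i. 0 < e i x" if x: "x \<in> topspace M" for x
  proof -
    \<comment> \<open>At the first function that is positive at \<open>x\<close> nothing is
      subtracted.\<close>
    define i where "i = (LEAST i. 0 < f i x)"
    have "0 < f i x"
      unfolding i_def using pos[OF x] by (rule LeastI_ex)
    moreover have "f j x = 0" if "j < i" for j
      using not_less_Least[of j "\<lambda>i. 0 < f i x"] that f0[of j x] by (simp add: i_def)
    ultimately have "e i x = f i x"
      by (simp add: e_def)
    then show ?thesis
      using \<open>0 < f i x\<close> by (intro exI[of _ i]) simp
  qed
  have e_fin: "\<exists>S n. openin M S \<and> x \<in> S \<and> (\<forall>y\<in>S. \<forall>i\<ge>n. e i y = 0)" if x: "x \<in> topspace M" for x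
  proof -
    obtain k where k: "0 < f k x"
      using pos[OF x] by blast
    define a where "a = f k x / 2"
    have a: "0 < a" "a < f k x"
      using k by (simp_all add: a_def)
    define S where "S = {y \<in> topspace M. f k y \<in> {a<..}}"
    have "openin M S"
      unfolding S_def using cont by (rule openin_continuous_map_preimage) simp
    moreover have "x \<in> S"
      using x a by (simp add: S_def)
    moreover obtain l :: nat where l: "1 / a < real l"
      using reals_Archimedean2 by blast
    \<comment> \<open>Once \<open>i\<close> exceeds \<open>k\<close> the sum contains
      \<open>f k y\<close>, which is greater than \<open>a\<close>; once \<open>i\<close> is also at
      least 1 / a, the subtracted term is at least 1 and outweighs \<open>f i y\<close>.\<close>
    moreover have "e i y = 0" if y: "y \<in> S" and i: "i \<ge> max l (Suc k)" for i y
    proof -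
      have "a \<le> f k y"
        using y by (simp add: S_def)
      also have "\<dots> \<le> (\<Sum>j<i. f j y)"
        using i f0 by (intro member_le_sum[of k "{..<i}" "\<lambda>j. f j y"]) auto
      finally have "real i * a \<le> real i * (\<Sum>j<i. f j y)"
        by (intro mult_left_mono) auto
      moreover have "1 \<le> real l * a"
        using l a(1) by (simp add: field_simps)
      moreover have "real l * a \<le> real i * a"
        using i a(1) by (intro mult_right_mono) auto
      ultimately show ?thesis
        using f1[of i y] by (simp add: e_def)
    qed
    ultimately show ?thesis
      by blast
  qed
  define mx where "mx n x = Max ((\<lambda>i. e i x) ` {..n})" for n :: nat and x
  have mx_Suc: "mx (Suc n) x = max (e (Suc n) x) (mx n x)" for n x
    unfolding mx_def atMost_Suc image_insert by (intro Max_insert) auto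
  have mx_cont: "continuous_map M euclideanreal (mx n)" for n
  proof (induction n)
    case 0
    then show ?case
      using e_cont[of 0] by (simp add: mx_def[abs_def])
  next
    case (Suc n)
    then show ?case
      using e_cont[of "Suc n"] unfolding mx_Suc[abs_def] by (intro continuous_intros) auto
  qed
  have mx_ge: "e i x \<le> mx n x" if "i \<le> n" for i n x
    using that by (simp add: mx_def)
  have mx_ex: "\<exists>i\<le>n. mx n x = e i x" for n x
  proof -
    have "mx n x \<in> (\<lambda>i. e i x) ` {..n}"
      unfolding mx_def by (intro Max_in) auto
    then show ?thesis
      by auto
  qed
  have mx_stable: "mx k x = mx n x" if "n \<le> k" "\<forall>i\<ge>n. e i x = 0" for k n x
    using that(1)
  proof (induction k rule: dec_induct)
    case (step k)
    have "0 \<le> mx k x"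
      using e0[of 0 x] mx_ge[of 0 k x] by simp
    then show ?case
      using step that(2) by (simp add: mx_Suc)
  qed simp
  \<comment> \<open>The choice of \<open>N x\<close> need not be locally constant. By stability
    \<mu> is also the maximum over any longer initial segment, and one length works on a whole
    neighbourhood, which gives continuity.\<close>
  define N where "N x = (SOME n. \<forall>i\<ge>n. e i x = 0)" for x
  have N: "\<forall>i\<ge>N x. e i x = 0" if "x \<in> topspace M" for x
    unfolding N_def using e_fin[OF that] by (intro someI_ex[of "\<lambda>n. \<forall>i\<ge>n. e i x = 0"]) blast
  define \<mu> where "\<mu> x = mx (N x) x" for x
  have \<mu>_eq: "\<mu> x = mx n x" if "x \<in> topspace M" "\<forall>i\<ge>n. e i x = 0" for x n
    using mx_stable[of "N x" "max n (N x)" x] mx_stable[of n "max n (N x)" x] N[OF that(1)] that(2)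
    by (simp add: \<mu>_def)
  have \<mu>_ge: "e i x \<le> \<mu> x" if x: "x \<in> topspace M" for i x
    using mx_ge[of i "max i (N x)" x] \<mu>_eq[OF x, of "max i (N x)"] N[OF x] by simp
  have \<mu>_pos: "0 < \<mu> x" if x: "x \<in> topspace M" for x
    using e_pos[OF x] \<mu>_ge[OF x] by (meson less_le_trans)
  have "continuous_near M euclideanreal \<mu> x" if x: "x \<in> topspace M" for x
  proof -
    obtain S n where S: "openin M S" "x \<in> S" "\<forall>y\<in>S. \<forall>i\<ge>n. e i y = 0"
      using e_fin[OF x] by blast
    show ?thesis
    proof (rule continuous_near_eq[OF continuous_map_imp_near[OF mx_cont x] S(1,2)])
      fix y assume y: "y \<in> S"
      then have "y \<in> topspace M"
        using openin_subset[OF S(1)] by (rule subsetD[rotated])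
      moreover have "\<forall>i\<ge>n. e i y = 0"
        using S(3) y by (rule bspec)
      ultimately show "mx n y = \<mu> y"
        by (rule \<mu>_eq[symmetric])
    qed
  qed
  then have \<mu>_cont: "continuous_map M euclideanreal \<mu>"
    using continuous_map_if_near[of "topspace M" M euclideanreal \<mu>] by simp
  show ?thesis
  proof (rule that[of "\<lambda>i x. e i x / \<mu> x"])
    fix i
    show "continuous_map M euclideanreal (\<lambda>x. e i x / \<mu> x)"
      using \<mu>_pos by (intro continuous_map_real_divide e_cont \<mu>_cont) (metis less_irrefl)
    fix x assume x: "x \<in> topspace M"
    show "0 \<le> e i x / \<mu> x"
      using e0[of i x] \<mu>_pos[OF x] by simp
    show "e i x / \<mu> x \<le> 1"
      using \<mu>_ge[OF x, of i] \<mu>_pos[OF x] by (simp add: divide_le_eq_1)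
    show "e i x / \<mu> x = 0" if "f i x = 0"
      using ef[OF that] by simp
  next
    fix x assume x: "x \<in> topspace M"
    obtain i where "\<mu> x = e i x"
      using mx_ex[of "N x" x] by (auto simp: \<mu>_def)
    then show "\<exists>i. e i x / \<mu> x = 1"
      using \<mu>_pos[OF x] by (intro exI[of _ i]) simp
    obtain S n where "openin M S" "x \<in> S" "\<forall>y\<in>S. \<forall>i\<ge>n. e i y = 0"
      using e_fin[OF x] by blast
    then show "\<exists>S n. openin M S \<and> x \<in> S \<and> (\<forall>y\<in>S. \<forall>i\<ge>n. e i y / \<mu> y = 0)"
      by (intro exI[of _ S] exI[of _ n]) simp
  qed
qed

text \<open>The sets where the chart bumps are positive cover \<open>M\<close>, and by the Lindelof
  property countably many suffice. Besides local finiteness, the normalization to maximum 1 is what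
  later lets the paths arrive exactly at their target.\<close>

lemma manifold_bumps:
  assumes mfd: "smooth_manifold m M \<A>" and ne: "topspace M \<noteq> {}"
  obtains C B K lam where
    "\<And>i :: nat. C i \<in> \<A>" "\<And>i. openin (Euclidean_space m) (B i)" "\<And>i. B i \<subseteq> snd (C i) ` fst (C i)"
    "\<And>i y z u. y \<in> B i \<Longrightarrow> z \<in> B i \<Longrightarrow> 0 \<le> u \<Longrightarrow> u \<le> 1 \<Longrightarrow> (\<lambda>k. (1 - u) * y k + u * z k) \<in> B i"
    "\<And>i. closedin M (K i)" "\<And>i. K i \<subseteq> {x \<in> fst (C i). snd (C i) x \<in> B i}"
    "\<And>i. continuous_map M euclideanreal (lam i)"
    "\<And>i x. x \<in> topspace M \<Longrightarrow> 0 \<le> lam i x" "\<And>i x. x \<in> topspace M \<Longrightarrow> lam i x \<le> (1 :: real)"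
    "\<And>i x. x \<in> topspace M \<Longrightarrow> x \<notin> K i \<Longrightarrow> lam i x = 0"
    "\<And>x. x \<in> topspace M \<Longrightarrow> \<exists>i. lam i x = 1"
    "\<And>x. x \<in> topspace M \<Longrightarrow> \<exists>S n. openin M S \<and> x \<in> S \<and> (\<forall>y\<in>S. \<forall>i\<ge>n. lam i y = 0)"
proof -
  have haus: "Hausdorff_space M" and sc: "second_countable M"
    and charts: "\<And>c. c \<in> \<A> \<Longrightarrow> is_chart m M c" and cover: "(\<Union>c\<in>\<A>. fst c) = topspace M"
    using mfd by (auto simp: smooth_manifold_def)
  define good where "good p c B K f \<longleftrightarrow> c \<in> \<A> \<and> openin (Euclidean_space m) B \<and> B \<subseteq> snd c ` fst c \<and>
    (\<forall>y\<in>B. \<forall>z\<in>B. \<forall>u. 0 \<le> u \<longrightarrow> u \<le> 1 \<longrightarrow> (\<lambda>k. (1 - u) * y k + u * z k) \<in> B) \<and>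
    closedin M K \<and> K \<subseteq> {x \<in> fst c. snd c x \<in> B} \<and> continuous_map M euclideanreal f \<and>
    (\<forall>x. 0 \<le> f x \<and> f x \<le> 1 \<and> (x \<notin> K \<longrightarrow> f x = 0)) \<and> f p = (1 :: real)" for p c B K f
  have "\<exists>c B K f. good p c B K f" if p: "p \<in> topspace M" for p
  proof -
    obtain c where c: "c \<in> \<A>" "p \<in> fst c"
      using cover p by blast
    obtain B K f where
      "openin (Euclidean_space m) B" "B \<subseteq> snd c ` fst c"
      "\<And>y z u. y \<in> B \<Longrightarrow> z \<in> B \<Longrightarrow> 0 \<le> u \<Longrightarrow> u \<le> 1 \<Longrightarrow> (\<lambda>k. (1 - u) * y k + u * z k) \<in> B"
      "closedin M K" "K \<subseteq> {x \<in> fst c. snd c x \<in> B}"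
      "continuous_map M euclideanreal f" "\<And>x. 0 \<le> f x" "\<And>x. f x \<le> 1" "\<And>x. x \<notin> K \<Longrightarrow> f x = 0" "f p = 1"
      by (erule chart_bump[OF haus charts[OF c(1)] c(2)])
    then have "good p c B K f"
      using c(1) by (simp add: good_def)
    then show ?thesis
      by blast
  qed
  then obtain c B K f where good: "\<And>p. p \<in> topspace M \<Longrightarrow> good p (c p) (B p) (K p) (f p)"
    by metis
  define O' where "O' p = {x \<in> topspace M. f p x \<in> {0<..}}" for p
  have O'_open: "openin M (O' p)" if "p \<in> topspace M" for p
    unfolding O'_def using good[OF that] by (intro openin_continuous_map_preimage[of _ euclideanreal]) (auto simp: good_def)
  have "p \<in> O' p" if "p \<in> topspace M" for p
    using good[OF that] that by (auto simp: O'_def good_def)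
  then have "\<Union>(O' ` topspace M) = topspace M"
    by (auto simp: O'_def)
  moreover have "openin M U" if "U \<in> O' ` topspace M" for U
    using that O'_open by blast
  ultimately obtain \<V> where \<V>: "countable \<V>" "\<V> \<subseteq> O' ` topspace M" "\<Union>\<V> = topspace M"
    using Lindelof_spaceD[OF second_countable_imp_Lindelof_space[OF sc]] by metis
  then obtain D where D: "countable D" "D \<subseteq> topspace M" "\<V> = O' ` D"
    by (metis countable_subset_image)
  \<comment> \<open>The enumeration by all naturals, with repetitions if necessary, needs at least
    one index; this is where \<open>M\<close> must be nonempty.\<close>
  have "D \<noteq> {}"
  proof
    assume "D = {}"
    then have "topspace M = {}"
      using D(3) \<V>(3) by (metis Union_empty image_empty)
    with ne show False
      by (rule notE)
  qed
  define d where "d = from_nat_into D"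
  have dM: "d i \<in> topspace M" for i
    using from_nat_into[OF \<open>D \<noteq> {}\<close>] D(2) by (auto simp: d_def)
  have G: "good (d i) (c (d i)) (B (d i)) (K (d i)) (f (d i))" for i
    using good[OF dM] .
  have pos: "\<exists>i. 0 < f (d i) x" if "x \<in> topspace M" for x
  proof -
    obtain p where "p \<in> D" "x \<in> O' p"
      using \<V>(3) D(3) \<open>x \<in> topspace M\<close> by auto
    moreover obtain i where "p = d i"
      using \<open>p \<in> D\<close> D(1) from_nat_into_surj unfolding d_def by metis
    ultimately show ?thesis
      by (auto simp: O'_def)
  qed
  have f_cont: "continuous_map M euclideanreal (f (d i))" and f_bd: "0 \<le> f (d i) x" "f (d i) x \<le> 1"
    and f_K: "x \<notin> K (d i) \<Longrightarrow> f (d i) x = 0" for i x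
    using G[of i] by (auto simp: good_def)
  obtain g where g: "\<And>i. continuous_map M euclideanreal (g i)"
    "\<And>i x. x \<in> topspace M \<Longrightarrow> 0 \<le> g i x" "\<And>i x. x \<in> topspace M \<Longrightarrow> g i x \<le> (1 :: real)"
    "\<And>i x. x \<in> topspace M \<Longrightarrow> f (d i) x = 0 \<Longrightarrow> g i x = 0"
    "\<And>x. x \<in> topspace M \<Longrightarrow> \<exists>i. g i x = 1"
    "\<And>x. x \<in> topspace M \<Longrightarrow> \<exists>S n. openin M S \<and> x \<in> S \<and> (\<forall>y\<in>S. \<forall>i\<ge>n. g i y = 0)"
    using f_cont f_bd pos by (rule locally_finite_normalization[of M "\<lambda>i. f (d i)"]) blast+
  show ?thesis
    by (rule that[of "\<lambda>i. c (d i)" "\<lambda>i. B (d i)" "\<lambda>i. K (d i)" g])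
      (use G g f_K in \<open>auto simp: good_def\<close>)
qed

text \<open>
  The path \<open>u \<mapsto> P((x, y), u)\<close> moves \<open>y\<close> towards \<open>x\<close> in one chart after another, by the fraction
  \<open>u \<lambda>\<^sub>i(x)\<close> of the straight segment in the \<open>i\<close>-th; it reaches \<open>x\<close> at \<open>u = 1\<close> because some
  \<open>\<lambda>\<^sub>i(x)\<close> is 1. Near the diagonal all the segments stay inside the charts.
\<close>

lemma manifold_paths:
  fixes M :: "'p topology"
  assumes mfd: "smooth_manifold m M \<A>"
  obtains N P where "openin (prod_topology M M) N" "\<And>x. x \<in> topspace M \<Longrightarrow> (x, x) \<in> N"
    "continuous_map (prod_topology (subtopology (prod_topology M M) N) I01) M P"
    "\<And>x y. (x, y) \<in> N \<Longrightarrow> P ((x, y), 0) = y" "\<And>x y. (x, y) \<in> N \<Longrightarrow> P ((x, y), 1) = x"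
    "\<And>x u. x \<in> topspace M \<Longrightarrow> 0 \<le> u \<Longrightarrow> u \<le> 1 \<Longrightarrow> P ((x, x), u) = x"
proof (cases "topspace M = {}")
  case True
  then show ?thesis
    by (intro that[of "{}" "\<lambda>p. undefined"]) (auto intro: continuous_map_on_empty simp: topspace_discrete_topology)
next
  case False
  obtain C B K lam where bumps:
    "\<And>i :: nat. C i \<in> \<A>" "\<And>i. openin (Euclidean_space m) (B i)" "\<And>i. B i \<subseteq> snd (C i) ` fst (C i)"
    "\<And>i y z u. y \<in> B i \<Longrightarrow> z \<in> B i \<Longrightarrow> 0 \<le> u \<Longrightarrow> u \<le> 1 \<Longrightarrow> (\<lambda>k. (1 - u) * y k + u * z k) \<in> B i"
    "\<And>i. closedin M (K i)" "\<And>i. K i \<subseteq> {x \<in> fst (C i). snd (C i) x \<in> B i}"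
    "\<And>i. continuous_map M euclideanreal (lam i)"
    "\<And>i x. x \<in> topspace M \<Longrightarrow> 0 \<le> lam i x" "\<And>i x. x \<in> topspace M \<Longrightarrow> lam i x \<le> (1 :: real)"
    "\<And>i x. x \<in> topspace M \<Longrightarrow> x \<notin> K i \<Longrightarrow> lam i x = 0"
    "\<And>x. x \<in> topspace M \<Longrightarrow> \<exists>i. lam i x = 1"
    "\<And>x. x \<in> topspace M \<Longrightarrow> \<exists>S n. openin M S \<and> x \<in> S \<and> (\<forall>y\<in>S. \<forall>i\<ge>n. lam i y = 0)"
    by (erule manifold_bumps[OF mfd False])
  have charts: "is_chart m M (C i)" for i
    using mfd bumps(1) by (auto simp: smooth_manifold_def)
  let ?MM = "prod_topology M M"
  let ?Z = "prod_topology ?MM I01"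
  \<comment> \<open>The case of weight zero gives a meaning to the step when the points do not lie
    in the chart.\<close>
  define S where "S i p = (case p of ((x, w), u) \<Rightarrow>
    if u * lam i x = 0 then w
    else inv_into (fst (C i)) (snd (C i))
      (\<lambda>k. (1 - u * lam i x) * snd (C i) w k + (u * lam i x) * snd (C i) x k))" for i p
  have S_diag: "S i ((x, x), u) = x" if x: "x \<in> topspace M" for i x u
  proof (cases "u * lam i x = 0")
    case False
    then have "x \<in> K i"
      using bumps(10) x by auto
    then have "x \<in> fst (C i)"
      using bumps(6) by blast
    moreover have "(\<lambda>k. (1 - u * lam i x) * snd (C i) x k + (u * lam i x) * snd (C i) x k) = snd (C i) x"
      by (auto simp: algebra_simps)
    ultimately show ?thesis
      using False chart_homeomorphism(4)[OF charts] by (simp add: S_def)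
  qed (simp add: S_def)
  \<comment> \<open>Away from the closed set \<open>K i\<close> the weight vanishes on a
    neighbourhood and the step is the projection to \<open>w\<close>. On \<open>K i\<close> both
    points stay in the convex box, where the segment formula also covers weight zero.\<close>
  have S_near: "continuous_near ?Z M (S i) ((x0, x0), u0)" if x0: "x0 \<in> topspace M" and u0: "u0 \<in> {0..1}" for i x0 u0
  proof (cases "x0 \<in> K i")
    case False
    let ?U = "((topspace M - K i) \<times> topspace M) \<times> topspace I01"
    have U: "openin ?Z ?U"
      using bumps(5) by (simp add: openin_prod_Times_iff openin_diff)
    have "continuous_map ?Z M (snd \<circ> fst)"
      using continuous_map_compose[OF continuous_map_fst continuous_map_snd] .
    then have near: "continuous_near ?Z M (snd \<circ> fst) ((x0, x0), u0)"
      by (rule continuous_map_imp_near) (use x0 u0 in auto)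
    show ?thesis
    proof (rule continuous_near_eq[OF near U])
      show "((x0, x0), u0) \<in> ?U"
        using False x0 u0 by simp
      show "(snd \<circ> fst) p = S i p" if "p \<in> ?U" for p
        using that bumps(10) by (auto simp: S_def)
    qed
  next
    case True
    let ?\<psi> = "snd (C i)" and ?D = "fst (C i)" and ?R = "Euclidean_space m"
    note hm = chart_homeomorphism[OF charts[of i]]
    have \<psi>: "continuous_map (subtopology M ?D) ?R ?\<psi>"
      and inv: "continuous_map (subtopology ?R (?\<psi> ` ?D)) M (inv_into ?D ?\<psi>)"
      using hm(1) by (auto simp: homeomorphic_maps_def continuous_map_in_subtopology)
    define V where "V = {x \<in> ?D. ?\<psi> x \<in> B i}"
    have tD: "topspace (subtopology M ?D) = ?D"
      using openin_subset[OF hm(3)] by auto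
    have "openin (subtopology M ?D) V"
      using openin_continuous_map_preimage[OF \<psi> bumps(2)[of i]] unfolding V_def tD .
    then have V: "openin M V"
      using hm(3) openin_trans_full by blast
    let ?U = "(V \<times> V) \<times> topspace I01"
    have U: "openin ?Z ?U"
      using V by (simp add: openin_prod_Times_iff)
    have VM: "V \<subseteq> topspace M"
      using V by (rule openin_subset)
    let ?ZU = "subtopology ?Z ?U"
    have x_c: "continuous_map ?ZU M (\<lambda>p. fst (fst p))" and w_c: "continuous_map ?ZU M (\<lambda>p. snd (fst p))"
      and u_c: "continuous_map ?ZU euclideanreal snd"
    proof -
      show "continuous_map ?ZU M (\<lambda>p. fst (fst p))" "continuous_map ?ZU M (\<lambda>p. snd (fst p))"
        using continuous_map_compose[OF continuous_map_fst continuous_map_fst, of M M I01]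
          continuous_map_compose[OF continuous_map_fst continuous_map_snd, of M M I01]
        by (auto simp: comp_def intro!: continuous_map_from_subtopology)
      have "continuous_map ?Z I01 snd"
        by (rule continuous_map_snd)
      then show "continuous_map ?ZU euclideanreal snd"
        by (intro continuous_map_from_subtopology) (simp add: continuous_map_in_subtopology)
    qed
    have lam_c: "continuous_map ?ZU euclideanreal (\<lambda>p. lam i (fst (fst p)))"
      using continuous_map_compose[OF x_c bumps(7)] by (simp add: comp_def)
    have "continuous_map ?ZU (subtopology M ?D) (\<lambda>p. fst (fst p))"
      "continuous_map ?ZU (subtopology M ?D) (\<lambda>p. snd (fst p))"
      using x_c w_c by (auto simp: continuous_map_in_subtopology V_def)
    from this[THEN continuous_map_compose, OF \<psi>]
    have "continuous_map ?ZU ?R (\<lambda>p. ?\<psi> (fst (fst p)))" "continuous_map ?ZU ?R (\<lambda>p. ?\<psi> (snd (fst p)))"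
      by (simp_all add: comp_def)
    then have \<psi>x: "continuous_map ?ZU euclideanreal (\<lambda>p. ?\<psi> (fst (fst p)) k)"
      and \<psi>w: "continuous_map ?ZU euclideanreal (\<lambda>p. ?\<psi> (snd (fst p)) k)" for k
      by (auto simp: continuous_map_Euclidean_space_iff')
    define A where "A p = (\<lambda>k. (1 - snd p * lam i (fst (fst p))) * ?\<psi> (snd (fst p)) k
        + (snd p * lam i (fst (fst p))) * ?\<psi> (fst (fst p)) k)" for p :: "('p \<times> 'p) \<times> real"
    have A_B: "A p \<in> B i" if p: "p \<in> ?U" for p
    proof -
      have "fst (fst p) \<in> V" "snd (fst p) \<in> V" "0 \<le> snd p" "snd p \<le> 1"
        using p by auto
      moreover from this have xM: "fst (fst p) \<in> topspace M"
        using VM by blast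
      ultimately have u: "0 \<le> snd p * lam i (fst (fst p))" "snd p * lam i (fst (fst p)) \<le> 1"
        using bumps(8)[OF xM, of i] bumps(9)[OF xM, of i] by (simp_all add: mult_le_one)
      have "?\<psi> (snd (fst p)) \<in> B i" "?\<psi> (fst (fst p)) \<in> B i"
        using \<open>fst (fst p) \<in> V\<close> \<open>snd (fst p) \<in> V\<close> unfolding V_def by blast+
      from bumps(4)[OF this u] show ?thesis
        unfolding A_def .
    qed
    have "continuous_map ?ZU ?R A"
      unfolding continuous_map_Euclidean_space_iff'
    proof (intro conjI allI ballI impI)
      fix k show "continuous_map ?ZU euclideanreal (\<lambda>p. A p k)"
        unfolding A_def by (intro continuous_intros u_c lam_c \<psi>x \<psi>w)
    next
      fix p k assume "p \<in> topspace ?ZU" "m \<le> k"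
      then show "A p k = 0"
        using A_B[of p] openin_subset[OF bumps(2), of i] by (auto simp: topspace_Euclidean_space)
    qed
    then have "continuous_map ?ZU (subtopology ?R (?\<psi> ` ?D)) A"
      using A_B bumps(3)[of i] by (auto simp: continuous_map_in_subtopology)
    from continuous_map_compose[OF this inv]
    have "continuous_map ?ZU M (S i)"
    proof (rule continuous_map_eq)
      fix p assume "p \<in> topspace ?ZU"
      then obtain x w u where p: "p = ((x, w), u)" and w: "w \<in> ?D"
        by (auto simp: V_def)
      have "u * lam i x = 0 \<Longrightarrow> A p = ?\<psi> w"
        by (auto simp: A_def p)
      then show "(inv_into ?D ?\<psi> \<circ> A) p = S i p"
        using w hm(4) by (auto simp: S_def p A_def)
    qed
    then show ?thesis
      using U True x0 u0 bumps(6) by (intro continuous_nearI[of ?Z ?U]) (auto simp: V_def)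
  qed
  define Y where "Y = rec_nat (\<lambda>((x, y), u). y) (\<lambda>i f ((x, y), u). S i ((x, f ((x, y), u)), u))"
  have Y_0: "Y 0 ((x, y), u) = y" and Y_Suc: "Y (Suc i) ((x, y), u) = S i ((x, Y i ((x, y), u)), u)" for i x y u
    by (simp_all add: Y_def)
  have Y_diag: "Y i ((x, x), u) = x" if "x \<in> topspace M" for i x u
    by (induction i) (simp_all add: Y_0 Y_Suc S_diag that)
  have Y_u0: "Y i ((x, y), 0) = y" for i x y
    by (induction i) (simp_all add: Y_0 Y_Suc S_def)
  \<comment> \<open>A step of weight 1 jumps to \<open>x\<close>, whatever the current point is, and
    all later steps fix \<open>x\<close>.\<close>
  have Y_u1: "Y n ((x, y), 1) = x" if "i < n" "lam i x = 1" and x: "x \<in> topspace M" for i n x y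
    using that(1)
  proof (induction n)
    case (Suc n)
    show ?case
    proof (cases "i = n")
      case True
      have "x \<in> K i"
        using bumps(10)[OF x, of i] that(2) by auto
      then have "x \<in> fst (C i)"
        using bumps(6) by blast
      then show ?thesis
        using that(2) True chart_homeomorphism(4)[OF charts] by (simp add: Y_Suc S_def)
    next
      case False
      then show ?thesis
        using Suc S_diag[OF x] by (simp add: Y_Suc)
    qed
  qed simp
  \<comment> \<open>Over a diagonal point the moving point remains \<open>x0\<close>, so each new
    step is again needed only at a diagonal point.\<close>
  have Y_near: "continuous_near ?Z M (Y i) ((x0, x0), u0)" if x0: "x0 \<in> topspace M" and u0: "u0 \<in> {0..1}" for i x0 u0
  proof (induction i)
    case 0
    have "continuous_map ?Z M (snd \<circ> fst)"
      using continuous_map_compose[OF continuous_map_fst continuous_map_snd] .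
    then have "continuous_map ?Z M (Y 0)"
      by (rule continuous_map_eq) (auto simp: Y_0)
    then show ?case
      by (rule continuous_map_imp_near) (use x0 u0 in auto)
  next
    case (Suc i)
    have pt: "((x0, x0), u0) \<in> topspace ?Z"
      using x0 u0 by simp
    have "continuous_map ?Z M (\<lambda>p. fst (fst p))" "continuous_map ?Z I01 snd"
      using continuous_map_compose[OF continuous_map_fst continuous_map_fst, of M M I01] continuous_map_snd
      by (auto simp: comp_def)
    from this[THEN continuous_map_imp_near, OF pt]
    have "continuous_near ?Z M (\<lambda>p. fst (fst p)) ((x0, x0), u0)" "continuous_near ?Z I01 snd ((x0, x0), u0)" .
    then have "continuous_near ?Z ?Z (\<lambda>p. ((fst (fst p), Y i p), snd p)) ((x0, x0), u0)"
      using Suc.IH by (intro continuous_near_pair)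
    moreover have "continuous_near ?Z M (S i) ((fst (fst ((x0, x0), u0)), Y i ((x0, x0), u0)), snd ((x0, x0), u0))"
      using S_near[OF x0 u0] Y_diag[OF x0] by simp
    ultimately have "continuous_near ?Z M (\<lambda>p. S i ((fst (fst p), Y i p), snd p)) ((x0, x0), u0)"
      by (rule continuous_near_compose)
    moreover have "(\<lambda>p. S i ((fst (fst p), Y i p), snd p)) = Y (Suc i)"
      by (auto simp: Y_Suc)
    ultimately show ?case
      by simp
  qed
  have Y_stable: "Y k ((x, y), u) = Y n ((x, y), u)" if "n \<le> k" "\<forall>i\<ge>n. lam i x = 0" for k n x y u
    using that(1) by (induction k rule: dec_induct) (use that(2) in \<open>simp_all add: Y_Suc S_def\<close>)
  define n where "n x = (SOME n. \<forall>i\<ge>n. lam i x = 0)" for x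
  have n: "\<forall>i\<ge>n x. lam i x = 0" if "x \<in> topspace M" for x
    unfolding n_def using bumps(12)[OF that] by (intro someI_ex[of "\<lambda>n. \<forall>i\<ge>n. lam i x = 0"]) blast
  \<comment> \<open>This is the infinite composite of the steps: beyond \<open>n x\<close> they are
    the identity, and near a given point one finite number of steps serves for all
    \<open>x\<close>.\<close>
  define P where "P = (\<lambda>((x, y), u). Y (n x) ((x, y), u))"
  have P_eq: "P ((x, y), u) = Y k ((x, y), u)" if "x \<in> topspace M" "\<forall>i\<ge>k. lam i x = 0" for x y u k
    using Y_stable[of k "max k (n x)" x y u] Y_stable[of "n x" "max k (n x)" x y u] n[OF that(1)] that(2)
    by (simp add: P_def)
  have P_near: "continuous_near ?Z M P ((x0, x0), u0)" if x0: "x0 \<in> topspace M" and u0: "u0 \<in> {0..1}" for x0 u0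
  proof -
    obtain T k where T: "openin M T" "x0 \<in> T" "\<forall>y\<in>T. \<forall>i\<ge>k. lam i y = 0"
      using bumps(12)[OF x0] by blast
    have TM: "T \<subseteq> topspace M"
      using T(1) by (rule openin_subset)
    show ?thesis
    proof (rule continuous_near_eq[OF Y_near[OF x0 u0]])
      show "openin ?Z ((T \<times> topspace M) \<times> topspace I01)"
        using T(1) by (simp add: openin_prod_Times_iff)
      show "((x0, x0), u0) \<in> (T \<times> topspace M) \<times> topspace I01"
        using T(2) x0 u0 by simp
      fix p assume "p \<in> (T \<times> topspace M) \<times> topspace I01"
      then obtain x y u where p: "p = ((x, y), u)" "x \<in> T"
        by auto
      then show "Y k p = P p"
        using P_eq[of x k y u] T(3) TM by auto
    qed
  qed
  \<comment> \<open>Continuity is required for all times at once; compactness of [0, 1] and the tube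
    lemma keep this condition open.\<close>
  define N where "N = {q \<in> topspace ?MM. \<forall>u\<in>{0..1}. (q, u) \<in> {p. continuous_near ?Z M P p}}"
  have N: "openin ?MM N"
    unfolding N_def by (rule openin_slice_compactin[OF openin_continuous_near]) (simp add: compactin_subtopology)
  have NM: "x \<in> topspace M" if "(x, y) \<in> N" for x y
    using that by (auto simp: N_def)
  have "continuous_map (subtopology ?Z (N \<times> {0..1})) M P"
    by (rule continuous_map_if_near) (auto simp: N_def)
  moreover have "subtopology ?Z (N \<times> {0..1}) = prod_topology (subtopology ?MM N) I01"
    by (simp add: subtopology_Times subtopology_subtopology)
  ultimately have P: "continuous_map (prod_topology (subtopology ?MM N) I01) M P"
    by simp
  show ?thesis
  proof (rule that[OF N _ P])
    show "(x, x) \<in> N" if "x \<in> topspace M" for x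
      using P_near[OF that] that by (auto simp: N_def)
    show "P ((x, y), 0) = y" for x y
      by (simp add: P_def Y_u0)
    show "P ((x, y), 1) = x" if "(x, y) \<in> N" for x y
    proof -
      have x: "x \<in> topspace M"
        using that by (rule NM)
      obtain i where i: "lam i x = 1"
        using bumps(11)[OF x] by blast
      \<comment> \<open>Running at least \<open>Suc i\<close> steps ensures that the step of weight
        1 has been taken.\<close>
      have "P ((x, y), 1) = Y (max (n x) (Suc i)) ((x, y), 1)"
        using n[OF x] by (intro P_eq[OF x]) auto
      then show ?thesis
        using Y_u1[of i "max (n x) (Suc i)" x y] i x by simp
    qed
    show "P ((x, x), u) = x" if "x \<in> topspace M" for x u
      using Y_diag[OF that] by (simp add: P_def)
  qed
qed

section \<open>Derivatives of transition maps\<close>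

text \<open>The mean value inequality for g(s) - c s, whose derivative is bounded by
  \<open>e\<close>.\<close>

lemma segment_increment:
  fixes g :: "real \<Rightarrow> real"
  assumes "\<And>s. s \<in> closed_segment a b \<Longrightarrow> (g has_real_derivative g' s) (at s)"
    and "\<And>s. s \<in> closed_segment a b \<Longrightarrow> \<bar>g' s - c\<bar> \<le> e"
  shows "\<bar>g b - g a - c * (b - a)\<bar> \<le> e * \<bar>b - a\<bar>"
proof -
  have "norm ((g b - c * b) - (g a - c * a)) \<le> e * norm (b - a)"
  proof (rule field_differentiable_bound[where S = "closed_segment a b" and f' = "\<lambda>s. g' s - c"])
    fix s assume s: "s \<in> closed_segment a b"
    show "((\<lambda>s. g s - c * s) has_field_derivative g' s - c) (at s within closed_segment a b)"
      by (rule has_field_derivative_at_within) (auto intro!: derivative_eq_intros assms(1)[OF s])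
    show "norm (g' s - c) \<le> e"
      using assms(2)[OF s] by simp
  qed auto
  then show ?thesis
    by (simp add: algebra_simps)
qed

lemma finite_neighbourhood:
  assumes "finite I" "x \<in> topspace X"
    and "\<And>i. i \<in> I \<Longrightarrow> \<exists>S. openin X S \<and> x \<in> S \<and> Q i S"
    and anti: "\<And>i S T. Q i S \<Longrightarrow> T \<subseteq> S \<Longrightarrow> Q i T"
  obtains S where "openin X S" "x \<in> S" "\<And>i. i \<in> I \<Longrightarrow> Q i S"
proof -
  obtain S where S: "\<And>i. i \<in> I \<Longrightarrow> openin X (S i) \<and> x \<in> S i \<and> Q i (S i)"
    using assms(3) by metis
  have "openin X (topspace X \<inter> (\<Inter>i\<in>I. S i))"
    using S assms(1) by (cases "I = {}") (auto intro!: openin_Int openin_INT)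
  moreover have "x \<in> topspace X \<inter> (\<Inter>i\<in>I. S i)"
    using S assms(2) by auto
  moreover have "Q i (topspace X \<inter> (\<Inter>i\<in>I. S i))" if i: "i \<in> I" for i
  proof (rule anti[of i "S i"])
    show "Q i (S i)"
      using S[OF i] by simp
  qed (use i in auto)
  ultimately show ?thesis
    by (rule that)
qed

text \<open>The increment from \<open>y\<close> to \<open>z\<close> is split into changes of one
  coordinate at a time. Each partial derivative stays within e / 2 of its value at \<open>a\<close>,
  so any two of its values differ by at most \<open>e\<close>. The point \<open>x\<close> that
  supplies the linear part is independent of \<open>y\<close> and \<open>z\<close>, since later
  estimates need it both fixed and moving.\<close>

lemma strict_differentiability:
  assumes S: "openin (Euclidean_space m) S" and f: "ck_on m (Suc 0) S f" and a: "a \<in> S" and e: "0 < e"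
  obtains r where "0 < r"
    "\<And>x y z. x \<in> topspace (Euclidean_space m) \<Longrightarrow> y \<in> topspace (Euclidean_space m) \<Longrightarrow>
      z \<in> topspace (Euclidean_space m) \<Longrightarrow> (\<And>k. k < m \<Longrightarrow> \<bar>x k - a k\<bar> < r) \<Longrightarrow>
      (\<And>k. k < m \<Longrightarrow> \<bar>y k - a k\<bar> < r) \<Longrightarrow> (\<And>k. k < m \<Longrightarrow> \<bar>z k - a k\<bar> < r) \<Longrightarrow>
      \<bar>f z - f y - (\<Sum>j<m. partial_deriv j f x * (z j - y j))\<bar> \<le> e * (\<Sum>j<m. \<bar>z j - y j\<bar>)"
proof -
  let ?R = "Euclidean_space m"
  have SR: "topspace (subtopology ?R S) = S"
    using openin_subset[OF S] by auto
  have diff: "(\<lambda>s. f (x(j := s))) differentiable (at (x j))" if "j < m" "x \<in> S" for j x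
    using f that by simp
  have cont: "continuous_map (subtopology ?R S) euclideanreal (partial_deriv j f)" if "j < m" for j
    using f that by simp
  obtain V where V: "openin ?R V" "a \<in> V"
    "\<And>j. j \<in> {..<m} \<Longrightarrow> V \<subseteq> {x \<in> S. \<bar>partial_deriv j f x - partial_deriv j f a\<bar> < e / 2}"
  proof (rule finite_neighbourhood[of "{..<m}" a ?R "\<lambda>j V. V \<subseteq> {x \<in> S. \<bar>partial_deriv j f x - partial_deriv j f a\<bar> < e / 2}"])
    show "a \<in> topspace ?R"
      using a openin_subset[OF S] by blast
    fix j assume j: "j \<in> {..<m}"
    let ?V = "{x \<in> topspace (subtopology ?R S). partial_deriv j f x \<in> ball (partial_deriv j f a) (e / 2)}"
    have "openin (subtopology ?R S) ?V"
      using j by (intro openin_continuous_map_preimage[OF cont]) auto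
    then have "openin ?R ?V"
      using S openin_trans_full by blast
    moreover have "?V \<subseteq> {x \<in> S. \<bar>partial_deriv j f x - partial_deriv j f a\<bar> < e / 2}"
      unfolding SR by (auto simp: dist_real_def abs_minus_commute)
    moreover have "a \<in> ?V"
      unfolding SR using a e by simp
    ultimately show "\<exists>V. openin ?R V \<and> a \<in> V \<and> V \<subseteq> {x \<in> S. \<bar>partial_deriv j f x - partial_deriv j f a\<bar> < e / 2}"
      by blast
  qed auto
  have VS: "openin ?R (S \<inter> V)" "a \<in> S \<inter> V"
    using S V(1,2) a by auto
  obtain r where r: "r > 0" "\<And>z. z \<in> topspace ?R \<Longrightarrow> (\<And>k. k < m \<Longrightarrow> \<bar>z k - a k\<bar> < r) \<Longrightarrow> z \<in> S \<inter> V"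
    using openin_Euclidean_space_box[OF VS] by blast
  show ?thesis
  proof (rule that[OF r(1)])
    fix x y z
    assume R: "x \<in> topspace ?R" "y \<in> topspace ?R" "z \<in> topspace ?R"
      and x: "\<And>k. k < m \<Longrightarrow> \<bar>x k - a k\<bar> < r" and y: "\<And>k. k < m \<Longrightarrow> \<bar>y k - a k\<bar> < r"
      and z: "\<And>k. k < m \<Longrightarrow> \<bar>z k - a k\<bar> < r"
    \<comment> \<open>The intermediate point after \<open>k\<close> coordinates of \<open>y\<close>
      have been replaced by those of \<open>z\<close>; boxes contain all these points.\<close>
    define w where "w k = (\<lambda>j. if j < k then z j else y j)" for k :: nat
    have step: "\<bar>f (w (Suc k)) - f (w k) - partial_deriv k f x * (z k - y k)\<bar> \<le> e * \<bar>z k - y k\<bar>"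
      if k: "k < m" for k
    proof -
      have seg: "(w k)(k := s) \<in> S \<inter> V" if s: "s \<in> closed_segment (y k) (z k)" for s
      proof (rule r(2))
        show "(w k)(k := s) \<in> topspace ?R"
          using R k by (auto simp: topspace_Euclidean_space w_def)
        have "closed_segment (y k) (z k) \<subseteq> ball (a k) r"
          using y[OF k] z[OF k] by (intro closed_segment_subset) (auto simp: dist_real_def abs_minus_commute)
        then have "\<bar>s - a k\<bar> < r"
          using s by (auto simp: dist_real_def abs_minus_commute subset_iff)
        then show "\<bar>((w k)(k := s)) j - a j\<bar> < r" if "j < m" for j
          using y z that by (simp add: w_def)
      qed
      have "\<bar>f ((w k)(k := z k)) - f ((w k)(k := y k)) - partial_deriv k f x * (z k - y k)\<bar> \<le> e * \<bar>z k - y k\<bar>"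
      proof (rule segment_increment[where g = "\<lambda>s. f ((w k)(k := s))"])
        fix s assume s: "s \<in> closed_segment (y k) (z k)"
        have "(\<lambda>s. f ((w k)(k := s))) differentiable (at s)"
          using diff[OF k, of "(w k)(k := s)"] seg[OF s] by simp
        then show "((\<lambda>s. f ((w k)(k := s))) has_real_derivative deriv (\<lambda>s. f ((w k)(k := s))) s) (at s)"
          by (simp add: DERIV_deriv_iff_real_differentiable)
        have "deriv (\<lambda>s. f ((w k)(k := s))) s = partial_deriv k f ((w k)(k := s))"
          by (simp add: partial_deriv_def)
        moreover have "\<bar>partial_deriv k f ((w k)(k := s)) - partial_deriv k f a\<bar> < e / 2"
          using V(3)[of k] k seg[OF s] by blast
        moreover have "\<bar>partial_deriv k f x - partial_deriv k f a\<bar> < e / 2"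
          using V(3)[of k] k r(2)[OF R(1) x] by blast
        ultimately show "\<bar>deriv (\<lambda>s. f ((w k)(k := s))) s - partial_deriv k f x\<bar> \<le> e"
          by linarith
      qed
      moreover have "(w k)(k := z k) = w (Suc k)" "(w k)(k := y k) = w k"
        by (auto simp: w_def)
      ultimately show ?thesis
        by simp
    qed
    have ends: "w 0 = y" "w m = z"
      using R by (auto simp: w_def topspace_Euclidean_space)
    have "f z - f y = (\<Sum>k<m. f (w (Suc k)) - f (w k))"
      using sum_lessThan_telescope[of "\<lambda>k. f (w k)" m] unfolding ends by (rule sym)
    then have "\<bar>f z - f y - (\<Sum>j<m. partial_deriv j f x * (z j - y j))\<bar>
        = \<bar>\<Sum>k<m. f (w (Suc k)) - f (w k) - partial_deriv k f x * (z k - y k)\<bar>"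
      by (simp add: sum_subtractf)
    also have "\<dots> \<le> (\<Sum>k<m. e * \<bar>z k - y k\<bar>)"
      by (rule order_trans[OF sum_abs sum_mono]) (use step in auto)
    finally show "\<bar>f z - f y - (\<Sum>j<m. partial_deriv j f x * (z j - y j))\<bar> \<le> e * (\<Sum>j<m. \<bar>z j - y j\<bar>)"
      by (simp add: sum_distrib_left)
  qed
qed

section \<open>Coordinate changes of tangent vectors: bounds, increments and the chain rule\<close>

definition l1norm :: "nat \<Rightarrow> (nat \<Rightarrow> real) \<Rightarrow> real" where
  "l1norm m v = (\<Sum>j<m. \<bar>v j\<bar>)"

lemma l1norm_nonneg: "0 \<le> l1norm m v"
  by (simp add: l1norm_def sum_nonneg)

lemma l1norm_le:
  assumes "\<And>k. k < m \<Longrightarrow> \<bar>v k\<bar> \<le> b"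
  shows "l1norm m v \<le> real m * b"
  using sum_mono[of "{..<m}" "\<lambda>k. \<bar>v k\<bar>" "\<lambda>k. b"] assms by (simp add: l1norm_def)

text \<open>A crude operator norm of the Jacobian; only its finiteness at a given point
  matters.\<close>

definition transition_bound :: "nat \<Rightarrow> 'p chart \<Rightarrow> 'p chart \<Rightarrow> 'p \<Rightarrow> real" where
  "transition_bound m c d x = (\<Sum>i<m. \<Sum>j<m. \<bar>partial_deriv j (\<lambda>y. transition c d y i) (snd c x)\<bar>)"

lemma transition_bound_nonneg: "0 \<le> transition_bound m c d x"
  by (simp add: transition_bound_def sum_nonneg)

lemma transition_deriv_bound: "\<bar>transition_deriv m c d x v k\<bar> \<le> transition_bound m c d x * l1norm m v"
proof (cases "k < m")
  case True
  have le: "\<bar>partial_deriv j (\<lambda>y. transition c d y k) (snd c x)\<bar> \<le> transition_bound m c d x" if "j < m" for j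
  proof -
    have "\<bar>partial_deriv j (\<lambda>y. transition c d y k) (snd c x)\<bar>
        \<le> (\<Sum>j<m. \<bar>partial_deriv j (\<lambda>y. transition c d y k) (snd c x)\<bar>)"
      using that by (intro member_le_sum) auto
    also have "\<dots> \<le> transition_bound m c d x"
      unfolding transition_bound_def using True
      by (intro member_le_sum[of k "{..<m}" "\<lambda>i. \<Sum>j<m. \<bar>partial_deriv j (\<lambda>y. transition c d y i) (snd c x)\<bar>"])
        (auto simp: sum_nonneg)
    finally show ?thesis .
  qed
  have "\<bar>transition_deriv m c d x v k\<bar> \<le> (\<Sum>j<m. transition_bound m c d x * \<bar>v j\<bar>)"
    using True le by (auto simp: transition_deriv_def abs_mult
        intro!: order_trans[OF sum_abs sum_mono] mult_right_mono)
  then show ?thesis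
    by (simp add: l1norm_def sum_distrib_left)
next
  case False
  then show ?thesis
    by (simp add: transition_deriv_def l1norm_nonneg transition_bound_nonneg)
qed

lemma transition_deriv_cong:
  "(\<And>j. j < m \<Longrightarrow> v j = w j) \<Longrightarrow> transition_deriv m c d x v = transition_deriv m c d x w"
  by (auto simp: transition_deriv_def fun_eq_iff intro!: sum.cong)

lemma transition_deriv_sum:
  "transition_deriv m c d x (\<lambda>k. \<Sum>i\<in>I. l i * v i k) k = (\<Sum>i\<in>I. l i * transition_deriv m c d x (v i) k)"
proof (cases "k < m")
  case True
  have "(\<Sum>j<m. a j * (\<Sum>i\<in>I. l i * v i j)) = (\<Sum>i\<in>I. l i * (\<Sum>j<m. a j * v i j))" for a :: "nat \<Rightarrow> real"
    unfolding sum_distrib_left by (subst sum.swap) (simp add: mult.left_commute)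
  then show ?thesis
    using True by (simp add: transition_deriv_def)
qed (simp add: transition_deriv_def)

lemma transition_deriv_diff:
  "transition_deriv m c d x (\<lambda>k. v k - w k) k = transition_deriv m c d x v k - transition_deriv m c d x w k"
  by (simp add: transition_deriv_def right_diff_distrib sum_subtractf)

lemma transition_deriv_scale:
  "transition_deriv m c d x (\<lambda>k. t * v k) k = t * transition_deriv m c d x v k"
  by (simp add: transition_deriv_def sum_distrib_left mult.left_commute)

context
  fixes m :: nat and M :: "'p topology" and \<A> :: "'p chart set"
  assumes mfd: "smooth_manifold m M \<A>"
begin

lemma smooth_manifold_is_chart: "c \<in> \<A> \<Longrightarrow> is_chart m M c"
  using mfd by (auto simp: smooth_manifold_def)

lemma smooth_manifold_chart_cover: "x \<in> topspace M \<Longrightarrow> \<exists>c\<in>\<A>. x \<in> fst c"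
  using mfd by (auto simp: smooth_manifold_def)

lemma openin_chart_image:
  assumes c: "c \<in> \<A>" and S: "openin M S" "S \<subseteq> fst c"
  shows "openin (Euclidean_space m) (snd c ` S)"
proof -
  note hm = chart_homeomorphism[OF smooth_manifold_is_chart[OF c]]
  have "homeomorphic_map (subtopology M (fst c)) (subtopology (Euclidean_space m) (snd c ` fst c)) (snd c)"
    using hm(1) homeomorphic_map_maps by blast
  moreover have "openin (subtopology M (fst c)) S"
    using S by (metis inf.absorb1 openin_subtopology_Int)
  ultimately have "openin (subtopology (Euclidean_space m) (snd c ` fst c)) (snd c ` S)"
    using homeomorphic_imp_open_map open_map_def by blast
  then show ?thesis
    using hm(2) openin_trans_full by blast
qed

lemma transition_chart:
  assumes c: "c \<in> \<A>" and x: "x \<in> fst c"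
  shows "transition c d (snd c x) = snd d x"
  using chart_homeomorphism(4)[OF smooth_manifold_is_chart[OF c]] x by (simp add: transition_def)

lemma continuous_map_chart:
  assumes c: "c \<in> \<A>"
  shows "continuous_map (subtopology M (fst c)) (Euclidean_space m) (snd c)"
  using chart_homeomorphism(1)[OF smooth_manifold_is_chart[OF c]]
  by (auto simp: homeomorphic_maps_def continuous_map_in_subtopology)

lemma openin_chart_box:
  assumes c: "c \<in> \<A>"
  shows "openin M {x \<in> fst c. \<forall>k<m. \<bar>snd c x k - y k\<bar> < r}"
proof -
  note hm = chart_homeomorphism[OF smooth_manifold_is_chart[OF c]]
  have t: "topspace (subtopology M (fst c)) = fst c"
    using openin_subset[OF hm(3)] by auto
  have "openin (subtopology M (fst c)) {x \<in> fst c. snd c x \<in> {z \<in> topspace (Euclidean_space m). \<forall>k<m. \<bar>z k - y k\<bar> < r}}"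
    using openin_continuous_map_preimage[OF continuous_map_chart[OF c] openin_Euclidean_box] unfolding t .
  moreover have "{x \<in> fst c. snd c x \<in> {z \<in> topspace (Euclidean_space m). \<forall>k<m. \<bar>z k - y k\<bar> < r}}
      = {x \<in> fst c. \<forall>k<m. \<bar>snd c x k - y k\<bar> < r}"
    using hm(5) by auto
  ultimately have "openin (subtopology M (fst c)) {x \<in> fst c. \<forall>k<m. \<bar>snd c x k - y k\<bar> < r}"
    by (simp only:)
  from openin_trans_full[OF this hm(3)] show ?thesis .
qed

lemma transition_ck:
  assumes "c \<in> \<A>" "d \<in> \<A>" "i < m"
  shows "ck_on m (Suc 0) (snd c ` (fst c \<inter> fst d)) (\<lambda>y. transition c d y i)"
  using mfd assms unfolding smooth_manifold_def smooth_on_def by blast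

text \<open>Strict differentiability of the m components of the transition map, pulled back to the
  manifold and made simultaneous by a finite intersection of neighbourhoods.\<close>

lemma transition_increment:
  assumes c: "c \<in> \<A>" and d: "d \<in> \<A>" and x0: "x0 \<in> fst c \<inter> fst d" and e: "0 < e"
  obtains S where "openin M S" "x0 \<in> S" "S \<subseteq> fst c \<inter> fst d"
    "\<And>i x y z. i < m \<Longrightarrow> x \<in> S \<Longrightarrow> y \<in> S \<Longrightarrow> z \<in> S \<Longrightarrow>
      \<bar>snd d z i - snd d y i - transition_deriv m c d x (\<lambda>k. snd c z k - snd c y k) i\<bar>
        \<le> e * l1norm m (\<lambda>k. snd c z k - snd c y k)"
proof -
  define Q where "Q i S \<longleftrightarrow> (\<forall>x\<in>S. \<forall>y\<in>S. \<forall>z\<in>S.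
      \<bar>snd d z i - snd d y i - transition_deriv m c d x (\<lambda>k. snd c z k - snd c y k) i\<bar>
        \<le> e * l1norm m (\<lambda>k. snd c z k - snd c y k))" for i S
  note hc = chart_homeomorphism[OF smooth_manifold_is_chart[OF c]] and hd = chart_homeomorphism[OF smooth_manifold_is_chart[OF d]]
  have UM: "openin M (fst c \<inter> fst d)"
    using hc(3) hd(3) by blast
  have x0M: "x0 \<in> topspace M"
    using x0 openin_subset[OF UM] by blast
  have ex: "\<exists>S. openin M S \<and> x0 \<in> S \<and> Q i S" if i: "i \<in> {..<m}" for i
  proof -
    have V: "openin (Euclidean_space m) (snd c ` (fst c \<inter> fst d))"
      by (rule openin_chart_image[OF c UM]) auto
    have a: "snd c x0 \<in> snd c ` (fst c \<inter> fst d)"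
      using x0 by blast
    have i': "i < m"
      using i by simp
    obtain r where r: "0 < r"
      "\<And>x y z. x \<in> topspace (Euclidean_space m) \<Longrightarrow> y \<in> topspace (Euclidean_space m) \<Longrightarrow>
      z \<in> topspace (Euclidean_space m) \<Longrightarrow> (\<And>k. k < m \<Longrightarrow> \<bar>x k - snd c x0 k\<bar> < r) \<Longrightarrow>
      (\<And>k. k < m \<Longrightarrow> \<bar>y k - snd c x0 k\<bar> < r) \<Longrightarrow> (\<And>k. k < m \<Longrightarrow> \<bar>z k - snd c x0 k\<bar> < r) \<Longrightarrow>
      \<bar>transition c d z i - transition c d y i - (\<Sum>j<m. partial_deriv j (\<lambda>y. transition c d y i) x * (z j - y j))\<bar>
        \<le> e * (\<Sum>j<m. \<bar>z j - y j\<bar>)"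
      by (erule strict_differentiability[OF V transition_ck[OF c d i'] a e])
    define S where "S = {x \<in> fst c. \<forall>k<m. \<bar>snd c x k - snd c x0 k\<bar> < r} \<inter> (fst c \<inter> fst d)"
    have "openin M S"
      unfolding S_def using openin_chart_box[OF c] UM by (rule openin_Int)
    moreover have "x0 \<in> S"
      using x0 r(1) by (simp add: S_def)
    moreover have "\<bar>snd d z i - snd d y i - transition_deriv m c d x (\<lambda>k. snd c z k - snd c y k) i\<bar>
        \<le> e * l1norm m (\<lambda>k. snd c z k - snd c y k)" if "x \<in> S" "y \<in> S" "z \<in> S" for x y z
    proof -
      have S: "snd c p \<in> topspace (Euclidean_space m)" "\<And>k. k < m \<Longrightarrow> \<bar>snd c p k - snd c x0 k\<bar> < r"
        "transition c d (snd c p) = snd d p" if "p \<in> S" for p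
        using that hc(5) transition_chart[OF c] by (auto simp: S_def)
      show ?thesis
        using r(2)[OF S(1)[OF that(1)] S(1)[OF that(2)] S(1)[OF that(3)] S(2)[OF that(1)] S(2)[OF that(2)] S(2)[OF that(3)]]
          i' by (simp add: S(3)[OF that(2)] S(3)[OF that(3)] transition_deriv_def l1norm_def)
    qed
    ultimately show ?thesis
      unfolding Q_def by blast
  qed
  have anti: "Q i T" if "Q i S" "T \<subseteq> S" for i S T
    using that unfolding Q_def by blast
  obtain S where S: "openin M S" "x0 \<in> S" "\<And>i. i \<in> {..<m} \<Longrightarrow> Q i S"
  proof (rule finite_neighbourhood[of "{..<m}" x0 M Q])
    show "Q i T" if "Q i S" "T \<subseteq> S" for i S T
      using that by (rule anti)
  qed (use x0M ex in auto)
  show ?thesis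
  proof (rule that[of "S \<inter> (fst c \<inter> fst d)"])
    show "openin M (S \<inter> (fst c \<inter> fst d))"
      using S(1) UM by (rule openin_Int)
    show "x0 \<in> S \<inter> (fst c \<inter> fst d)"
      using S(2) x0 by (rule IntI)
    fix i x y z assume i: "i < m" and xyz: "x \<in> S \<inter> (fst c \<inter> fst d)" "y \<in> S \<inter> (fst c \<inter> fst d)" "z \<in> S \<inter> (fst c \<inter> fst d)"
    from i have "Q i S"
      using S(3) by simp
    then show "\<bar>snd d z i - snd d y i - transition_deriv m c d x (\<lambda>k. snd c z k - snd c y k) i\<bar>
        \<le> e * l1norm m (\<lambda>k. snd c z k - snd c y k)"
      using xyz unfolding Q_def by blast
  qed auto
qed

text \<open>Turns a statement about increments between points into one about an arbitrary coordinate
  vector: every direction is realized, up to a positive factor, inside any neighbourhood.\<close>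

lemma small_displacement:
  assumes c: "c \<in> \<A>" and S: "openin M S" "x0 \<in> S" "S \<subseteq> fst c"
  obtains z t where "z \<in> S" "0 < t" "\<And>k. k < m \<Longrightarrow> snd c z k - snd c x0 k = t * v k"
proof -
  note hc = chart_homeomorphism[OF smooth_manifold_is_chart[OF c]]
  have "snd c x0 \<in> snd c ` S"
    using S(2) by blast
  then obtain r where r: "r > 0"
    "\<And>z. z \<in> topspace (Euclidean_space m) \<Longrightarrow> (\<And>k. k < m \<Longrightarrow> \<bar>z k - snd c x0 k\<bar> < r) \<Longrightarrow> z \<in> snd c ` S"
    using openin_Euclidean_space_box[OF openin_chart_image[OF c S(1,3)]] by blast
  \<comment> \<open>The summand 1 avoids a zero denominator and makes the displacement strictly
    smaller than \<open>r\<close>.\<close>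
  define t where "t = r / (1 + l1norm m v)"
  have t: "0 < t"
    using r(1) l1norm_nonneg[of m v] by (simp add: t_def)
  have x0R: "snd c x0 \<in> topspace (Euclidean_space m)"
    using hc(5) S by blast
  define p where "p = (\<lambda>k. snd c x0 k + (if k < m then t * v k else 0))"
  have "p \<in> snd c ` S"
  proof (rule r(2))
    show "p \<in> topspace (Euclidean_space m)"
      using x0R by (simp add: p_def topspace_Euclidean_space)
    fix k assume k: "k < m"
    have "\<bar>v k\<bar> \<le> l1norm m v"
      unfolding l1norm_def using k by (intro member_le_sum[of k "{..<m}" "\<lambda>k. \<bar>v k\<bar>"]) auto
    then have "t * \<bar>v k\<bar> < t * (1 + l1norm m v)"
      using t by (intro mult_strict_left_mono) auto
    also have "\<dots> = r"
      using l1norm_nonneg[of m v] by (simp add: t_def)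
    finally show "\<bar>p k - snd c x0 k\<bar> < r"
      using k t by (simp add: p_def abs_mult)
  qed
  then obtain z where "z \<in> S" "snd c z = p"
    by blast
  then show ?thesis
    using t by (intro that[of z t]) (auto simp: p_def)
qed

text \<open>
  Both sides are the linear part of the same increment \<open>e(z) - e(x)\<close>, up to an error that is
  small compared with \<open>c(z) - c(x)\<close>.
\<close>

lemma transition_deriv_comp:
  assumes c: "c \<in> \<A>" and d: "d \<in> \<A>" and e: "e \<in> \<A>" and x: "x \<in> fst c" "x \<in> fst d" "x \<in> fst e"
  shows "transition_deriv m d e x (transition_deriv m c d x v) = transition_deriv m c e x v"
proof
  fix i
  show "transition_deriv m d e x (transition_deriv m c d x v) i = transition_deriv m c e x v i"
  proof (cases "i < m")
    case False
    then show ?thesis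
      by (simp add: transition_deriv_def)
  next
    case i: True
    define a where "a = transition_bound m c d x"
    define b where "b = transition_bound m d e x"
    have ab: "0 \<le> a" "0 \<le> b"
      by (simp_all add: a_def b_def transition_bound_nonneg)
    \<comment> \<open>The three summands bound, relative to \<epsilon> and the displacement in
      \<open>c\<close>, the errors of three replacements: \<delta>d by its linear part (carried on
      to \<open>e\<close>), the increment from \<open>d\<close> to \<open>e\<close> by its linear
      part (using the length of \<delta>d), and the increment from \<open>c\<close> to
      \<open>e\<close> by its linear part.\<close>
    define K where "K = b * real m + (real m * a + real m) + 1"
    have K: "0 < K"
      using ab by (simp add: K_def add_nonneg_pos)
    let ?L = "transition_deriv m d e x (transition_deriv m c d x v) i"
    let ?R = "transition_deriv m c e x v i"
    have main: "\<bar>?L - ?R\<bar> \<le> \<epsilon> * (K * l1norm m v)" if \<epsilon>: "0 < \<epsilon>" "\<epsilon> \<le> 1" for \<epsilon>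
    proof -
      obtain S1 where S1: "openin M S1" "x \<in> S1" "S1 \<subseteq> fst c \<inter> fst d"
        "\<And>i p y z. i < m \<Longrightarrow> p \<in> S1 \<Longrightarrow> y \<in> S1 \<Longrightarrow> z \<in> S1 \<Longrightarrow>
        \<bar>snd d z i - snd d y i - transition_deriv m c d p (\<lambda>k. snd c z k - snd c y k) i\<bar>
        \<le> \<epsilon> * l1norm m (\<lambda>k. snd c z k - snd c y k)"
        by (erule transition_increment[OF c d IntI[OF x(1,2)] \<epsilon>(1)])
      obtain S2 where S2: "openin M S2" "x \<in> S2" "S2 \<subseteq> fst d \<inter> fst e"
        "\<And>i p y z. i < m \<Longrightarrow> p \<in> S2 \<Longrightarrow> y \<in> S2 \<Longrightarrow> z \<in> S2 \<Longrightarrow>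
        \<bar>snd e z i - snd e y i - transition_deriv m d e p (\<lambda>k. snd d z k - snd d y k) i\<bar>
        \<le> \<epsilon> * l1norm m (\<lambda>k. snd d z k - snd d y k)"
        by (erule transition_increment[OF d e IntI[OF x(2,3)] \<epsilon>(1)])
      obtain S3 where S3: "openin M S3" "x \<in> S3" "S3 \<subseteq> fst c \<inter> fst e"
        "\<And>i p y z. i < m \<Longrightarrow> p \<in> S3 \<Longrightarrow> y \<in> S3 \<Longrightarrow> z \<in> S3 \<Longrightarrow>
        \<bar>snd e z i - snd e y i - transition_deriv m c e p (\<lambda>k. snd c z k - snd c y k) i\<bar>
        \<le> \<epsilon> * l1norm m (\<lambda>k. snd c z k - snd c y k)"
        by (erule transition_increment[OF c e IntI[OF x(1,3)] \<epsilon>(1)])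
      have nb: "openin M (S1 \<inter> S2 \<inter> S3)" "x \<in> S1 \<inter> S2 \<inter> S3" "S1 \<inter> S2 \<inter> S3 \<subseteq> fst c"
        using S1(1-3) S2(1,2) S3(1,2) by (auto intro!: openin_Int)
      obtain z t where z: "z \<in> S1 \<inter> S2 \<inter> S3" and t: "0 < t"
        and zt: "\<And>k. k < m \<Longrightarrow> snd c z k - snd c x k = t * v k"
        by (erule small_displacement[OF c nb, where v = v])
      define \<delta>c where "\<delta>c = (\<lambda>k. snd c z k - snd c x k)"
      define \<delta>d where "\<delta>d = (\<lambda>k. snd d z k - snd d x k)"
      define Ac where "Ac = transition_deriv m c d x \<delta>c"
      have n: "l1norm m \<delta>c = t * l1norm m v"
        using t by (simp add: l1norm_def \<delta>c_def zt abs_mult sum_distrib_left)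
      have R: "transition_deriv m c e x \<delta>c i = t * ?R"
      proof -
        have "transition_deriv m c e x \<delta>c = transition_deriv m c e x (\<lambda>k. t * v k)"
          by (rule transition_deriv_cong) (simp add: \<delta>c_def zt)
        then show ?thesis
          by (simp add: transition_deriv_scale)
      qed
      have L: "transition_deriv m d e x Ac i = t * ?L"
      proof -
        have "Ac = (\<lambda>k. t * transition_deriv m c d x v k)"
          unfolding Ac_def transition_deriv_scale[symmetric]
          by (intro ext fun_cong[OF transition_deriv_cong]) (simp add: \<delta>c_def zt)
        then show ?thesis
          by (simp add: transition_deriv_scale)
      qed
      have 1: "\<bar>\<delta>d k - Ac k\<bar> \<le> \<epsilon> * l1norm m \<delta>c" if "k < m" for k
        using S1(4)[OF that S1(2) S1(2), of z] z by (simp add: \<delta>d_def Ac_def \<delta>c_def)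
      have 2: "\<bar>snd e z i - snd e x i - transition_deriv m d e x \<delta>d i\<bar> \<le> \<epsilon> * l1norm m \<delta>d"
        using S2(4)[OF i S2(2) S2(2), of z] z by (simp add: \<delta>d_def)
      have 3: "\<bar>snd e z i - snd e x i - transition_deriv m c e x \<delta>c i\<bar> \<le> \<epsilon> * l1norm m \<delta>c"
        using S3(4)[OF i S3(2) S3(2), of z] z by (simp add: \<delta>c_def)
      have 4: "\<bar>transition_deriv m d e x \<delta>d i - transition_deriv m d e x Ac i\<bar> \<le> b * (real m * (\<epsilon> * l1norm m \<delta>c))"
      proof -
        have "\<bar>transition_deriv m d e x (\<lambda>k. \<delta>d k - Ac k) i\<bar> \<le> b * l1norm m (\<lambda>k. \<delta>d k - Ac k)"
          unfolding b_def by (rule transition_deriv_bound)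
        also have "\<dots> \<le> b * (real m * (\<epsilon> * l1norm m \<delta>c))"
          using 1 ab by (intro mult_left_mono l1norm_le)
        finally show ?thesis
          by (simp add: transition_deriv_diff)
      qed
      have 5: "l1norm m \<delta>d \<le> (real m * a + real m) * l1norm m \<delta>c"
      proof -
        have "\<bar>\<delta>d k\<bar> \<le> (a + 1) * l1norm m \<delta>c" if "k < m" for k
        proof -
          have "\<bar>Ac k\<bar> \<le> a * l1norm m \<delta>c"
            unfolding a_def Ac_def by (rule transition_deriv_bound)
          moreover have "\<epsilon> * l1norm m \<delta>c \<le> 1 * l1norm m \<delta>c"
            using \<epsilon> by (intro mult_right_mono l1norm_nonneg)
          ultimately show ?thesis
            using 1[OF that] by (simp add: algebra_simps)
        qed
        then have "l1norm m \<delta>d \<le> real m * ((a + 1) * l1norm m \<delta>c)"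
          by (rule l1norm_le)
        then show ?thesis
          by (simp add: algebra_simps)
      qed
      have 6: "\<epsilon> * l1norm m \<delta>d \<le> \<epsilon> * ((real m * a + real m) * l1norm m \<delta>c)"
        using 5 \<epsilon> by (intro mult_left_mono) auto
      have "\<bar>transition_deriv m d e x Ac i - transition_deriv m c e x \<delta>c i\<bar>
          \<le> b * (real m * (\<epsilon> * l1norm m \<delta>c)) + \<epsilon> * ((real m * a + real m) * l1norm m \<delta>c) + \<epsilon> * l1norm m \<delta>c"
        using 2 3 4 6 by linarith
      also have "\<dots> = \<epsilon> * K * l1norm m \<delta>c"
        by (simp add: K_def algebra_simps)
      finally have "\<bar>t * (?L - ?R)\<bar> \<le> t * (\<epsilon> * (K * l1norm m v))"
        unfolding L R n by (simp add: algebra_simps)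
      then show ?thesis
        using t by (simp add: abs_mult)
    qed
    have "\<bar>?L - ?R\<bar> \<le> 0"
    proof (rule field_le_epsilon)
      fix \<eta> :: real assume \<eta>: "0 < \<eta>"
      define B where "B = K * l1norm m v"
      have B: "0 \<le> B"
        using K l1norm_nonneg[of m v] by (simp add: B_def)
      \<comment> \<open>The bound 1 was used to estimate the length of \<delta>d; the denominator B
        + 1 is positive even when \<open>B\<close> is zero.\<close>
      define \<epsilon> where "\<epsilon> = min 1 (\<eta> / (B + 1))"
      have "0 < \<epsilon>" "\<epsilon> \<le> 1"
        using \<eta> B by (auto simp: \<epsilon>_def)
      then have "\<bar>?L - ?R\<bar> \<le> \<epsilon> * B"
        unfolding B_def by (rule main)
      also have "\<dots> \<le> \<eta> / (B + 1) * B"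
        using B by (intro mult_right_mono) (auto simp: \<epsilon>_def)
      also have "\<dots> \<le> \<eta>"
        using B \<eta> by (simp add: field_simps)
      finally show "\<bar>?L - ?R\<bar> \<le> 0 + \<eta>"
        by simp
    qed
    then show ?thesis
      by simp
  qed
qed

text \<open>Near \<open>x0\<close>, reading the displacement of chart \<open>d\<close> in chart
  \<open>c\<close> almost returns the displacement of \<open>c\<close>, uniformly in both points.
  The error must be relative to the displacement in \<open>c\<close> so that it can be compared
  across several charts \<open>d\<close>.\<close>

lemma transition_deriv_estimate:
  assumes c: "c \<in> \<A>" and d: "d \<in> \<A>" and x0: "x0 \<in> fst c" "x0 \<in> fst d" and \<eta>: "0 < \<eta>"
  obtains S where "openin M S" "x0 \<in> S" "S \<subseteq> fst c \<inter> fst d"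
    "\<And>k x y. k < m \<Longrightarrow> x \<in> S \<Longrightarrow> y \<in> S \<Longrightarrow>
      \<bar>snd c y k - snd c x k - transition_deriv m d c x (\<lambda>l. snd d y l - snd d x l) k\<bar>
        \<le> \<eta> * l1norm m (\<lambda>l. snd c y l - snd c x l)"
proof -
  define a where "a = transition_bound m c d x0"
  \<comment> \<open>A Lipschitz constant for the change from \<open>c\<close> to \<open>d\<close>
    near \<open>x0\<close>: Jacobian bound \<open>a\<close> plus error 1 in each of the m
    coordinates. It converts the error measured in \<open>d\<close> into one measured in
    \<open>c\<close>.\<close>
  define L where "L = real m * (a + 1)"
  have L: "0 \<le> L"
    by (simp add: L_def a_def transition_bound_nonneg)
  define \<epsilon> where "\<epsilon> = \<eta> / (L + 1)"
  have \<epsilon>: "0 < \<epsilon>"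
    using \<eta> L by (simp add: \<epsilon>_def)
  obtain S1 where S1: "openin M S1" "x0 \<in> S1" "S1 \<subseteq> fst c \<inter> fst d"
    "\<And>i p y z. i < m \<Longrightarrow> p \<in> S1 \<Longrightarrow> y \<in> S1 \<Longrightarrow> z \<in> S1 \<Longrightarrow>
    \<bar>snd d z i - snd d y i - transition_deriv m c d p (\<lambda>k. snd c z k - snd c y k) i\<bar>
    \<le> 1 * l1norm m (\<lambda>k. snd c z k - snd c y k)"
    by (erule transition_increment[OF c d IntI[OF x0(1,2)] zero_less_one])
  obtain S2 where S2: "openin M S2" "x0 \<in> S2" "S2 \<subseteq> fst d \<inter> fst c"
    "\<And>i p y z. i < m \<Longrightarrow> p \<in> S2 \<Longrightarrow> y \<in> S2 \<Longrightarrow> z \<in> S2 \<Longrightarrow>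
    \<bar>snd c z i - snd c y i - transition_deriv m d c p (\<lambda>k. snd d z k - snd d y k) i\<bar>
    \<le> \<epsilon> * l1norm m (\<lambda>k. snd d z k - snd d y k)"
    by (erule transition_increment[OF d c IntI[OF x0(2,1)] \<epsilon>])
  show ?thesis
  proof (rule that[of "S1 \<inter> S2"])
    show "openin M (S1 \<inter> S2)" "x0 \<in> S1 \<inter> S2" "S1 \<inter> S2 \<subseteq> fst c \<inter> fst d"
      using S1(1-3) S2(1,2) by auto
    fix k x y assume k: "k < m" and xy: "x \<in> S1 \<inter> S2" "y \<in> S1 \<inter> S2"
    define \<delta>c where "\<delta>c = (\<lambda>k. snd c y k - snd c x k)"
    define \<delta>d where "\<delta>d = (\<lambda>k. snd d y k - snd d x k)"
    have "\<bar>\<delta>d l\<bar> \<le> (a + 1) * l1norm m \<delta>c" if "l < m" for l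
    proof -
      have "\<bar>\<delta>d l - transition_deriv m c d x0 \<delta>c l\<bar> \<le> l1norm m \<delta>c"
        using S1(4)[OF that S1(2), of x y] xy by (simp add: \<delta>c_def \<delta>d_def)
      moreover have "\<bar>transition_deriv m c d x0 \<delta>c l\<bar> \<le> a * l1norm m \<delta>c"
        unfolding a_def by (rule transition_deriv_bound)
      ultimately show ?thesis
        by (simp add: algebra_simps)
    qed
    then have "l1norm m \<delta>d \<le> real m * ((a + 1) * l1norm m \<delta>c)"
      by (rule l1norm_le)
    then have "\<epsilon> * l1norm m \<delta>d \<le> \<epsilon> * (L * l1norm m \<delta>c)"
      using \<epsilon> by (intro mult_left_mono) (simp_all add: L_def mult.assoc)
    also have "\<dots> = \<eta> * (L / (L + 1)) * l1norm m \<delta>c"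
      by (simp add: \<epsilon>_def)
    also have "\<dots> \<le> \<eta> * 1 * l1norm m \<delta>c"
      using \<eta> L by (intro mult_right_mono mult_left_mono l1norm_nonneg) (auto simp: field_simps)
    finally have "\<epsilon> * l1norm m \<delta>d \<le> \<eta> * l1norm m \<delta>c"
      by simp
    moreover have "\<bar>snd c y k - snd c x k - transition_deriv m d c x \<delta>d k\<bar> \<le> \<epsilon> * l1norm m \<delta>d"
      using S2(4)[OF k, of x x y] xy by (simp add: \<delta>d_def)
    ultimately show "\<bar>snd c y k - snd c x k - transition_deriv m d c x (\<lambda>l. snd d y l - snd d x l) k\<bar>
        \<le> \<eta> * l1norm m (\<lambda>l. snd c y l - snd c x l)"
      unfolding \<delta>c_def \<delta>d_def by linarith
  qed
qed

lemma continuous_map_transition_deriv: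
  assumes c: "c \<in> \<A>" and d: "d \<in> \<A>"
    and x: "continuous_map X (subtopology M (fst c \<inter> fst d)) x"
    and v: "\<And>j. j < m \<Longrightarrow> continuous_map X euclideanreal (\<lambda>p. v p j)"
  shows "continuous_map X euclideanreal (\<lambda>p. transition_deriv m c d (x p) (v p) k)"
proof (cases "k < m")
  case True
  have *: "continuous_map X euclideanreal (\<lambda>p. partial_deriv j (\<lambda>y. transition c d y k) (snd c (x p)))"
    if j: "j < m" for j
  proof -
    have "continuous_map (subtopology (Euclidean_space m) (snd c ` (fst c \<inter> fst d))) euclideanreal
        (partial_deriv j (\<lambda>y. transition c d y k))"
      using transition_ck[OF c d True] j by simp
    moreover have "continuous_map (subtopology M (fst c \<inter> fst d))
        (subtopology (Euclidean_space m) (snd c ` (fst c \<inter> fst d))) (snd c)"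
      using continuous_map_from_subtopology_mono[OF continuous_map_chart[OF c], of "fst c \<inter> fst d"]
      by (auto simp: continuous_map_in_subtopology)
    ultimately have "continuous_map X euclideanreal (partial_deriv j (\<lambda>y. transition c d y k) \<circ> (snd c \<circ> x))"
      using x by (intro continuous_map_compose)
    then show ?thesis
      by (simp add: comp_def)
  qed
  have "continuous_map X euclideanreal
      (\<lambda>p. \<Sum>j<m. partial_deriv j (\<lambda>y. transition c d y k) (snd c (x p)) * v p j)"
    by (intro continuous_map_sum continuous_map_real_mult * v) auto
  then show ?thesis
    using True by (simp add: transition_deriv_def)
qed (simp add: transition_deriv_def)

end

section \<open>Tangent vectors near the diagonal\<close>

lemma topspace_tangent_bundle:
  "topspace (tangent_bundle m M \<A>)
     = {tangent_vector m \<A> c x v | c x v. c \<in> \<A> \<and> x \<in> topspace M \<inter> fst c \<and> v \<in> topspace (Euclidean_space m)}"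
proof -
  have "topspace (tangent_bundle m M \<A>) = (\<lambda>(c, x, v). tangent_vector m \<A> c x v) `
      topspace (sum_topology (\<lambda>c. prod_topology (subtopology M (fst c)) (Euclidean_space m)) \<A>)"
    unfolding tangent_bundle_def using quotient_imp_surjective_map[OF quotient_map_quotient_topology] by metis
  then show ?thesis
    by (force simp: image_iff)
qed

lemma continuous_map_tangent_vector:
  assumes "c \<in> \<A>"
  shows "continuous_map (prod_topology (subtopology M (fst c)) (Euclidean_space m)) (tangent_bundle m M \<A>)
           (\<lambda>(x, v). tangent_vector m \<A> c x v)"
  using continuous_map_compose[OF
      continuous_map_component_injection[OF assms, of "\<lambda>c. prod_topology (subtopology M (fst c)) (Euclidean_space m)"]
      quotient_imp_continuous_map[OF quotient_map_quotient_topology[where f = "\<lambda>(c, x, v). tangent_vector m \<A> c x v"]]]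
  unfolding tangent_bundle_def by (simp add: comp_def case_prod_unfold)

text \<open>By the chain rule a tangent vector is determined by its base point and its coordinates
  in a single chart chosen for that point.\<close>

lemma tangent_bundle_lepoll_real:
  assumes mfd: "smooth_manifold m M \<A>"
  shows "topspace (tangent_bundle m M \<A>) \<lesssim> (UNIV :: real set)"
proof -
  have M: "topspace M \<lesssim> (UNIV :: real set)"
    using mfd by (intro second_countable_lepoll_real) (auto simp: smooth_manifold_def)
  define ch where "ch x = (SOME c. c \<in> \<A> \<and> x \<in> fst c)" for x
  have ch: "ch x \<in> \<A>" "x \<in> fst (ch x)" if "x \<in> topspace M" for x
  proof -
    have "\<exists>c. c \<in> \<A> \<and> x \<in> fst c"
      using smooth_manifold_chart_cover[OF mfd that] by blast
    then have "ch x \<in> \<A> \<and> x \<in> fst (ch x)"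
      unfolding ch_def by (rule someI_ex)
    then show "ch x \<in> \<A>" "x \<in> fst (ch x)"
      by blast+
  qed
  have "inj_on (\<lambda>(x, F). (x, F (ch x))) (topspace (tangent_bundle m M \<A>))"
  proof (rule inj_onI)
    fix p q assume p: "p \<in> topspace (tangent_bundle m M \<A>)" and q: "q \<in> topspace (tangent_bundle m M \<A>)"
      and eq: "(\<lambda>(x, F). (x, F (ch x))) p = (\<lambda>(x, F). (x, F (ch x))) q"
    obtain c x v where p': "p = tangent_vector m \<A> c x v" "c \<in> \<A>" "x \<in> topspace M" "x \<in> fst c"
      using p unfolding topspace_tangent_bundle by blast
    obtain c' x' v' where q': "q = tangent_vector m \<A> c' x' v'" "c' \<in> \<A>" "x' \<in> topspace M" "x' \<in> fst c'"
      using q unfolding topspace_tangent_bundle by blast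
    have x': "x' = x"
      using eq by (simp add: p' q' tangent_vector_def)
    have chx: "transition_deriv m c (ch x) x v = transition_deriv m c' (ch x) x v'"
      using eq ch[OF p'(3)] by (simp add: p' q' tangent_vector_def x')
    have "transition_deriv m c d x v = transition_deriv m c' d x v'" if d: "d \<in> \<A>" "x \<in> fst d" for d
      using transition_deriv_comp[OF mfd p'(2) ch(1)[OF p'(3)] d(1) p'(4) ch(2)[OF p'(3)] d(2), of v]
        transition_deriv_comp[OF mfd q'(2) ch(1)[OF p'(3)] d(1) q'(4)[unfolded x'] ch(2)[OF p'(3)] d(2), of v'] chx
      by simp
    then have "(\<lambda>d\<in>{d \<in> \<A>. x \<in> fst d}. transition_deriv m c d x v) = (\<lambda>d\<in>{d \<in> \<A>. x \<in> fst d}. transition_deriv m c' d x v')"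
      by (intro restrict_ext) blast
    then show "p = q"
      by (simp add: p' q' tangent_vector_def x')
  qed
  moreover have "(\<lambda>(x, F). (x, F (ch x))) ` topspace (tangent_bundle m M \<A>) \<subseteq> topspace M \<times> UNIV"
    unfolding topspace_tangent_bundle by (auto simp: tangent_vector_def)
  ultimately have "topspace (tangent_bundle m M \<A>) \<lesssim> topspace M \<times> (UNIV :: (nat \<Rightarrow> real) set)"
    unfolding lepoll_def by blast
  then show ?thesis
    using lepoll_real_Times[OF M lepoll_nat_fun_real] by (rule lepoll_trans)
qed

text \<open>
  The vector \<open>\<Sum>\<^sub>i \<lambda>\<^sub>i(x) (\<psi>\<^sub>i(y) - \<psi>\<^sub>i(x))\<close>, the \<open>i\<close>-th summand being read in the chart \<open>\<psi>\<^sub>i\<close>, is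
  continuous in \<open>(x, y)\<close> and, by strict differentiability, nonzero near the diagonal.
\<close>

lemma manifold_vectors:
  fixes M :: "'p topology"
  assumes mfd: "smooth_manifold m M \<A>"
  obtains N \<phi> where "openin (prod_topology M M) N" "\<And>x. x \<in> topspace M \<Longrightarrow> (x, x) \<in> N"
    "continuous_map (subtopology (prod_topology M M) N) (tangent_bundle m M \<A>) \<phi>"
    "\<And>x. \<phi> (x, x) = zero_vector \<A> x"
    "\<And>x y. (x, y) \<in> N \<Longrightarrow> x \<noteq> y \<Longrightarrow>
       \<phi> (x, y) \<in> topspace (tangent_bundle m M \<A>) - zero_vector \<A> ` topspace M"
proof (cases "topspace M = {}")
  case True
  define \<phi> :: "'p \<times> 'p \<Rightarrow> _" where "\<phi> = (\<lambda>(x, y). zero_vector \<A> x)"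
  show ?thesis
    by (rule that[of "{}" \<phi>]) (use True in \<open>auto simp: \<phi>_def\<close>)
next
  case False
  obtain C B K lam where bumps:
    "\<And>i :: nat. C i \<in> \<A>" "\<And>i. openin (Euclidean_space m) (B i)" "\<And>i. B i \<subseteq> snd (C i) ` fst (C i)"
    "\<And>i y z u. y \<in> B i \<Longrightarrow> z \<in> B i \<Longrightarrow> 0 \<le> u \<Longrightarrow> u \<le> 1 \<Longrightarrow> (\<lambda>k. (1 - u) * y k + u * z k) \<in> B i"
    "\<And>i. closedin M (K i)" "\<And>i. K i \<subseteq> {x \<in> fst (C i). snd (C i) x \<in> B i}"
    "\<And>i. continuous_map M euclideanreal (lam i)"
    "\<And>i x. x \<in> topspace M \<Longrightarrow> 0 \<le> lam i x" "\<And>i x. x \<in> topspace M \<Longrightarrow> lam i x \<le> (1 :: real)"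
    "\<And>i x. x \<in> topspace M \<Longrightarrow> x \<notin> K i \<Longrightarrow> lam i x = 0"
    "\<And>x. x \<in> topspace M \<Longrightarrow> \<exists>i. lam i x = 1"
    "\<And>x. x \<in> topspace M \<Longrightarrow> \<exists>S n. openin M S \<and> x \<in> S \<and> (\<forall>y\<in>S. \<forall>i\<ge>n. lam i y = 0)"
    by (erule manifold_bumps[OF mfd False])
  let ?MM = "prod_topology M M" and ?T = "tangent_bundle m M \<A>" and ?R = "Euclidean_space m"
  define disp where "disp c x y = (\<lambda>l. snd c y l - snd c x l :: real)" for c :: "'p chart" and x y
  \<comment> \<open>The coordinates in chart \<open>d\<close> of the weighted sum of displacements.
    The index set is finite for every point of \<open>M\<close> by local finiteness.\<close>
  define W where "W x y d = (\<lambda>k. \<Sum>i | lam i x \<noteq> 0. lam i x * transition_deriv m (C i) d x (disp (C i) x y) k)" for x y d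
  define \<phi> where "\<phi> = (\<lambda>(x, y). (x, \<lambda>d\<in>{d \<in> \<A>. x \<in> fst d}. W x y d))"
  \<comment> \<open>Continuity and nonvanishing are proved on squares \<open>Q \<times> Q\<close>,
    on which one chart and one finite set of indices suffice.\<close>
  define good where "good Q \<longleftrightarrow> openin M Q \<and> continuous_map (subtopology ?MM (Q \<times> Q)) ?T \<phi> \<and>
    (\<forall>x\<in>Q. \<forall>y\<in>Q. x \<noteq> y \<longrightarrow> \<phi> (x, y) \<notin> zero_vector \<A> ` topspace M)" for Q
  have ex: "\<exists>Q. x0 \<in> Q \<and> good Q" if x0: "x0 \<in> topspace M" for x0
  proof -
    obtain c where c: "c \<in> \<A>" "x0 \<in> fst c"
      using smooth_manifold_chart_cover[OF mfd x0] by blast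
    obtain T n where T: "openin M T" "x0 \<in> T" "\<forall>y\<in>T. \<forall>i\<ge>n. lam i y = 0"
      using bumps(12)[OF x0] by blast
    \<comment> \<open>Only these indices can contribute near \<open>x0\<close>: the weights from
      \<open>n\<close> on vanish on \<open>T\<close>, and those whose closed \<open>K i\<close>
      misses \<open>x0\<close> vanish on \<open>T'\<close>.\<close>
    define I where "I = {i. i < n \<and> x0 \<in> K i}"
    have I: "finite I"
      by (simp add: I_def)
    have T'_ex: "\<exists>S. openin M S \<and> x0 \<in> S \<and> (\<forall>x\<in>S. lam i x = 0)" if "i \<in> {i. i < n \<and> x0 \<notin> K i}" for i
    proof (intro exI conjI)
      show "openin M (topspace M - K i)"
        using bumps(5) by (simp add: openin_diff)
    qed (use that x0 bumps(10) in auto)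
    have "finite {i. i < n \<and> x0 \<notin> K i}"
      by simp
    then obtain T' where T': "openin M T'" "x0 \<in> T'"
      "\<And>i. i \<in> {i. i < n \<and> x0 \<notin> K i} \<Longrightarrow> \<forall>x\<in>T'. lam i x = 0"
      using x0 T'_ex by (rule finite_neighbourhood[where Q = "\<lambda>i S. \<forall>x\<in>S. lam i x = 0"]) blast+
    \<comment> \<open>Summing the error over m coordinates gives a factor of at most 1 / 2; the
      added 1 keeps the denominator positive for m = 0.\<close>
    define \<eta> where "\<eta> = 1 / (2 * (real m + 1))"
    have \<eta>: "0 < \<eta>"
      by (simp add: \<eta>_def)
    define E where "E i S \<longleftrightarrow> S \<subseteq> fst c \<inter> fst (C i) \<and> (\<forall>x\<in>S. \<forall>y\<in>S. \<forall>k<m.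
        \<bar>disp c x y k - transition_deriv m (C i) c x (disp (C i) x y) k\<bar> \<le> \<eta> * l1norm m (disp c x y))" for i S
    have E_ex: "\<exists>S. openin M S \<and> x0 \<in> S \<and> E i S" if "i \<in> I" for i
    proof -
      have x0i: "x0 \<in> fst (C i)"
        using that bumps(6) by (auto simp: I_def)
      obtain S where "openin M S" "x0 \<in> S" "S \<subseteq> fst c \<inter> fst (C i)"
        "\<And>k x y. k < m \<Longrightarrow> x \<in> S \<Longrightarrow> y \<in> S \<Longrightarrow>
        \<bar>snd c y k - snd c x k - transition_deriv m (C i) c x (\<lambda>l. snd (C i) y l - snd (C i) x l) k\<bar>
        \<le> \<eta> * l1norm m (\<lambda>l. snd c y l - snd c x l)"
        by (erule transition_deriv_estimate[OF mfd c(1) bumps(1)[of i] c(2) x0i \<eta>])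
      then show ?thesis
        by (intro exI[of _ S]) (auto simp: E_def disp_def)
    qed
    have E_anti: "E i S'" if "E i S" "S' \<subseteq> S" for i S S'
      using that unfolding E_def by blast
    obtain S where S: "openin M S" "x0 \<in> S" "\<And>i. i \<in> I \<Longrightarrow> E i S"
      using I x0 E_ex E_anti by (rule finite_neighbourhood[where Q = E]) blast+
    define Q where "Q = T \<inter> T' \<inter> S \<inter> fst c"
    have Q: "openin M Q"
      unfolding Q_def using T(1) T'(1) S(1) chart_homeomorphism(3)[OF smooth_manifold_is_chart[OF mfd c(1)]] by (intro openin_Int)
    have x0Q: "x0 \<in> Q"
      using T(2) T'(2) S(2) c(2) by (simp add: Q_def)
    have QM: "Q \<subseteq> topspace M"
      using Q by (rule openin_subset)
    have Qc: "Q \<subseteq> fst c"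
      by (simp add: Q_def)
    have Qi: "Q \<subseteq> fst (C i)" if "i \<in> I" for i
      using S(3)[OF that] by (auto simp: Q_def E_def)
    have lam_Q: "lam i x = 0" if "x \<in> Q" "i \<notin> I" for i x
    proof (cases "i < n")
      case True
      then show ?thesis
        using that T'(3)[of i] by (simp add: I_def Q_def)
    next
      case False
      then show ?thesis
        using that(1) T(3) by (simp add: Q_def)
    qed
    have W_Q: "W x y d k = (\<Sum>i\<in>I. lam i x * transition_deriv m (C i) d x (disp (C i) x y) k)" if "x \<in> Q" for x y d k
      unfolding W_def using lam_Q[OF that] I by (intro sum.mono_neutral_left) auto
    have W_R: "W x y d \<in> topspace ?R" for x y d
      by (simp add: W_def topspace_Euclidean_space transition_deriv_def)
    \<comment> \<open>By linearity and the chain rule the coordinates in the various charts belong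
      to one tangent vector, so \<phi> takes values in the bundle and its continuity can be checked
      in the single chart \<open>c\<close>.\<close>
    have W_trans: "transition_deriv m c d x (W x y c) = W x y d" if x: "x \<in> Q" and d: "d \<in> \<A>" "x \<in> fst d" for x y d
    proof
      fix k
      have "transition_deriv m c d x (W x y c) k
          = transition_deriv m c d x (\<lambda>k. \<Sum>i\<in>I. lam i x * transition_deriv m (C i) c x (disp (C i) x y) k) k"
        using W_Q[OF x] by presburger
      also have "\<dots> = (\<Sum>i\<in>I. lam i x * transition_deriv m c d x (transition_deriv m (C i) c x (disp (C i) x y)) k)"
        by (rule transition_deriv_sum)
      also have "\<dots> = (\<Sum>i\<in>I. lam i x * transition_deriv m (C i) d x (disp (C i) x y) k)"
      proof (rule sum.cong)
        fix i assume "i \<in> I"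
        then have "x \<in> fst (C i)"
          using Qi x by blast
        then show "lam i x * transition_deriv m c d x (transition_deriv m (C i) c x (disp (C i) x y)) k
            = lam i x * transition_deriv m (C i) d x (disp (C i) x y) k"
          using transition_deriv_comp[OF mfd bumps(1) c(1) d(1)] Qc x d(2) by (metis subsetD)
      qed simp
      finally show "transition_deriv m c d x (W x y c) k = W x y d k"
        by (simp add: W_Q[OF x])
    qed
    have \<phi>_Q: "\<phi> (x, y) = tangent_vector m \<A> c x (W x y c)" if "x \<in> Q" for x y
      unfolding \<phi>_def tangent_vector_def prod.case
      by (intro arg_cong[where f = "Pair x"] restrict_ext) (simp add: W_trans[OF that])
    let ?QQ = "subtopology ?MM (Q \<times> Q)"
    have fstQ: "continuous_map ?QQ (subtopology M Q) fst" and sndQ: "continuous_map ?QQ (subtopology M Q) snd"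
      unfolding subtopology_Times by (rule continuous_map_fst, rule continuous_map_snd)
    have sub: "continuous_map ?QQ (subtopology M U) fst" "continuous_map ?QQ (subtopology M U) snd" if "Q \<subseteq> U" for U
      using fstQ sndQ that by (auto simp: continuous_map_in_subtopology)
    have coord: "continuous_map ?QQ euclideanreal (\<lambda>p. snd d (f p) l)"
      if "d \<in> \<A>" "continuous_map ?QQ (subtopology M (fst d)) f" for d f l
      using continuous_map_compose[OF continuous_map_compose[OF that(2) continuous_map_chart[OF mfd that(1)]]
          continuous_map_Euclidean_space_component]
      by (simp add: comp_def)
    have "continuous_map ?QQ euclideanreal
        (\<lambda>p. lam i (fst p) * transition_deriv m (C i) c (fst p) (disp (C i) (fst p) (snd p)) k)" if i: "i \<in> I" for i k
    proof (intro continuous_map_real_mult continuous_map_transition_deriv[OF mfd bumps(1) c(1)])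
      show "continuous_map ?QQ euclideanreal (\<lambda>p. lam i (fst p))"
        using continuous_map_compose[OF sub(1)[OF QM] continuous_map_from_subtopology[OF bumps(7)]]
        by (simp add: comp_def)
      show "continuous_map ?QQ (subtopology M (fst (C i) \<inter> fst c)) fst"
        using Qc Qi[OF i] by (intro sub(1)) auto
      show "continuous_map ?QQ euclideanreal (\<lambda>p. disp (C i) (fst p) (snd p) j)" for j
        unfolding disp_def
        by (intro continuous_map_diff coord bumps(1) sub Qi[OF i])
    qed
    then have "continuous_map ?QQ euclideanreal
        (\<lambda>p. \<Sum>i\<in>I. lam i (fst p) * transition_deriv m (C i) c (fst p) (disp (C i) (fst p) (snd p)) k)" for k
      using I by (intro continuous_map_sum)
    then have "continuous_map ?QQ euclideanreal (\<lambda>p. W (fst p) (snd p) c k)" for k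
      by (rule continuous_map_eq) (auto simp: W_Q)
    then have "continuous_map ?QQ ?R (\<lambda>p. W (fst p) (snd p) c)"
      unfolding continuous_map_Euclidean_space_iff' using W_R by (auto simp: topspace_Euclidean_space)
    then have "continuous_map ?QQ (prod_topology (subtopology M (fst c)) ?R) (\<lambda>p. (fst p, W (fst p) (snd p) c))"
      using sub(1)[OF Qc] by (simp add: continuous_map_pairwise comp_def)
    from continuous_map_compose[OF this continuous_map_tangent_vector[OF c(1)]]
    have cont: "continuous_map ?QQ ?T \<phi>"
      by (rule continuous_map_eq) (auto simp: \<phi>_Q)
    \<comment> \<open>\<open>W\<close> differs from \<Lambda> \<delta> by at most \<Lambda> \<eta>
      times the length of \<delta> in each coordinate, and \<Lambda> is at least 1 because some
      weight is 1. If \<open>W\<close> vanished, the length of \<delta> would be at most half of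
      itself.\<close>
    have nonzero: "W x y c \<noteq> (\<lambda>i. 0)" if xy: "x \<in> Q" "y \<in> Q" "x \<noteq> y" for x y
    proof
      assume W0: "W x y c = (\<lambda>i. 0)"
      define \<delta> where "\<delta> = disp c x y"
      define \<Lambda> where "\<Lambda> = (\<Sum>i\<in>I. lam i x)"
      have xM: "x \<in> topspace M"
        using xy QM by blast
      obtain i where i: "lam i x = 1"
        using bumps(11)[OF xM] by blast
      then have "i \<in> I"
        using lam_Q[OF xy(1), of i] by auto
      then have "1 \<le> \<Lambda>"
        unfolding \<Lambda>_def using i I bumps(8)[OF xM] by (metis member_le_sum)
      have "\<bar>\<Lambda> * \<delta> k\<bar> \<le> \<Lambda> * (\<eta> * l1norm m \<delta>)" if k: "k < m" for k
      proof -
        have "\<Lambda> * \<delta> k = \<Lambda> * \<delta> k - W x y c k"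
          by (simp add: W0)
        also have "\<dots> = (\<Sum>i\<in>I. lam i x * (\<delta> k - transition_deriv m (C i) c x (disp (C i) x y) k))"
          by (simp add: W_Q[OF xy(1)] \<Lambda>_def sum_distrib_right right_diff_distrib sum_subtractf)
        also have "\<bar>\<dots>\<bar> \<le> (\<Sum>i\<in>I. lam i x * (\<eta> * l1norm m \<delta>))"
        proof (rule order_trans[OF sum_abs sum_mono])
          fix i assume i: "i \<in> I"
          have "\<bar>\<delta> k - transition_deriv m (C i) c x (disp (C i) x y) k\<bar> \<le> \<eta> * l1norm m \<delta>"
            using S(3)[OF i] xy k unfolding E_def \<delta>_def Q_def by blast
          then show "\<bar>lam i x * (\<delta> k - transition_deriv m (C i) c x (disp (C i) x y) k)\<bar>
              \<le> lam i x * (\<eta> * l1norm m \<delta>)"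
            using bumps(8)[OF xM, of i] by (simp add: abs_mult mult_left_mono)
        qed
        finally show ?thesis
          by (simp add: \<Lambda>_def sum_distrib_right)
      qed
      then have "\<bar>\<delta> k\<bar> \<le> \<eta> * l1norm m \<delta>" if "k < m" for k
        using that \<open>1 \<le> \<Lambda>\<close> by (fastforce simp: abs_mult)
      then have "l1norm m \<delta> \<le> real m * (\<eta> * l1norm m \<delta>)"
        by (rule l1norm_le)
      also have "\<dots> = (real m * \<eta>) * l1norm m \<delta>"
        by simp
      also have "\<dots> \<le> 1 / 2 * l1norm m \<delta>"
        by (intro mult_right_mono l1norm_nonneg) (simp add: \<eta>_def field_simps)
      finally have l0: "l1norm m \<delta> = 0"
        using l1norm_nonneg[of m \<delta>] by simp
      have "\<delta> k = 0" if "k < m" for k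
        using l0 that by (simp add: l1norm_def sum_nonneg_eq_0_iff)
      moreover have "snd c x \<in> topspace ?R" "snd c y \<in> topspace ?R"
        using chart_homeomorphism(5)[OF smooth_manifold_is_chart[OF mfd c(1)]] Qc xy by blast+
      ultimately have "snd c x k = snd c y k" for k
        by (cases "k < m") (auto simp: \<delta>_def disp_def topspace_Euclidean_space)
      then have "snd c x = snd c y"
        by blast
      then show False
        using chart_homeomorphism(4)[OF smooth_manifold_is_chart[OF mfd c(1)]] Qc xy by (meson inj_onD subsetD)
    qed
    have "\<phi> (x, y) \<notin> zero_vector \<A> ` topspace M" if xy: "x \<in> Q" "y \<in> Q" "x \<noteq> y" for x y
    proof
      assume "\<phi> (x, y) \<in> zero_vector \<A> ` topspace M"
      then obtain x' where "\<phi> (x, y) = zero_vector \<A> x'"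
        by blast
      then have "x' = x" and F: "(\<lambda>d\<in>{d \<in> \<A>. x \<in> fst d}. W x y d) = (\<lambda>d\<in>{d \<in> \<A>. x' \<in> fst d}. (\<lambda>i. 0))"
        unfolding \<phi>_def zero_vector_def prod.case prod.inject by blast+
      have "(\<lambda>d\<in>{d \<in> \<A>. x \<in> fst d}. W x y d) c = (\<lambda>d\<in>{d \<in> \<A>. x' \<in> fst d}. (\<lambda>i. 0)) c"
        by (rule fun_cong[OF F])
      then have "W x y c = (\<lambda>i. 0)"
        using c(1) subsetD[OF Qc xy(1)] \<open>x' = x\<close> by (simp add: restrict_def)
      then show False
        using nonzero[OF xy] by blast
    qed
    then have "good Q"
      using Q cont by (simp add: good_def)
    then show ?thesis
      using x0Q by blast
  qed
  \<comment> \<open>Any pair in \<open>N\<close> lies in one common square, so nonvanishing off the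
    diagonal passes to the union.\<close>
  define N where "N = (\<Union>Q\<in>{Q. good Q}. Q \<times> Q)"
  have N: "openin ?MM N"
    unfolding N_def by (intro openin_Union) (auto simp: good_def openin_prod_Times_iff)
  have "continuous_near ?MM ?T \<phi> p" if p: "p \<in> N" for p
  proof -
    obtain Q where Q: "good Q" "p \<in> Q \<times> Q"
      using p by (auto simp: N_def)
    then show ?thesis
      by (intro continuous_nearI[of ?MM "Q \<times> Q"]) (auto simp: good_def openin_prod_Times_iff)
  qed
  then have cont: "continuous_map (subtopology ?MM N) ?T \<phi>"
    by (rule continuous_map_if_near)
  show ?thesis
  proof (rule that[OF N _ cont])
    show "(x, x) \<in> N" if "x \<in> topspace M" for x
      using ex[OF that] by (auto simp: N_def)
    have "transition_deriv m (C i) d x (disp (C i) x x) k = 0" for i d x k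
      by (simp add: disp_def transition_deriv_def)
    then show "\<phi> (x, x) = zero_vector \<A> x" for x
      by (simp add: \<phi>_def zero_vector_def W_def)
    fix x y assume xy: "(x, y) \<in> N" "x \<noteq> y"
    have "(x, y) \<in> topspace (subtopology ?MM N)"
      using xy(1) openin_subset[OF N] by auto
    then have "\<phi> (x, y) \<in> topspace ?T"
      using continuous_map_image_subset_topspace[OF cont] by blast
    moreover have "\<phi> (x, y) \<notin> zero_vector \<A> ` topspace M"
      using xy by (auto simp: N_def good_def)
    ultimately show "\<phi> (x, y) \<in> topspace ?T - zero_vector \<A> ` topspace M"
      by blast
  qed
qed

section \<open>Composing the shrinkings of all circles\<close>

theorem corollary52:
  fixes h :: "('u, 'c) cohomology"
    and M :: "'p topology" and \<A> :: "'p chart set"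
    and m n :: nat and k :: int and t b :: 'c
  defines "W \<equiv> wedge_circles n"
  defines "E \<equiv> mapping_space W M"
  defines "ev \<equiv> (\<lambda>\<gamma> :: nat \<times> complex \<Rightarrow> 'p. \<gamma> (wedge_base n))"
  defines "\<sigma> \<equiv> const_map W"
  defines "e \<equiv> manifold_euler_class h m M \<A> t"
  assumes "additive_cohomology_theory h"
    and "multiplicative_cohomology_theory h"
    and "(UNIV :: real set) \<lesssim> (UNIV :: 'u set)"
    and "smooth_manifold m M \<A>"
    and "manifold_orientation h m M \<A> t"
    and "b \<in> carrier (coh h k E {})"
  shows "coh_cup h E {} {} k (int m) b (coh_ind h (int m) E {} M {} ev e)
       = coh_cup h E {} {} k (int m)
           (coh_ind h k E {} M {} ev (coh_ind h k M {} E {} \<sigma> b))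
           (coh_ind h (int m) E {} M {} ev e)"
proof -
  note mult = assms(7) and le = assms(8) and mfd = assms(9) and b = assms(11)
  interpret multiplicative_cohomology_theory h by (fact mult)
  have coh: "cohomology_theory h"
    by unfold_locales
  have haus: "Hausdorff_space M" and sc: "second_countable M"
    using mfd by (auto simp: smooth_manifold_def)
  let ?T = "tangent_bundle m M \<A>" and ?z = "zero_vector \<A>"
  let ?Tnz = "topspace ?T - ?z ` topspace M"
  have E: "E = mapping_space (wedge_circles n) M"
    by (simp add: E_def W_def)
  \<comment> \<open>The mapping space, its cylinder, the tangent bundle and \<open>M\<close> must
    all have genuine copies in the universe; each injects into the real line, which the universe
    contains by hypothesis.\<close>
  have real_E: "topspace E \<lesssim> (UNIV :: real set)"
    unfolding E by (rule wedge_maps_lepoll_real[OF haus sc])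
  have "topspace I01 \<lesssim> (UNIV :: real set)"
    by (intro subset_imp_lepoll) simp
  from lepoll_real_Times[OF real_E this] have real_EI: "topspace (prod_topology E I01) \<lesssim> (UNIV :: real set)"
    by simp
  have leE: "topspace E \<lesssim> (UNIV :: 'u set)" and leEI: "topspace (prod_topology E I01) \<lesssim> (UNIV :: 'u set)"
    and leT: "topspace ?T \<lesssim> (UNIV :: 'u set)" and leM: "topspace M \<lesssim> (UNIV :: 'u set)"
    using lepoll_trans[OF real_E le] lepoll_trans[OF real_EI le]
      lepoll_trans[OF tangent_bundle_lepoll_real[OF mfd] le]
      lepoll_trans[OF second_countable_lepoll_real[OF haus sc] le] by blast+
  obtain N1 P where P: "openin (prod_topology M M) N1" "\<And>x. x \<in> topspace M \<Longrightarrow> (x, x) \<in> N1"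
    "continuous_map (prod_topology (subtopology (prod_topology M M) N1) I01) M P"
    "\<And>x y. (x, y) \<in> N1 \<Longrightarrow> P ((x, y), 0) = y" "\<And>x y. (x, y) \<in> N1 \<Longrightarrow> P ((x, y), 1) = x"
    "\<And>x u. x \<in> topspace M \<Longrightarrow> 0 \<le> u \<Longrightarrow> u \<le> 1 \<Longrightarrow> P ((x, x), u) = x"
    by (erule manifold_paths[OF mfd])
  obtain N2 \<phi> where \<phi>: "openin (prod_topology M M) N2" "\<And>x. x \<in> topspace M \<Longrightarrow> (x, x) \<in> N2"
    "continuous_map (subtopology (prod_topology M M) N2) ?T \<phi>" "\<And>x. \<phi> (x, x) = ?z x"
    "\<And>x y. (x, y) \<in> N2 \<Longrightarrow> x \<noteq> y \<Longrightarrow> \<phi> (x, y) \<in> ?Tnz"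
    by (erule manifold_vectors[OF mfd])
  define N where "N = N1 \<inter> N2"
  have N: "openin (prod_topology M M) N"
    unfolding N_def using P(1) \<phi>(1) by (rule openin_Int)
  have diag: "(x, x) \<in> N" if "x \<in> topspace M" for x
    using P(2) \<phi>(2) that by (simp add: N_def)
  have "continuous_map (subtopology (prod_topology M M) N) (subtopology (prod_topology M M) N1) id"
    by (auto simp: N_def continuous_map_in_subtopology continuous_map_from_subtopology)
  then have "continuous_map (prod_topology (subtopology (prod_topology M M) N) I01)
      (prod_topology (subtopology (prod_topology M M) N1) I01) (\<lambda>p. (id (fst p), snd p))"
    using continuous_map_compose[OF continuous_map_fst] continuous_map_snd
    by (fastforce simp: continuous_map_pairwise comp_def)
  from continuous_map_compose[OF this P(3)]
  have PN: "continuous_map (prod_topology (subtopology (prod_topology M M) N) I01) M P"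
    by (simp add: comp_def)
  have \<phi>N: "continuous_map (subtopology (prod_topology M M) N) ?T \<phi>"
    using continuous_map_from_subtopology_mono[OF \<phi>(3)] by (simp add: N_def)
  have t: "t \<in> carrier (coh h (int m) ?T ?Tnz)"
    using assms(10) by (simp add: manifold_orientation_def thom_class_def)
  let ?e = "coh_ind h (int m) E {} ?T ?Tnz (?z \<circ> ev) t"
  \<comment> \<open>The class is arbitrary here because the induction applies the step to
    \<open>b\<close> after several loops have already been shrunk, while \<open>?e\<close> stays the
    same.\<close>
  have step: "coh_cup h E {} {} k (int m) c ?e
      = coh_cup h E {} {} k (int m) (coh_ind h k E {} E {} (shrink_circles n {i}) c) ?e"
    if "i < n" "c \<in> carrier (coh h k E {})" for i c
    unfolding ev_def E
  proof (rule coh_cup_shrink_circle[OF mult leEI[unfolded E] leE[unfolded E] leT haus N diag \<phi>N _ _ _ PN])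
    show "\<phi> (x, x) = ?z x" for x
      by (rule \<phi>(4))
  qed (use P(4-6) \<phi>(5) that t in \<open>auto simp: N_def E\<close>)
  have shrink_cont: "continuous_map E E (shrink_circles n S)" for S
    unfolding E by (rule continuous_map_shrink_circles)
  have shrink_pair: "pair_map E {} E {} (shrink_circles n S)" for S
    using shrink_cont by (simp add: pair_map_def)
  have all: "coh_cup h E {} {} k (int m) b ?e
      = coh_cup h E {} {} k (int m) (coh_ind h k E {} E {} (shrink_circles n {..<j}) b) ?e" if "j \<le> n" for j
    using that
  proof (induction j)
    case 0
    have "coh_ind h k E {} E {} (shrink_circles n {..<0}) b = coh_ind h k E {} E {} id b"
    proof (rule coh_ind_cong[OF coh leE leE shrink_pair _ b])
      fix \<gamma> assume "\<gamma> \<in> topspace E"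
      then have "\<gamma> \<in> extensional (topspace (wedge_circles n))"
        by (simp add: E topspace_mapping_space)
      then show "shrink_circles n {..<0} \<gamma> = id \<gamma>"
        by (simp add: shrink_circles_def extensional_restrict)
    qed
    then show ?case
      using coh_ind_id[OF coh leE b] by simp
  next
    case (Suc j)
    let ?b = "coh_ind h k E {} E {} (shrink_circles n {..<j}) b"
    have b': "?b \<in> carrier (coh h k E {})"
      by (rule coh_ind_closed[OF coh leE leE shrink_pair b])
    have j: "j \<le> n" "j < n"
      using Suc.prems by auto
    have "coh_cup h E {} {} k (int m) b ?e
        = coh_cup h E {} {} k (int m) (coh_ind h k E {} E {} (shrink_circles n {j}) ?b) ?e"
      by (rule trans[OF Suc.IH[OF j(1)] step[OF j(2) b']])
    also have "coh_ind h k E {} E {} (shrink_circles n {j}) ?b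
        = coh_ind h k E {} E {} (shrink_circles n {..<j} \<circ> shrink_circles n {j}) b"
      by (rule coh_ind_comp[OF coh leE leE leE shrink_pair shrink_pair b, symmetric])
    \<comment> \<open>The base point has index \<open>n\<close>, which is not below
      \<open>Suc j\<close>, so the first shrinking leaves the base value unchanged and the second
      uses the same one.\<close>
    also have "shrink_circles n {..<j} \<circ> shrink_circles n {j} = shrink_circles n {..<Suc j}"
      using Suc.prems wedge_base_in_topspace[of n]
      by (auto simp: fun_eq_iff shrink_circles_def wedge_base_def lessThan_Suc)
    finally show ?case .
  qed
  have ev_pair: "pair_map E {} M {} ev"
    unfolding pair_map_def E ev_def using continuous_map_eval[OF wedge_base_in_topspace] by simp
  have \<sigma>_pair: "pair_map M {} E {} \<sigma>"
  proof -
    have "continuous_map M (mapping_space (wedge_circles n) M) (const_map (wedge_circles n))"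
    proof (rule continuous_map_into_wedge_maps)
      fix j assume j: "j < n"
      have "continuous_map (prod_topology M I01) M fst"
        by (rule continuous_map_fst)
      then show "continuous_map (prod_topology M I01) M (\<lambda>(x, \<theta>). const_map (wedge_circles n) x (wedge_loop n j \<theta>))"
        by (rule continuous_map_eq) (use wedge_loop_in_topspace[OF j] in \<open>auto simp: const_map_def\<close>)
    qed (simp_all add: const_map_def wedge_base_in_topspace)
    then show ?thesis
      by (simp add: pair_map_def E \<sigma>_def W_def)
  qed
  have "coh_ind h k E {} E {} (shrink_circles n {..<n}) b = coh_ind h k E {} E {} (\<sigma> \<circ> ev) b"
  proof (rule coh_ind_cong[OF coh leE leE shrink_pair _ b])
    fix \<gamma> assume "\<gamma> \<in> topspace E"
    have "(if fst w \<in> {..<n} then \<gamma> (wedge_base n) else \<gamma> w) = \<gamma> (wedge_base n)"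
      if "w \<in> topspace (wedge_circles n)" for w
      using that by (auto simp: topspace_wedge_circles)
    then show "shrink_circles n {..<n} \<gamma> = (\<sigma> \<circ> ev) \<gamma>"
      by (auto simp: shrink_circles_def \<sigma>_def const_map_def ev_def W_def intro!: restrict_ext)
  qed
  also have "\<dots> = coh_ind h k E {} M {} ev (coh_ind h k M {} E {} \<sigma> b)"
    by (rule coh_ind_comp[OF coh leE leM leE ev_pair \<sigma>_pair b])
  finally have b_end: "coh_ind h k E {} E {} (shrink_circles n {..<n}) b
      = coh_ind h k E {} M {} ev (coh_ind h k M {} E {} \<sigma> b)" .
  have z_pair: "pair_map M {} ?T ?Tnz ?z"
  proof -
    have "continuous_map M (subtopology (prod_topology M M) N) (\<lambda>x. (x, x))"
      using diag by (auto simp: continuous_map_in_subtopology continuous_map_pairwise comp_def)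
    from continuous_map_compose[OF this \<phi>N] have "continuous_map M ?T ?z"
      by (simp add: comp_def \<phi>(4))
    then show ?thesis
      by (simp add: pair_map_def)
  qed
  \<comment> \<open>The Euler class is the pullback of the Thom class along the zero section, so
    both sides are its pullback along the composite with \<open>ev\<close>.\<close>
  have "?e = coh_ind h (int m) E {} M {} ev e"
    unfolding e_def manifold_euler_class_def euler_class_def
    by (rule coh_ind_comp[OF coh leE leM leT ev_pair z_pair t])
  with all[OF order_refl] show ?thesis
    unfolding b_end by (simp only:)
qed

end
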